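(* Let $n\ge 1$, let $w_n\ge\dots\ge w_1>0$ be real weights and let $B\in\{1,\dots,n\}$. Consider the (1+1) EA (defined in the context) minimising the penalised fitness \[ f(x)=\sum_{i=1}^n w_i x_i+\max\{0,\,B-b(x)\}\cdot(n w_n+1),\qquad b(x)=\sum_{i=1}^n x_i . \] Then the expected optimisation time of the (1+1) EA is $O(n^2\log^+ B)$, where $\log^+(x):=\max\{1,\log x\}$. Moreover, for every constant $c>0$, the optimisation time is $O(n^2\log n)$ with probability $1-O(n^{-c})$. The constants hidden in the $O$-notation do not depend on $n$, the weights, or $B$ (the second one may depend on $c$).
   Context: Problem: minimise $f_{\mathrm{obj}}(x)=\sum_{i=1}^n w_ix_i$ over $x\in\{0,1\}^n$ subject to the uniform constraint $x_1+\dots+x_n\ge B$. A search point is optimal if it satisfies the constraint and minimises $f_{\mathrm{obj}}$ among all points satisfying the constraint. (1+1) EA: choose $x_0$ uniformly at random from $\{0,1\}^n$; in each iteration create $x'$ by flipping each bit of $x_t$ independently with probability $1/n$; set $x_{t+1}=x'$ if $f(x')\le f(x_t)$, otherwise $x_{t+1}=x_t$. The optimisation time is the number of iterations until an optimal search point has been sampled for the first time. *)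

theory Defs
  imports "HOL-Probability.Probability"
begin

text \<open>Search points x in {0,1}^n are functions nat => bool, with x i the i-th bit
  for i in {1..n} and x i = False outside {1..n}.\<close>

definition search_space :: "nat \<Rightarrow> (nat \<Rightarrow> bool) set" where
  "search_space n = {x. \<forall>i. i \<notin> {1..n} \<longrightarrow> \<not> x i}"

definition ones :: "nat \<Rightarrow> (nat \<Rightarrow> bool) \<Rightarrow> nat" where
  "ones n x = card {i \<in> {1..n}. x i}"

definition f_obj :: "nat \<Rightarrow> (nat \<Rightarrow> real) \<Rightarrow> (nat \<Rightarrow> bool) \<Rightarrow> real" where
  "f_obj n w x = (\<Sum>i\<in>{1..n}. if x i then w i else 0)"

definition f_pen :: "nat \<Rightarrow> (nat \<Rightarrow> real) \<Rightarrow> nat \<Rightarrow> (nat \<Rightarrow> bool) \<Rightarrow> real" where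
  "f_pen n w B x = f_obj n w x + max 0 (real B - real (ones n x)) * (real n * w n + 1)"

definition optimal :: "nat \<Rightarrow> (nat \<Rightarrow> real) \<Rightarrow> nat \<Rightarrow> (nat \<Rightarrow> bool) \<Rightarrow> bool" where
  "optimal n w B x \<longleftrightarrow> x \<in> search_space n \<and> ones n x \<ge> B \<and>
     (\<forall>y \<in> search_space n. ones n y \<ge> B \<longrightarrow> f_obj n w x \<le> f_obj n w y)"

definition init_pmf :: "nat \<Rightarrow> (nat \<Rightarrow> bool) pmf" where
  "init_pmf n = Pi_pmf {1..n} False (\<lambda>_. bernoulli_pmf (1/2))"

definition flip_mask :: "nat \<Rightarrow> (nat \<Rightarrow> bool) pmf" where
  "flip_mask n = Pi_pmf {1..n} False (\<lambda>_. bernoulli_pmf (1 / real n))"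

text \<open>State of the run: current search point x_t and a flag recording whether an
  optimal search point has been sampled so far (in x_0 or any offspring).\<close>
definition ea_start :: "nat \<Rightarrow> (nat \<Rightarrow> real) \<Rightarrow> nat \<Rightarrow> ((nat \<Rightarrow> bool) \<times> bool) pmf" where
  "ea_start n w B = map_pmf (\<lambda>x. (x, optimal n w B x)) (init_pmf n)"

definition ea_step :: "nat \<Rightarrow> (nat \<Rightarrow> real) \<Rightarrow> nat \<Rightarrow> (nat \<Rightarrow> bool) \<times> bool
    \<Rightarrow> ((nat \<Rightarrow> bool) \<times> bool) pmf" where
  "ea_step n w B s = map_pmf (\<lambda>m.
      let x = fst s; x' = (\<lambda>i. x i \<noteq> m i)
      in (if f_pen n w B x' \<le> f_pen n w B x then x' else x, snd s \<or> optimal n w B x'))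
    (flip_mask n)"

definition ea_state :: "nat \<Rightarrow> (nat \<Rightarrow> real) \<Rightarrow> nat \<Rightarrow> nat \<Rightarrow> ((nat \<Rightarrow> bool) \<times> bool) pmf" where
  "ea_state n w B t = ((\<lambda>D. bind_pmf D (ea_step n w B)) ^^ t) (ea_start n w B)"

text \<open>Pr[T > t]: no optimal search point sampled within the first t iterations.\<close>
definition tail_prob :: "nat \<Rightarrow> (nat \<Rightarrow> real) \<Rightarrow> nat \<Rightarrow> nat \<Rightarrow> real" where
  "tail_prob n w B t = measure_pmf.prob (ea_state n w B t) {s. \<not> snd s}"

text \<open>E[T] = sum over t >= 0 of Pr[T > t] (in ennreal, so infinity is allowed).\<close>
definition expected_time :: "nat \<Rightarrow> (nat \<Rightarrow> real) \<Rightarrow> nat \<Rightarrow> ennreal" where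
  "expected_time n w B = (\<Sum>t. ennreal (tail_prob n w B t))"

definition valid_instance :: "nat \<Rightarrow> (nat \<Rightarrow> real) \<Rightarrow> nat \<Rightarrow> bool" where
  "valid_instance n w B \<longleftrightarrow> n \<ge> 1 \<and> w 1 > 0 \<and>
     (\<forall>i j. 1 \<le> i \<longrightarrow> i \<le> j \<longrightarrow> j \<le> n \<longrightarrow> w i \<le> w j) \<and> 1 \<le> B \<and> B \<le> n"

end

theory Submission
  imports Defs
begin

text \<open>
  A search point is described by its set \<open>Y\<close> of bits that differ from the optimum \<open>1\<^sup>B0\<^sup>n\<^sup>-\<^sup>B\<close>. Writing
  \<open>d\<^sub>i = |w\<^sub>i - w\<^sub>B|\<close> and \<open>s = b(x) - B\<close>, the fitness of a feasible point exceeds the optimum by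
  \<open>\<Sum>\<^sub>i\<^sub>\<in>\<^sub>Y d\<^sub>i + s w\<^sub>B\<close>. As in Witt's analysis of linear functions, the numbers \<open>d\<^sub>i\<close> and \<open>w\<^sub>B\<close> are
  replaced by \<open>\<phi>(d\<^sub>i)\<close> and \<open>\<phi>(w\<^sub>B)\<close>, which lie between 1 and an absolute constant, grow at most as fast
  as the originals, and jump by suitable factors \<open>(1 + O(1/n))\<^sup>k\<close> wherever they grow more slowly. An
  accepted step then loses potential only on bits far below the largest repaired one.
  Without surplus, swapping two misplaced bits of opposite sides gives a multiplicative drift of order
  \<open>1/n\<^sup>2\<close>; the losses of steps repairing a single bit are paid for by its plain swaps with correct bits
  of the same side. With surplus, removing single one-bits gives drift of order \<open>1/n\<close>. Since
  a point without surplus has at most \<open>2B\<close> misplaced bits, its potential is \<open>O(B)\<close>, which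
  yields \<open>O(n\<^sup>2 log B)\<close>; the tail bound follows from multiplicative drift alone.
\<close>

section \<open>Standard bit mutation\<close>

definition mutation_mean :: "nat \<Rightarrow> (nat set \<Rightarrow> real) \<Rightarrow> real" where
  "mutation_mean n h =
     (\<Sum>F\<in>Pow {1..n}. (1 / real n) ^ card F * (1 - 1 / real n) ^ (n - card F) * h F)"

lemma mutation_mean_add:
  "mutation_mean n (\<lambda>F. h F + k F) = mutation_mean n h + mutation_mean n k"
  unfolding mutation_mean_def by (simp add: distrib_left sum.distrib)

lemma mutation_mean_diff:
  "mutation_mean n (\<lambda>F. h F - k F) = mutation_mean n h - mutation_mean n k"
  unfolding mutation_mean_def by (simp add: right_diff_distrib sum_subtractf)

lemma mutation_mean_sum:
  "mutation_mean n (\<lambda>F. \<Sum>i\<in>A. h i F) = (\<Sum>i\<in>A. mutation_mean n (h i))"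
  unfolding mutation_mean_def by (simp add: sum_distrib_left sum.swap[of _ A])

lemma mutation_mean_cmult:
  "mutation_mean n (\<lambda>F. c * h F) = c * mutation_mean n h"
  unfolding mutation_mean_def by (simp add: sum_distrib_left algebra_simps)

lemma mutation_weight_nonneg:
  "0 \<le> (1 / real n) ^ k * (1 - 1 / real n) ^ j"
  by (cases n) (auto intro!: mult_nonneg_nonneg zero_le_power)

lemma mutation_mean_mono:
  assumes "\<And>F. F \<subseteq> {1..n} \<Longrightarrow> h F \<le> k F"
  shows "mutation_mean n h \<le> mutation_mean n k"
  unfolding mutation_mean_def
  using assms mutation_weight_nonneg by (auto intro!: sum_mono mult_left_mono)

lemma mutation_mean_superset:
  assumes "Q \<subseteq> {1..n}"
  shows "mutation_mean n (\<lambda>F. of_bool (Q \<subseteq> F)) = (1 / real n) ^ card Q"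
proof -
  let ?p = "1 / real n" and ?D = "{1..n} - Q"
  have finQ: "finite Q" and finD: "finite ?D"
    using assms finite_subset by auto
  have card_n: "card Q + card ?D = n"
    using assms card_Un_disjoint[of Q ?D] finQ finD by (simp add: Un_absorb1)
  have "mutation_mean n (\<lambda>F. of_bool (Q \<subseteq> F)) =
      (\<Sum>F\<in>{F \<in> Pow {1..n}. Q \<subseteq> F}. ?p ^ card F * (1 - ?p) ^ (n - card F))"
    unfolding mutation_mean_def
    by (rule sum.mono_neutral_cong_right) auto
  also have "\<dots> = (\<Sum>G\<in>Pow ?D. ?p ^ card (Q \<union> G) * (1 - ?p) ^ (n - card (Q \<union> G)))"
    using assms
    by (intro sum.reindex_bij_witness[of _ "\<lambda>G. Q \<union> G" "\<lambda>F. F - Q"])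
       (auto simp: Un_absorb1)
  also have "\<dots> = (\<Sum>G\<in>Pow ?D. ?p ^ card Q * (?p ^ card G * (1 - ?p) ^ card (?D - G)))"
  proof (rule sum.cong[OF refl])
    fix G assume G: "G \<in> Pow ?D"
    then have finG: "finite G" using finD finite_subset by auto
    have "card (Q \<union> G) = card Q + card G"
      using G finQ finG by (intro card_Un_disjoint) auto
    moreover have "card (?D - G) = card ?D - card G" "card G \<le> card ?D"
      using G finD finG by (auto intro: card_Diff_subset card_mono)
    moreover from calculation have "n - card (Q \<union> G) = card (?D - G)"
      using card_n by linarith
    ultimately show "?p ^ card (Q \<union> G) * (1 - ?p) ^ (n - card (Q \<union> G)) =
        ?p ^ card Q * (?p ^ card G * (1 - ?p) ^ card (?D - G))"
      by (simp add: power_add)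
  qed
  also have "\<dots> = ?p ^ card Q * (\<Sum>G\<in>Pow ?D. (\<Prod>_\<in>G. ?p) * (\<Prod>_\<in>?D - G. 1 - ?p))"
    by (simp add: sum_distrib_left)
  also have "(\<Sum>G\<in>Pow ?D. (\<Prod>_\<in>G. ?p) * (\<Prod>_\<in>?D - G. 1 - ?p)) = (\<Prod>_\<in>?D. ?p + (1 - ?p))"
    using prod_add[OF finD, of "\<lambda>_. ?p" "\<lambda>_. 1 - ?p"] by simp
  finally show ?thesis by simp
qed

lemma mutation_mean_const: "mutation_mean n (\<lambda>F. c) = c"
  using mutation_mean_superset[of "{}" n] mutation_mean_cmult[of n c "\<lambda>_. 1"] by simp

lemma one_minus_inverse_power_ge_third:
  assumes "n \<ge> 1" "k \<le> n - 1"
  shows "1 / 3 \<le> (1 - 1 / real n) ^ k"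
proof (cases "n = 1")
  case True
  then show ?thesis using assms by simp
next
  case False
  then have n: "n \<ge> 2" using assms by simp
  define m where "m = n - 1"
  have m: "m \<ge> 1" "real n = real m + 1" using n by (auto simp: m_def)
  have "(1 + 1 / real m) ^ m \<le> exp (1 / real m) ^ m"
    using m exp_ge_add_one_self by (intro power_mono) auto
  also have "\<dots> = exp 1" using m by (simp flip: exp_of_nat_mult)
  also have "\<dots> \<le> 3" by (rule exp_le)
  finally have "(1 + 1 / real m) ^ m \<le> 3" .
  moreover have "1 + 1 / real m > 0" using m by (simp add: field_simps)
  ultimately have "1 / 3 \<le> 1 / (1 + 1 / real m) ^ m"
    by (simp add: field_simps)
  also have "\<dots> = (1 - 1 / real n) ^ m"
    using m by (simp add: m(2) power_one_over[symmetric] field_simps)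
  also have "\<dots> \<le> (1 - 1 / real n) ^ k"
    using assms n by (intro power_decreasing) (auto simp: m_def)
  finally show ?thesis .
qed

lemma mutation_mean_ge_sum:
  assumes n: "n \<ge> 1" and sub: "\<F> \<subseteq> Pow {1..n} - {{}}"
    and nonneg: "\<And>F. F \<subseteq> {1..n} \<Longrightarrow> 0 \<le> h F"
  shows "(\<Sum>F\<in>\<F>. (1 / real n) ^ card F * h F) / 3 \<le> mutation_mean n h"
proof -
  have "(\<Sum>F\<in>\<F>. (1 / real n) ^ card F * h F) / 3
      = (\<Sum>F\<in>\<F>. (1 / real n) ^ card F * (1 / 3) * h F)"
    by (simp add: sum_divide_distrib)
  also have "\<dots> \<le> (\<Sum>F\<in>\<F>. (1 / real n) ^ card F * (1 - 1 / real n) ^ (n - card F) * h F)"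
  proof (rule sum_mono)
    fix F assume F: "F \<in> \<F>"
    then have "F \<subseteq> {1..n}" "F \<noteq> {}" using sub by auto
    moreover from this have "card F \<noteq> 0" using finite_subset[of F "{1..n}"] by auto
    ultimately show "(1 / real n) ^ card F * (1 / 3) * h F
        \<le> (1 / real n) ^ card F * (1 - 1 / real n) ^ (n - card F) * h F"
      using n one_minus_inverse_power_ge_third[of n "n - card F"] nonneg[of F]
      by (intro mult_right_mono mult_left_mono) auto
  qed
  also have "\<dots> \<le> mutation_mean n h"
    unfolding mutation_mean_def
  proof (rule sum_mono2)
    fix F assume "F \<in> Pow {1..n} - \<F>"
    then show "0 \<le> (1 / real n) ^ card F * (1 - 1 / real n) ^ (n - card F) * h F"
      by (intro mult_nonneg_nonneg[OF mutation_weight_nonneg] nonneg) auto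
  qed (use sub in auto)
  finally show ?thesis .
qed

lemma mutation_mean_card_superset_le:
  assumes "n \<ge> 1" "Q \<subseteq> {1..n}"
  shows "mutation_mean n (\<lambda>F. of_bool (Q \<subseteq> F) * real (card F))
    \<le> (real (card Q) + 1) * (1 / real n) ^ card Q"
proof -
  let ?p = "1 / real n"
  have finQ: "finite Q" using assms finite_subset by blast
  have "mutation_mean n (\<lambda>F. of_bool (Q \<subseteq> F) * real (card F))
      \<le> mutation_mean n (\<lambda>F. \<Sum>l\<in>{1..n}. of_bool (insert l Q \<subseteq> F))"
  proof (rule mutation_mean_mono)
    fix F assume F: "F \<subseteq> {1..n}"
    then have "real (card F) = (\<Sum>l\<in>{1..n}. of_bool (l \<in> F))"
      by (simp add: Int_absorb1)
    then show "of_bool (Q \<subseteq> F) * real (card F) \<le> (\<Sum>l\<in>{1..n}. of_bool (insert l Q \<subseteq> F))"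
      by (auto simp: of_bool_def)
  qed
  also have "\<dots> = (\<Sum>l\<in>{1..n}. ?p ^ card (insert l Q))"
    unfolding mutation_mean_sum using assms
    by (intro sum.cong refl mutation_mean_superset) auto
  also have "\<dots> \<le> (\<Sum>l\<in>{1..n}. of_bool (l \<in> Q) * ?p ^ card Q + ?p * ?p ^ card Q)"
    using finQ by (intro sum_mono) (auto simp: card_insert_if insert_absorb)
  also have "\<dots> = (real (card Q) + 1) * ?p ^ card Q"
    using assms by (simp add: sum.distrib Int_absorb1 Int_absorb2 flip: sum_distrib_right)
       (simp add: field_simps)
  finally show ?thesis .
qed

section \<open>Capping the growth of the weights\<close>

text \<open>On a logarithmic scale \<open>\<phi>\<close> is the largest function below \<open>b\<close> times the sup-convolution
  \<open>fa\<close> of \<open>a\<close> that grows at most as fast as the identity. The cap \<open>b\<close> makes \<open>\<phi>\<close> jump at a cut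
  \<open>\<kappa>\<close> by the amount of mass below it, while \<open>fa\<close> contributes the mass of the linear stretch above it.\<close>

lemma capped_growth_exists:
  fixes V :: "real set" and a b :: "real \<Rightarrow> real"
  assumes fin: "finite V" and pos: "\<And>v. v \<in> V \<Longrightarrow> 0 < v"
    and a: "\<And>v. v \<in> V \<Longrightarrow> 1 \<le> a v" "\<And>v. v \<in> V \<Longrightarrow> a v \<le> Ma"
      "\<And>u v. u \<in> V \<Longrightarrow> v \<in> V \<Longrightarrow> u \<le> v \<Longrightarrow> a u \<le> a v"
    and b: "\<And>v. v \<in> V \<Longrightarrow> 1 \<le> b v" "\<And>v. v \<in> V \<Longrightarrow> b v \<le> Mb"
      "\<And>u v. u \<in> V \<Longrightarrow> v \<in> V \<Longrightarrow> u < v \<Longrightarrow> b u < b v"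
  shows "\<exists>\<phi>. (\<forall>v\<in>V. 1 \<le> \<phi> v \<and> \<phi> v \<le> Mb * Ma)
    \<and> (\<forall>u\<in>V. \<forall>v\<in>V. u \<le> v \<longrightarrow> \<phi> u \<le> \<phi> v)
    \<and> (\<forall>v\<in>V. \<exists>\<kappa>\<in>V. \<kappa> \<le> v
        \<and> (\<forall>u\<in>V. \<kappa> \<le> u \<longrightarrow> \<phi> u * \<kappa> \<le> \<phi> \<kappa> * u)
        \<and> (\<forall>u\<in>V. u \<le> v \<longrightarrow> \<phi> \<kappa> * u \<le> \<phi> u * \<kappa>)
        \<and> (\<forall>l\<in>V. l < \<kappa> \<longrightarrow> \<phi> l * b \<kappa> \<le> \<phi> \<kappa> * b l
            \<and> (\<exists>y\<in>V. l \<le> y \<and> y < \<kappa> \<and> \<phi> l * b \<kappa> * a v \<le> \<phi> v * b l * a y)))"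
proof -
  define fa where "fa u = Max ((\<lambda>y. a y * u / y) ` {y \<in> V. u \<le> y})" for u
  define \<phi> where "\<phi> v = Min ((\<lambda>u. b u * fa u * v / u) ` {u \<in> V. u \<le> v})" for v
  have fa_ge: "a y * u / y \<le> fa u" if "y \<in> V" "u \<le> y" for u y
    unfolding fa_def using fin that by (intro Max_ge) auto
  have fa_ex: "\<exists>y\<in>V. u \<le> y \<and> fa u = a y * u / y" if "u \<in> V" for u
  proof -
    have "fa u \<in> (\<lambda>y. a y * u / y) ` {y \<in> V. u \<le> y}"
      unfolding fa_def using fin that by (intro Max_in) auto
    then show ?thesis by auto
  qed
  have fa_ge_a: "a u \<le> fa u" if "u \<in> V" for u
    using fa_ge[of u u] that pos[of u] by simp
  have fa_pos: "1 \<le> fa u" if "u \<in> V" for u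
    using fa_ge_a[OF that] a(1)[OF that] by simp
  have fa_le: "fa u \<le> Ma" if u: "u \<in> V" for u
  proof -
    obtain y where y: "y \<in> V" "u \<le> y" "fa u = a y * u / y" using fa_ex[OF u] by auto
    have "a y * u / y \<le> a y * 1"
      using y u pos[of y] a(1)[of y] by (simp add: field_simps)
    then show ?thesis using y a(2)[of y] by simp
  qed
  have fa_mono: "fa u \<le> fa v" if u: "u \<in> V" "v \<in> V" "u \<le> v" for u v
  proof -
    obtain y where y: "y \<in> V" "u \<le> y" "fa u = a y * u / y" using fa_ex[OF u(1)] by auto
    show ?thesis
    proof (cases "v \<le> y")
      case True
      have "a y * u / y \<le> a y * v / y"
        using y u pos[of y] a(1)[of y] by (intro divide_right_mono mult_left_mono) auto
      then show ?thesis using fa_ge[of y v] True y by simp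
    next
      case False
      have "a y * u / y \<le> a y * 1"
        using y u pos[of y] a(1)[of y] by (simp add: field_simps)
      also have "\<dots> \<le> a v" using a(3)[of y v] False y u by simp
      finally show ?thesis using fa_ge_a[of v] u y by simp
    qed
  qed
  have phi_le: "\<phi> v \<le> b u * fa u * v / u" if "u \<in> V" "u \<le> v" for u v
    unfolding \<phi>_def using fin that by (intro Min_le) auto
  have phi_ex: "\<exists>u\<in>V. u \<le> v \<and> \<phi> v = b u * fa u * v / u" if "v \<in> V" for v
  proof -
    have "\<phi> v \<in> (\<lambda>u. b u * fa u * v / u) ` {u \<in> V. u \<le> v}"
      unfolding \<phi>_def using fin that by (intro Min_in) auto
    then show ?thesis by auto
  qed
  have phi_le_bfa: "\<phi> v \<le> b v * fa v" if "v \<in> V" for v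
    using phi_le[of v v] that pos[of v] by simp
  have bfa_ge1: "1 \<le> b v * fa v" if "v \<in> V" for v
    using mult_mono[of 1 "b v" 1 "fa v"] b(1)[OF that] fa_pos[OF that] by simp
  have phi_ge1: "1 \<le> \<phi> v" if v: "v \<in> V" for v
  proof -
    obtain u where u: "u \<in> V" "u \<le> v" "\<phi> v = b u * fa u * v / u" using phi_ex[OF v] by auto
    have "b u * fa u * 1 \<le> b u * fa u * (v / u)"
      using u pos[of u] bfa_ge1[of u] by (intro mult_left_mono) auto
    then show ?thesis using bfa_ge1[of u] u by simp
  qed
  have phi_leM: "\<phi> v \<le> Mb * Ma" if v: "v \<in> V" for v
  proof -
    have "b v * fa v \<le> Mb * Ma"
      using b(1,2)[OF v] fa_le[OF v] fa_pos[OF v] by (intro mult_mono) auto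
    then show ?thesis using phi_le_bfa[OF v] by simp
  qed
  have phi_ratio: "\<phi> v * u \<le> \<phi> u * v" if uv: "u \<in> V" "v \<in> V" "u \<le> v" for u v
  proof -
    obtain y where y: "y \<in> V" "y \<le> u" "\<phi> u = b y * fa y * u / y" using phi_ex[OF uv(1)] by auto
    have "\<phi> v \<le> b y * fa y * v / y" using phi_le[of y v] y uv by simp
    then have "\<phi> v * u \<le> b y * fa y * v / y * u"
      using pos[OF uv(1)] by (intro mult_right_mono) auto
    then show ?thesis using y by (simp add: ac_simps)
  qed
  have phi_mono: "\<phi> u \<le> \<phi> v" if uv: "u \<in> V" "v \<in> V" "u \<le> v" for u v
  proof -
    obtain y where y: "y \<in> V" "y \<le> v" "\<phi> v = b y * fa y * v / y" using phi_ex[OF uv(2)] by auto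
    show ?thesis
    proof (cases "y \<le> u")
      case True
      have "b y * fa y * u / y \<le> b y * fa y * v / y"
        using uv y pos[of y] bfa_ge1[of y] by (intro divide_right_mono mult_left_mono) auto
      then show ?thesis using phi_le[of y u] True y by simp
    next
      case False
      have "\<phi> u \<le> b u * fa u" using phi_le_bfa uv by simp
      also have "\<dots> \<le> b y * fa y"
        using False y uv b(1)[of u] b(3)[of u y] fa_mono[of u y] fa_pos[of u]
        by (intro mult_mono) auto
      also have "\<dots> \<le> b y * fa y * (v / y)"
        using mult_left_mono[of 1 "v / y" "b y * fa y"] bfa_ge1[of y] y pos[of y] by simp
      finally show ?thesis using y by simp
    qed
  qed
  have cut: "\<exists>\<kappa>\<in>V. \<kappa> \<le> v
        \<and> (\<forall>u\<in>V. \<kappa> \<le> u \<longrightarrow> \<phi> u * \<kappa> \<le> \<phi> \<kappa> * u)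
        \<and> (\<forall>u\<in>V. u \<le> v \<longrightarrow> \<phi> \<kappa> * u \<le> \<phi> u * \<kappa>)
        \<and> (\<forall>l\<in>V. l < \<kappa> \<longrightarrow> \<phi> l * b \<kappa> \<le> \<phi> \<kappa> * b l
            \<and> (\<exists>y\<in>V. l \<le> y \<and> y < \<kappa> \<and> \<phi> l * b \<kappa> * a v \<le> \<phi> v * b l * a y))"
    if v: "v \<in> V" for v
  proof -
    obtain \<kappa> where k: "\<kappa> \<in> V" "\<kappa> \<le> v" "\<phi> v = b \<kappa> * fa \<kappa> * v / \<kappa>"
      using phi_ex[OF v] by auto
    have kpos: "0 < \<kappa>" and vpos: "0 < v" using pos k v by auto
    have phik: "\<phi> \<kappa> = b \<kappa> * fa \<kappa>"
    proof (rule antisym)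
      show "\<phi> \<kappa> \<le> b \<kappa> * fa \<kappa>" using phi_le_bfa k by simp
      have "\<phi> v * \<kappa> = b \<kappa> * fa \<kappa> * v" using k(3) kpos by simp
      then have "b \<kappa> * fa \<kappa> * v \<le> \<phi> \<kappa> * v" using phi_ratio[of \<kappa> v] k v by simp
      then show "b \<kappa> * fa \<kappa> \<le> \<phi> \<kappa>" using vpos by simp
    qed
    have lower: "\<phi> \<kappa> * u \<le> \<phi> u * \<kappa>" if u: "u \<in> V" "u \<le> v" for u
    proof -
      have "\<phi> v * \<kappa> = \<phi> \<kappa> * v" using k(3) phik kpos by simp
      then have "\<phi> \<kappa> * v * u = \<phi> v * u * \<kappa>" by (simp add: ac_simps)
      also have "\<dots> \<le> \<phi> u * v * \<kappa>"
        using phi_ratio[of u v] u v kpos by (intro mult_right_mono) auto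
      finally have "v * (\<phi> \<kappa> * u) \<le> v * (\<phi> u * \<kappa>)" by (simp add: ac_simps)
      then show ?thesis using vpos by simp
    qed
    have growth: "\<phi> l * b \<kappa> \<le> \<phi> \<kappa> * b l
            \<and> (\<exists>y\<in>V. l \<le> y \<and> y < \<kappa> \<and> \<phi> l * b \<kappa> * a v \<le> \<phi> v * b l * a y)"
      if l: "l \<in> V" "l < \<kappa>" for l
    proof -
      have bl: "1 \<le> b l" "1 \<le> b \<kappa>" "b l < b \<kappa>" and lpos: "0 < l" using b l k pos by auto
      have "\<phi> l * b \<kappa> \<le> b l * fa l * b \<kappa>"
        using phi_le_bfa[of l] l bl by (intro mult_right_mono) auto
      also have "\<dots> \<le> b l * fa \<kappa> * b \<kappa>"
        using fa_mono[of l \<kappa>] l k bl by (intro mult_right_mono mult_left_mono) auto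
      finally have 1: "\<phi> l * b \<kappa> \<le> \<phi> \<kappa> * b l" by (simp add: phik ac_simps)
      obtain y where y: "y \<in> V" "l \<le> y" "fa l = a y * l / y" using fa_ex[OF l(1)] by auto
      have ypos: "0 < y" using pos y by simp
      have "y < \<kappa>"
      proof (rule ccontr)
        assume "\<not> y < \<kappa>"
        then have "a y * \<kappa> / y \<le> fa \<kappa>" using fa_ge[of y \<kappa>] y by simp
        then have "a y * \<kappa> / y * l \<le> fa \<kappa> * l" using lpos by (intro mult_right_mono) auto
        then have "fa l * \<kappa> \<le> fa \<kappa> * l" using y(3) by (simp add: ac_simps)
        moreover have "\<phi> \<kappa> * l \<le> \<phi> l * \<kappa>" using phi_ratio[of l \<kappa>] l k by simp
        moreover have "\<phi> l * \<kappa> \<le> b l * fa l * \<kappa>"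
          using phi_le_bfa[of l] l kpos by simp
        moreover from calculation(1) have "b l * (fa l * \<kappa>) \<le> b l * (fa \<kappa> * l)"
          using bl by (intro mult_left_mono) auto
        ultimately have "b \<kappa> * (fa \<kappa> * l) \<le> b l * (fa \<kappa> * l)"
          unfolding phik by argo
        moreover have "0 < fa \<kappa> * l" using fa_pos[of \<kappa>] k lpos by simp
        ultimately show False using bl mult_le_cancel_right_pos[of "fa \<kappa> * l" "b \<kappa>" "b l"] by linarith
      qed
      have "a y * l / y \<le> a y * y / y"
        using y a(1)[of y] ypos by (intro divide_right_mono mult_left_mono) auto
      then have "fa l \<le> a y" using y(3) ypos by simp
      then have "b l * fa l \<le> b l * a y" using bl by simp
      then have phil: "\<phi> l \<le> b l * a y" using phi_le_bfa[of l] l by simp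
      have "a v * \<kappa> / v \<le> fa \<kappa>" using fa_ge[of v \<kappa>] v k by simp
      then have "a v \<le> fa \<kappa> * v / \<kappa>" using kpos vpos by (simp add: field_simps)
      then have phiv: "b \<kappa> * a v \<le> \<phi> v"
        using mult_left_mono[of "a v" "fa \<kappa> * v / \<kappa>" "b \<kappa>"] bl k(3) by simp
      have "\<phi> l * (b \<kappa> * a v) \<le> (b l * a y) * \<phi> v"
        using phil phiv bl a(1)[of v] v a(1)[of y] y by (intro mult_mono) auto
      then show ?thesis using 1 y \<open>y < \<kappa>\<close> by (auto simp: ac_simps)
    qed
    have "\<phi> u * \<kappa> \<le> \<phi> \<kappa> * u" if "u \<in> V" "\<kappa> \<le> u" for u using phi_ratio[of \<kappa> u] k that by simp
    then show ?thesis using k lower growth by blast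
  qed
  show ?thesis
    using phi_ge1 phi_leM phi_mono cut by (intro exI[of _ \<phi>]) blast
qed

lemma geometric_sum_by_rank:
  fixes h v :: "'a \<Rightarrow> real"
  assumes "finite X" and g: "1 \<le> g" and K: "0 \<le> K"
    and "\<And>i. i \<in> X \<Longrightarrow> h i * g ^ card {x \<in> X. v i \<le> v x} \<le> K"
  shows "(g - 1) * sum h X \<le> K * (1 - 1 / g ^ card X)"
  using assms(1,4)
proof (induction "card X" arbitrary: X)
  case 0
  then show ?case by simp
next
  case (Suc m)
  then have "X \<noteq> {}" by auto
  then obtain z where z: "z \<in> X" "\<And>x. x \<in> X \<Longrightarrow> v z \<le> v x"
    using Suc.prems(1) ex_min_if_finite[of "v ` X"] by (auto simp: not_less) 
  have gpos: "0 < g ^ k" for k using g by simp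
  have IH: "(g - 1) * sum h (X - {z}) \<le> K * (1 - 1 / g ^ card (X - {z}))"
  proof (rule Suc.hyps(1))
    show "m = card (X - {z})" using Suc.hyps(2) z(1) Suc.prems(1) by simp
    show "finite (X - {z})" using Suc.prems by simp
    fix i assume i: "i \<in> X - {z}"
    have "card {x \<in> X - {z}. v i \<le> v x} \<le> card {x \<in> X. v i \<le> v x}"
      using Suc.prems(1) by (intro card_mono) auto
    then have le: "g ^ card {x \<in> X - {z}. v i \<le> v x} \<le> g ^ card {x \<in> X. v i \<le> v x}"
      using g by (intro power_increasing) auto
    show "h i * g ^ card {x \<in> X - {z}. v i \<le> v x} \<le> K"
    proof (cases "0 \<le> h i")
      case True
      then show ?thesis using mult_left_mono[OF le True] Suc.prems(2)[of i] i by simp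
    next
      case False
      then show ?thesis using K gpos by (smt (verit) mult_nonneg_nonneg mult_neg_pos)
    qed
  qed
  have cardX: "card X = Suc (card (X - {z}))" using z(1) Suc.prems(1) by (metis card_Suc_Diff1)
  have "{x \<in> X. v z \<le> v x} = X" using z by auto
  then have "h z \<le> K / g ^ card X"
    using Suc.prems(2)[OF z(1)] gpos by (simp add: pos_le_divide_eq)
  then have "(g - 1) * h z \<le> (g - 1) * (K / g ^ card X)"
    using g by (intro mult_left_mono) auto
  also have "\<dots> = K * (1 / g ^ card (X - {z}) - 1 / g ^ card X)"
    using g by (simp add: cardX field_simps)
  finally have "(g - 1) * (h z + sum h (X - {z})) \<le> K * (1 - 1 / g ^ card X)"
    using IH by (simp add: algebra_simps)
  then show ?case using sum.remove[of X z h] z(1) Suc.prems(1) by simp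
qed

section \<open>Gaps, surplus and the potential\<close>

locale ea_instance =
  fixes n :: nat and w :: "nat \<Rightarrow> real" and B :: nat
  assumes valid: "valid_instance n w B"
begin

lemma n_ge1: "1 \<le> n" and B_ge1: "1 \<le> B" and B_le_n: "B \<le> n"
  using valid by (auto simp: valid_instance_def)

lemma w_mono: "1 \<le> i \<Longrightarrow> i \<le> j \<Longrightarrow> j \<le> n \<Longrightarrow> w i \<le> w j"
  using valid by (auto simp: valid_instance_def)

lemma w_pos: "1 \<le> i \<Longrightarrow> i \<le> n \<Longrightarrow> 0 < w i"
  using valid[unfolded valid_instance_def, THEN conjunct2, THEN conjunct1] w_mono[of 1 i] by linarith

lemma wB_pos: "0 < w B"
  using w_pos B_ge1 B_le_n by simp

definition side :: "nat \<Rightarrow> real" where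
  "side i = (if i \<le> B then - 1 else 1)"

definition gap :: "nat \<Rightarrow> real" where
  "gap i = \<bar>w i - w B\<bar>"

text \<open>Items \<open>1..n\<close> are the bits; items \<open>n+1..2n\<close> are \<open>n\<close> copies of one unit of surplus, whose weight
  in the fitness is \<open>w B\<close>. The multiplicity \<open>n\<close> forces a constant-factor jump of \<open>\<phi>\<close> above \<open>w B\<close>,
  because several surplus units may appear in one step at constant rate.\<close>

definition item_value :: "nat \<Rightarrow> real" where
  "item_value i = (if i \<le> n then gap i else w B)"

definition levels :: "real set" where
  "levels = {v \<in> item_value ` {1..2 * n}. 0 < v}"

definition item_count :: "real \<Rightarrow> real \<Rightarrow> nat" where
  "item_count u v = card {i \<in> {1..2 * n}. u \<le> item_value i \<and> item_value i \<le> v}"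

definition surplus :: "nat set \<Rightarrow> real" where
  "surplus Y = (\<Sum>i\<in>Y. side i)"

lemma gap_nonneg [simp]: "0 \<le> gap i"
  by (simp add: gap_def)

lemma side_gap: "1 \<le> i \<Longrightarrow> i \<le> n \<Longrightarrow> w i = w B + side i * gap i"
  using w_mono[of i B] w_mono[of B i] B_ge1 B_le_n by (auto simp: side_def gap_def)

lemma gap_less_wB: "1 \<le> i \<Longrightarrow> i \<le> B \<Longrightarrow> gap i < w B"
  using w_mono[of i B] w_pos[of i] B_le_n by (auto simp: gap_def)

lemma gap_level: "i \<in> {1..n} \<Longrightarrow> 0 < gap i \<Longrightarrow> gap i \<in> levels"
  by (auto simp: levels_def item_value_def image_iff intro!: bexI[of _ i])

lemma wB_level: "w B \<in> levels"
proof -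
  have "item_value (Suc n) \<in> item_value ` {1..2 * n}" using n_ge1 by (intro imageI) auto
  then show ?thesis using wB_pos by (simp add: levels_def item_value_def)
qed

lemma level_pos: "v \<in> levels \<Longrightarrow> 0 < v"
  by (simp add: levels_def)

lemma finite_levels: "finite levels"
  by (simp add: levels_def)

end

locale ea_potential = ea_instance +
  fixes \<phi> \<kappa> :: "real \<Rightarrow> real"
  assumes phi_0: "\<phi> 0 = 0"
    and phi_ge1: "v \<in> levels \<Longrightarrow> 1 \<le> \<phi> v"
    and phi_le: "v \<in> levels \<Longrightarrow> \<phi> v \<le> exp 288"
    and phi_mono: "u \<in> levels \<Longrightarrow> v \<in> levels \<Longrightarrow> u \<le> v \<Longrightarrow> \<phi> u \<le> \<phi> v"
    and kappa_level: "v \<in> levels \<Longrightarrow> \<kappa> v \<in> levels"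
    and kappa_le: "v \<in> levels \<Longrightarrow> \<kappa> v \<le> v"
    and phi_above_kappa: "v \<in> levels \<Longrightarrow> u \<in> levels \<Longrightarrow> \<kappa> v \<le> u \<Longrightarrow> \<phi> u * \<kappa> v \<le> \<phi> (\<kappa> v) * u"
    and phi_below: "v \<in> levels \<Longrightarrow> u \<in> levels \<Longrightarrow> u \<le> v \<Longrightarrow> \<phi> (\<kappa> v) * u \<le> \<phi> u * \<kappa> v"
    and growth_kappa: "v \<in> levels \<Longrightarrow> l \<in> levels \<Longrightarrow> l < \<kappa> v \<Longrightarrow>
      \<phi> l * (1 + 48 / real n) ^ item_count l (\<kappa> v) \<le> \<phi> (\<kappa> v)"
    and growth: "v \<in> levels \<Longrightarrow> l \<in> levels \<Longrightarrow> l < \<kappa> v \<Longrightarrow>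
      \<phi> l * (1 + 48 / real n) ^ item_count l v \<le> \<phi> v"

lemma (in ea_instance) potential_exists: "\<exists>\<phi> \<kappa>. ea_potential n w B \<phi> \<kappa>"
proof -
  define g where "g = 1 + 48 / real n"
  define N where "N v = card {i \<in> {1..2 * n}. item_value i \<le> v}" for v
  define N' where "N' v = card {i \<in> {1..2 * n}. item_value i < v}" for v
  have g1: "1 < g" using n_ge1 by (simp add: g_def)
  have N_mono: "N u \<le> N v" if "u \<le> v" for u v
    unfolding N_def using that by (intro card_mono) auto
  have N'_mono: "N' u \<le> N' v" if "u \<le> v" for u v
    unfolding N'_def using that by (intro card_mono) auto
  have N_N': "N u \<le> N' v" if "u < v" for u v
    unfolding N_def N'_def using that by (intro card_mono) auto
  have N'_N: "N' v < N v" if "v \<in> levels" for v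
  proof -
    obtain i where i: "i \<in> {1..2 * n}" "item_value i = v" using \<open>v \<in> levels\<close>
      by (auto simp: levels_def)
    then have "i \<in> {i \<in> {1..2 * n}. item_value i \<le> v}" "i \<notin> {i \<in> {1..2 * n}. item_value i < v}"
      by auto
    then show ?thesis unfolding N_def N'_def
      by (intro psubset_card_mono) auto
  qed
  have N_le: "N v \<le> 2 * n" for v
    using card_mono[of "{1..2 * n}" "{i \<in> {1..2 * n}. item_value i \<le> v}"] unfolding N_def
    by (simp add: subset_iff)
  have N'_le: "N' v \<le> 2 * n" for v
    using card_mono[of "{1..2 * n}" "{i \<in> {1..2 * n}. item_value i < v}"] unfolding N'_def
    by (simp add: subset_iff)
  have count: "item_count l v + N' l = N v" if "l \<le> v" for l v
  proof -
    have "{i \<in> {1..2 * n}. item_value i \<le> v} =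
        {i \<in> {1..2 * n}. l \<le> item_value i \<and> item_value i \<le> v} \<union> {i \<in> {1..2 * n}. item_value i < l}"
      using that by auto
    moreover have "card \<dots> = item_count l v + N' l"
      unfolding item_count_def N'_def by (intro card_Un_disjoint) auto
    ultimately show ?thesis by (simp add: N_def)
  qed
  define a where "a v = g ^ N v" for v
  define b where "b v = g ^ (N v + N' v)" for v
  have "\<exists>\<phi>. (\<forall>v\<in>levels. 1 \<le> \<phi> v \<and> \<phi> v \<le> g ^ (4 * n) * g ^ (2 * n))
    \<and> (\<forall>u\<in>levels. \<forall>v\<in>levels. u \<le> v \<longrightarrow> \<phi> u \<le> \<phi> v)
    \<and> (\<forall>v\<in>levels. \<exists>\<kappa>\<in>levels. \<kappa> \<le> v
        \<and> (\<forall>u\<in>levels. \<kappa> \<le> u \<longrightarrow> \<phi> u * \<kappa> \<le> \<phi> \<kappa> * u)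
        \<and> (\<forall>u\<in>levels. u \<le> v \<longrightarrow> \<phi> \<kappa> * u \<le> \<phi> u * \<kappa>)
        \<and> (\<forall>l\<in>levels. l < \<kappa> \<longrightarrow> \<phi> l * b \<kappa> \<le> \<phi> \<kappa> * b l
            \<and> (\<exists>y\<in>levels. l \<le> y \<and> y < \<kappa> \<and> \<phi> l * b \<kappa> * a v \<le> \<phi> v * b l * a y)))"
  proof (rule capped_growth_exists)
    fix u v assume uv: "u \<in> levels" "v \<in> levels" "u < v"
    have "N u + N' u < N v + N' v" using N'_N[OF uv(1)] N_N'[OF uv(3)] N'_mono[of u v] N_mono[of u v] N'_N[OF uv(2)] uv
      by linarith
    then show "b u < b v" using g1 by (simp add: b_def)
  next
    fix v show "b v \<le> g ^ (4 * n)"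
      unfolding b_def using N_le[of v] N'_le[of v] g1 by (intro power_increasing) auto
  next
    fix u v :: real assume "u \<le> v" then show "a u \<le> a v"
      unfolding a_def using N_mono g1 by (intro power_increasing) auto
  qed (use finite_levels level_pos g1 N_le in \<open>auto simp: a_def b_def intro!: one_le_power power_increasing\<close>)
  then obtain \<phi> where
    bounds: "\<forall>v\<in>levels. 1 \<le> \<phi> v \<and> \<phi> v \<le> g ^ (4 * n) * g ^ (2 * n)"
    and mono: "\<forall>u\<in>levels. \<forall>v\<in>levels. u \<le> v \<longrightarrow> \<phi> u \<le> \<phi> v"
    and cut: "\<forall>v\<in>levels. \<exists>\<kappa>\<in>levels. \<kappa> \<le> v
        \<and> (\<forall>u\<in>levels. \<kappa> \<le> u \<longrightarrow> \<phi> u * \<kappa> \<le> \<phi> \<kappa> * u)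
        \<and> (\<forall>u\<in>levels. u \<le> v \<longrightarrow> \<phi> \<kappa> * u \<le> \<phi> u * \<kappa>)
        \<and> (\<forall>l\<in>levels. l < \<kappa> \<longrightarrow> \<phi> l * b \<kappa> \<le> \<phi> \<kappa> * b l
            \<and> (\<exists>y\<in>levels. l \<le> y \<and> y < \<kappa> \<and> \<phi> l * b \<kappa> * a v \<le> \<phi> v * b l * a y))"
    by (elim exE conjE)
  have phi1: "1 \<le> \<phi> v" and phiM: "\<phi> v \<le> g ^ (4 * n) * g ^ (2 * n)" if "v \<in> levels" for v
    using bounds that by simp_all
  obtain \<kappa> where \<kappa>: "\<forall>v\<in>levels. \<kappa> v \<in> levels \<and> \<kappa> v \<le> v
        \<and> (\<forall>u\<in>levels. \<kappa> v \<le> u \<longrightarrow> \<phi> u * \<kappa> v \<le> \<phi> (\<kappa> v) * u)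
        \<and> (\<forall>u\<in>levels. u \<le> v \<longrightarrow> \<phi> (\<kappa> v) * u \<le> \<phi> u * \<kappa> v)
        \<and> (\<forall>l\<in>levels. l < \<kappa> v \<longrightarrow> \<phi> l * b (\<kappa> v) \<le> \<phi> (\<kappa> v) * b l
            \<and> (\<exists>y\<in>levels. l \<le> y \<and> y < \<kappa> v \<and> \<phi> l * b (\<kappa> v) * a v \<le> \<phi> v * b l * a y))"
    using bchoice[OF cut[unfolded Bex_def[of levels]]] by (auto simp only: Bex_def)
  have kap: "\<kappa> v \<in> levels" "\<kappa> v \<le> v" if "v \<in> levels" for v using \<kappa> that by simp_all
  have above: "\<phi> u * \<kappa> v \<le> \<phi> (\<kappa> v) * u" if "v \<in> levels" "u \<in> levels" "\<kappa> v \<le> u" for u v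
    using \<kappa> that by simp
  have below: "\<phi> (\<kappa> v) * u \<le> \<phi> u * \<kappa> v" if "v \<in> levels" "u \<in> levels" "u \<le> v" for u v
    using \<kappa> that by simp
  have gr1: "\<phi> l * b (\<kappa> v) \<le> \<phi> (\<kappa> v) * b l"
    and gr2: "\<exists>y\<in>levels. l \<le> y \<and> y < \<kappa> v \<and> \<phi> l * b (\<kappa> v) * a v \<le> \<phi> v * b l * a y"
    if "v \<in> levels" "l \<in> levels" "l < \<kappa> v" for l v
    using \<kappa> that by simp_all
  have cancel: "x * g ^ k \<le> y" if "x * g ^ p \<le> y * g ^ q" "k + q \<le> p" "0 \<le> x" for x y k p q
  proof -
    have "x * g ^ k * g ^ q \<le> x * g ^ p"
      using that g1 by (simp add: mult.assoc flip: power_add) (intro mult_left_mono power_increasing, auto)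
    then have "(x * g ^ k) * g ^ q \<le> y * g ^ q" using that by linarith
    then show ?thesis using g1 by simp
  qed
  define \<psi> where "\<psi> v = (if v = 0 then 0 else \<phi> v)" for v
  have psi: "\<psi> v = \<phi> v" if "v \<in> levels" for v
    using level_pos[OF that] by (simp add: \<psi>_def)
  have "ea_potential n w B \<psi> \<kappa>"
  proof
    fix v assume v: "v \<in> levels"
    have "g ^ n \<le> exp 48"
    proof -
      have "g ^ n \<le> exp (48 / real n) ^ n"
        unfolding g_def using n_ge1 exp_ge_add_one_self by (intro power_mono) auto
      also have "\<dots> = exp 48" using n_ge1 by (simp flip: exp_of_nat_mult)
      finally show ?thesis .
    qed
    then have "(g ^ n) ^ 6 \<le> exp 48 ^ 6" using g1 by (intro power_mono) auto
    also have "\<dots> = exp 288" by (simp flip: exp_of_nat_mult)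
    also have "(g ^ n) ^ 6 = g ^ (4 * n) * g ^ (2 * n)"
      by (simp add: mult.commute flip: power_mult power_add)
    finally show "\<psi> v \<le> exp 288" using phiM[OF v] psi v by simp
  next
    fix v l assume v: "v \<in> levels" and l: "l \<in> levels" "l < \<kappa> v"
    note kv = kap[OF v]
    have pos: "0 \<le> \<phi> l" using phi1[OF l(1)] by simp
    have "item_count l (\<kappa> v) + (N l + N' l) \<le> N (\<kappa> v) + N' (\<kappa> v)"
      using count[of l "\<kappa> v"] l N_N'[OF l(2)] by simp
    then show "\<psi> l * (1 + 48 / real n) ^ item_count l (\<kappa> v) \<le> \<psi> (\<kappa> v)"
      using cancel[OF gr1[OF v l, unfolded b_def]] pos psi l kv by (simp add: g_def)
    obtain y where y: "y \<in> levels" "l \<le> y" "y < \<kappa> v" "\<phi> l * b (\<kappa> v) * a v \<le> \<phi> v * b l * a y"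
      using gr2[OF v l] by auto
    have "\<phi> l * g ^ (N (\<kappa> v) + N' (\<kappa> v) + N v) \<le> \<phi> v * g ^ (N l + N' l + N y)"
      using y(4) by (simp add: a_def b_def power_add mult.assoc)
    moreover have "item_count l v + (N l + N' l + N y) \<le> N (\<kappa> v) + N' (\<kappa> v) + N v"
      using count[of l v] l kv N_N'[OF y(3)] N_mono[of l "\<kappa> v"] by simp
    ultimately show "\<psi> l * (1 + 48 / real n) ^ item_count l v \<le> \<psi> v"
      using cancel pos psi l v by (simp add: g_def)
  qed (use psi phi1 mono kap above below in \<open>auto simp: \<psi>_def[of 0]\<close>)
  then show ?thesis by blast
qed

context ea_potential
begin

abbreviation top_phi :: real where "top_phi \<equiv> \<phi> (w B)"

definition val :: "nat \<Rightarrow> real" where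
  "val i = \<phi> (gap i)"

definition slope :: "real \<Rightarrow> real" where
  "slope v = \<phi> (\<kappa> v) / \<kappa> v"

definition overflow :: "real \<Rightarrow> real" where
  "overflow v = (if w B < \<kappa> v then \<phi> (w B) else 0)"

lemma kappa_pos: "v \<in> levels \<Longrightarrow> 0 < \<kappa> v"
  using kappa_level level_pos by blast

lemma phi_kappa_ge1: "v \<in> levels \<Longrightarrow> 1 \<le> \<phi> (\<kappa> v)"
  using kappa_level phi_ge1 by blast

lemma phi_kappa_le: "v \<in> levels \<Longrightarrow> \<phi> (\<kappa> v) \<le> \<phi> v"
  using kappa_level kappa_le phi_mono by blast

lemma slope_pos: "v \<in> levels \<Longrightarrow> 0 < slope v"
  using kappa_pos[of v] phi_kappa_ge1[of v] by (simp add: slope_def)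

lemma phi_le_slope: "v \<in> levels \<Longrightarrow> u \<in> levels \<Longrightarrow> \<kappa> v \<le> u \<Longrightarrow> \<phi> u \<le> slope v * u"
  using phi_above_kappa[of v u] kappa_pos[of v] by (simp add: slope_def field_simps)

lemma phi_ge_slope: "v \<in> levels \<Longrightarrow> u \<in> levels \<Longrightarrow> u \<le> v \<Longrightarrow> slope v * u \<le> \<phi> u"
  using phi_below[of v u] kappa_pos[of v] by (simp add: slope_def field_simps)

lemma slope_kappa: "v \<in> levels \<Longrightarrow> slope v * \<kappa> v = \<phi> (\<kappa> v)"
  using kappa_pos[of v] by (simp add: slope_def)

lemma gap_cases: "i \<in> {1..n} \<Longrightarrow> gap i = 0 \<or> gap i \<in> levels"
  using gap_level[of i] gap_nonneg[of i] by (cases "gap i = 0") (auto simp: less_le)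

lemma finite_bits: "A \<subseteq> {1..n} \<Longrightarrow> finite A"
  by (rule finite_subset) auto

lemma val_ge1: "i \<in> {1..n} \<Longrightarrow> 0 < gap i \<Longrightarrow> 1 \<le> val i"
  using gap_level phi_ge1 by (simp add: val_def)

lemma val_nonneg: "i \<in> {1..n} \<Longrightarrow> 0 \<le> val i"
  using gap_cases[of i] phi_0 phi_ge1[of "gap i"] by (auto simp: val_def)

lemma val_le_exp: "i \<in> {1..n} \<Longrightarrow> val i \<le> exp 288"
  using gap_cases[of i] phi_0 phi_le[of "gap i"] by (auto simp: val_def)

lemma val_mono: "i \<in> {1..n} \<Longrightarrow> v \<in> levels \<Longrightarrow> gap i \<le> v \<Longrightarrow> val i \<le> \<phi> v"
  using gap_cases[of i] phi_0 phi_ge1[of v] phi_mono[of "gap i" v] by (auto simp: val_def)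

lemma val_ge_slope: "i \<in> {1..n} \<Longrightarrow> v \<in> levels \<Longrightarrow> gap i \<le> v \<Longrightarrow> slope v * gap i \<le> val i"
  using gap_cases[of i] phi_0 phi_ge_slope[of v "gap i"] by (auto simp: val_def)

lemma val_le_slope: "i \<in> {1..n} \<Longrightarrow> v \<in> levels \<Longrightarrow> \<kappa> v \<le> gap i \<Longrightarrow> val i \<le> slope v * gap i"
  using gap_cases[of i] kappa_pos[of v] phi_le_slope[of v "gap i"] by (auto simp: val_def)

lemma top_phi_ge1: "1 \<le> top_phi"
  using phi_ge1 wB_level by blast

lemma overflow_nonneg: "0 \<le> overflow v"
  using top_phi_ge1 by (simp add: overflow_def)

text \<open>An accepted step loses potential only on bits whose gap lies below the cut of the largest
  decreasing item: from the cut upwards the potential is dominated by a multiple of the fitness,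
  with equality up to that item, and below the cut it dominates the same multiple.\<close>

lemma accepted_loss_bound:
  assumes v: "v \<in> levels" and A: "A \<subseteq> {1..n}" "\<And>a. a \<in> A \<Longrightarrow> gap a \<le> v" and U: "U \<subseteq> {1..n}"
    and neg: "\<delta> < 0 \<Longrightarrow> w B \<le> v"
    and acc: "sum gap U + \<delta> * w B \<le> sum gap A"
  shows "sum val U + \<delta> * top_phi - sum val A
    \<le> (\<Sum>l\<in>{l \<in> U. gap l < \<kappa> v}. val l) + max \<delta> 0 * overflow v"
proof -
  let ?r = "slope v"
  have fin: "finite A" "finite U" using A U finite_bits by auto
  have sA: "?r * sum gap A \<le> sum val A"
    unfolding sum_distrib_left using A v val_ge_slope by (intro sum_mono) auto
  have "sum val U \<le> (\<Sum>l\<in>U. ?r * gap l + (if gap l < \<kappa> v then val l else 0))"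
  proof (rule sum_mono)
    fix l assume "l \<in> U"
    then have "l \<in> {1..n}" using U by auto
    then show "val l \<le> ?r * gap l + (if gap l < \<kappa> v then val l else 0)"
      using val_le_slope[of l v] slope_pos[OF v] v by auto
  qed
  also have "\<dots> = ?r * sum gap U + (\<Sum>l\<in>{l \<in> U. gap l < \<kappa> v}. val l)"
    using fin by (simp add: sum.distrib sum_distrib_left sum.If_cases Int_def)
  finally have sU: "sum val U \<le> ?r * sum gap U + (\<Sum>l\<in>{l \<in> U. gap l < \<kappa> v}. val l)" .
  have s\<delta>: "\<delta> * top_phi \<le> ?r * (\<delta> * w B) + max \<delta> 0 * overflow v"
  proof (cases "0 \<le> \<delta>")
    case True
    have "top_phi \<le> ?r * w B + overflow v"
      using phi_le_slope[OF v wB_level] slope_pos[OF v] wB_pos by (auto simp: overflow_def)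
    then have "\<delta> * top_phi \<le> \<delta> * (?r * w B + overflow v)" using True by (intro mult_left_mono) auto
    then show ?thesis using True by (simp add: algebra_simps)
  next
    case False
    then have "?r * w B \<le> top_phi" using phi_ge_slope[OF v wB_level] neg by simp
    then have "\<delta> * top_phi \<le> \<delta> * (?r * w B)" using False by (intro mult_left_mono_neg) auto
    then show ?thesis using False by (simp add: algebra_simps)
  qed
  have "?r * (sum gap U + \<delta> * w B) \<le> ?r * sum gap A"
    using acc slope_pos[OF v] by (intro mult_left_mono) auto
  then show ?thesis using sA sU s\<delta> by (simp add: distrib_left)
qed

lemma low_items_sum:
  assumes v: "v \<in> levels" and t: "t = 0 \<or> t \<in> levels" "t < \<kappa> v"
  shows "48 / real n * (\<Sum>i\<in>{i \<in> {1..2 * n}. t < item_value i \<and> item_value i < \<kappa> v}. \<phi> (item_value i))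
    \<le> \<phi> (\<kappa> v) - \<phi> t"
proof -
  let ?X = "{i \<in> {1..2 * n}. t < item_value i \<and> item_value i < \<kappa> v}" and ?g = "1 + 48 / real n"
  have g1: "1 \<le> ?g" by simp
  have t0: "0 \<le> t" using t level_pos[of t] by auto
  have K: "1 \<le> \<phi> (\<kappa> v)" using phi_kappa_ge1 v by simp
  have "(?g - 1) * (\<Sum>i\<in>?X. \<phi> (item_value i)) \<le> \<phi> (\<kappa> v) * (1 - 1 / ?g ^ card ?X)"
  proof (rule geometric_sum_by_rank[where v = item_value])
    fix i assume i: "i \<in> ?X"
    then have lev: "item_value i \<in> levels" using t0 by (auto simp: levels_def)
    have "card {x \<in> ?X. item_value i \<le> item_value x} \<le> item_count (item_value i) (\<kappa> v)"
      unfolding item_count_def by (intro card_mono) auto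
    then have "\<phi> (item_value i) * ?g ^ card {x \<in> ?X. item_value i \<le> item_value x}
        \<le> \<phi> (item_value i) * ?g ^ item_count (item_value i) (\<kappa> v)"
      using phi_ge1[OF lev] g1 by (intro mult_left_mono power_increasing) auto
    also have "\<dots> \<le> \<phi> (\<kappa> v)" using growth_kappa[OF v lev] i by simp
    finally show "\<phi> (item_value i) * ?g ^ card {x \<in> ?X. item_value i \<le> item_value x} \<le> \<phi> (\<kappa> v)" .
  qed (use g1 K in auto)
  moreover have "\<phi> t \<le> \<phi> (\<kappa> v) / ?g ^ card ?X"
  proof (cases "t = 0")
    case True
    then show ?thesis using phi_0 K by simp
  next
    case False
    then have lev: "t \<in> levels" using t by simp
    have "card ?X \<le> item_count t (\<kappa> v)"
      unfolding item_count_def by (intro card_mono) auto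
    then have "\<phi> t * ?g ^ card ?X \<le> \<phi> t * ?g ^ item_count t (\<kappa> v)"
      using phi_ge1[OF lev] g1 by (intro mult_left_mono power_increasing) auto
    also have "\<dots> \<le> \<phi> (\<kappa> v)" using growth_kappa[OF v lev t(2)] .
    finally show ?thesis using n_ge1 by (simp add: pos_le_divide_eq add_pos_pos)
  qed
  ultimately show ?thesis by (simp add: algebra_simps)
qed

lemma low_bits_sum:
  assumes v: "v \<in> levels"  and t: "t = 0 \<or> t \<in> levels" "t < \<kappa> v"
  shows "48 / real n * (\<Sum>i\<in>{i \<in> {1..n}. t < gap i \<and> gap i < \<kappa> v}. val i) \<le> \<phi> (\<kappa> v) - \<phi> t"
proof -
  have "(\<Sum>i\<in>{i \<in> {1..n}. t < gap i \<and> gap i < \<kappa> v}. val i)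
     = (\<Sum>i\<in>{i \<in> {1..n}. t < gap i \<and> gap i < \<kappa> v}. \<phi> (item_value i))"
    by (intro sum.cong) (auto simp: item_value_def val_def)
  also have "\<dots> \<le> (\<Sum>i\<in>{i \<in> {1..2 * n}. t < item_value i \<and> item_value i < \<kappa> v}. \<phi> (item_value i))"
  proof (rule sum_mono2)
    fix i assume i: "i \<in> {i \<in> {1..2 * n}. t < item_value i \<and> item_value i < \<kappa> v} - {i \<in> {1..n}. t < gap i \<and> gap i < \<kappa> v}"
    moreover have "0 \<le> t" using t level_pos[of t] by auto
    ultimately have "item_value i \<in> levels" by (auto simp: levels_def)
    then show "0 \<le> \<phi> (item_value i)" using phi_ge1[of "item_value i"] by simp
  qed (auto simp: item_value_def)
  finally have "48 / real n * (\<Sum>i\<in>{i \<in> {1..n}. t < gap i \<and> gap i < \<kappa> v}. val i)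
     \<le> 48 / real n * (\<Sum>i\<in>{i \<in> {1..2 * n}. t < item_value i \<and> item_value i < \<kappa> v}. \<phi> (item_value i))"
    by (intro mult_left_mono) auto
  then show ?thesis using low_items_sum[OF v t] by linarith
qed

lemma low_weight_le:
  assumes v: "v \<in> levels"
  shows "(\<Sum>l\<in>{l \<in> {1..n}. gap l < \<kappa> v}. val l) / real n + overflow v \<le> \<phi> (\<kappa> v) / 48"
proof -
  let ?X = "{i \<in> {1..2 * n}. 0 < item_value i \<and> item_value i < \<kappa> v}"
  let ?L = "{l \<in> {1..n}. 0 < gap l \<and> gap l < \<kappa> v}"
  let ?C = "if w B < \<kappa> v then {n + 1..2 * n} else {}"
  have X: "?X = ?L \<union> ?C" using wB_pos by (auto simp: item_value_def)
  have "(\<Sum>i\<in>?X. \<phi> (item_value i)) = (\<Sum>i\<in>?L. \<phi> (item_value i)) + (\<Sum>i\<in>?C. \<phi> (item_value i))"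
    unfolding X by (intro sum.union_disjoint) auto
  also have "(\<Sum>i\<in>?L. \<phi> (item_value i)) = (\<Sum>i\<in>?L. val i)"
    by (intro sum.cong) (auto simp: item_value_def val_def)
  also have "\<dots> = (\<Sum>l\<in>{l \<in> {1..n}. gap l < \<kappa> v}. val l)"
  proof (rule sum.mono_neutral_left)
    show "\<forall>i\<in>{l \<in> {1..n}. gap l < \<kappa> v} - ?L. val i = 0"
    proof
      fix i assume "i \<in> {l \<in> {1..n}. gap l < \<kappa> v} - ?L"
      then have "gap i = 0" using gap_nonneg[of i] by auto
      then show "val i = 0" using phi_0 by (simp add: val_def)
    qed
  qed auto
  also have "(\<Sum>i\<in>?C. \<phi> (item_value i)) = real n * overflow v"
    by (simp add: item_value_def overflow_def)
  finally have "48 / real n * ((\<Sum>l\<in>{l \<in> {1..n}. gap l < \<kappa> v}. val l) + real n * overflow v) \<le> \<phi> (\<kappa> v)"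
    using low_items_sum[OF v, of 0] kappa_pos[OF v] phi_0 by simp
  then show ?thesis using n_ge1 by (simp add: field_simps)
qed

text \<open>Expected loss of steps that repair a single item of value \<open>v\<close>: such a step must spoil one more
  bit of the same side \<open>S\<close> than of the other side \<open>P\<close>, so any loss needs two bits of \<open>S\<close>. The three
  summands are paid for by the plain swaps of the item with one bit of \<open>S\<close>.\<close>

definition burden :: "real \<Rightarrow> nat set \<Rightarrow> nat set \<Rightarrow> nat set \<Rightarrow> real" where
  "burden v S P F =
     (\<Sum>l\<in>{l \<in> S. gap l < \<kappa> v}. \<Sum>t\<in>S - {l}. val l * of_bool ({l, t} \<subseteq> F))
   + (\<Sum>t\<in>{t \<in> S. gap t < \<kappa> v}. \<Sum>t'\<in>{t' \<in> S - {t}. gap t \<le> gap t'}.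
        of_bool ({t, t'} \<subseteq> F) * ((\<Sum>u\<in>{u \<in> P. gap u < \<kappa> v}. of_bool (u \<in> F) * val u) + overflow v))
   + (\<Sum>t\<in>{t \<in> S. \<kappa> v \<le> gap t}. (\<phi> v - val t) / \<phi> (\<kappa> v) *
        (of_bool ({t} \<subseteq> F) * ((\<Sum>u\<in>{u \<in> P. gap u < \<kappa> v}. of_bool (u \<in> F) * val u) + overflow v)))"

lemma burden_nonneg:
  assumes v: "v \<in> levels" and S: "S \<subseteq> {1..n}" "\<And>t. t \<in> S \<Longrightarrow> gap t \<le> v" and P: "P \<subseteq> {1..n}"
  shows "0 \<le> burden v S P F"
proof -
  have 1: "0 \<le> val i" if "i \<in> S \<or> i \<in> P" for i using that S P val_nonneg by blast
  have 2: "0 \<le> \<phi> v - val i" if "i \<in> S" for i using val_mono[of i v] that S v by auto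
  have 3: "0 \<le> \<phi> (\<kappa> v)" using phi_kappa_ge1[OF v] by simp
  show ?thesis unfolding burden_def
    using 1 2 3 overflow_nonneg
    by (intro add_nonneg_nonneg sum_nonneg mult_nonneg_nonneg divide_nonneg_nonneg) auto
qed

lemma burden_ge:
  assumes v: "v \<in> levels" and S: "S \<subseteq> {1..n}" "\<And>t. t \<in> S \<Longrightarrow> gap t \<le> v" and P: "P \<subseteq> {1..n}"
    and disj: "S \<inter> P = {}" and two: "2 \<le> card (F \<inter> S)" and \<delta>: "0 \<le> \<delta>" "\<delta> + 1 \<le> real (card (F \<inter> S))"
    and high: "{t \<in> F \<inter> S. gap t < \<kappa> v} = {} \<Longrightarrow>
       ((\<Sum>u\<in>{u \<in> F \<inter> P. gap u < \<kappa> v}. val u) + \<delta> * overflow v = 0) \<or>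
       max 1 \<delta> * \<phi> (\<kappa> v) \<le> (\<Sum>t\<in>F \<inter> S. \<phi> v - val t)"
  shows "(\<Sum>l\<in>{l \<in> F \<inter> (S \<union> P). gap l < \<kappa> v}. val l) + \<delta> * overflow v \<le> burden v S P F"
proof -
  have finS: "finite S" and finP: "finite P" using S P finite_bits by auto
  define R where "R = (\<Sum>u\<in>{u \<in> F \<inter> P. gap u < \<kappa> v}. val u)"
  have R': "(\<Sum>u\<in>{u \<in> P. gap u < \<kappa> v}. of_bool (u \<in> F) * val u) = R"
    unfolding R_def using finP by (intro sum.mono_neutral_cong_right) auto
  have valS: "0 \<le> val i" if "i \<in> S" for i using that S val_nonneg by blast
  have R0: "0 \<le> R" unfolding R_def using P val_nonneg by (intro sum_nonneg) blast
  have O0: "0 \<le> overflow v" by (rule overflow_nonneg)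
  have split: "(\<Sum>l\<in>{l \<in> F \<inter> (S \<union> P). gap l < \<kappa> v}. val l)
      = (\<Sum>l\<in>{l \<in> F \<inter> S. gap l < \<kappa> v}. val l) + R"
  proof -
    have "{l \<in> F \<inter> (S \<union> P). gap l < \<kappa> v} = {l \<in> F \<inter> S. gap l < \<kappa> v} \<union> {l \<in> F \<inter> P. gap l < \<kappa> v}"
      by auto
    then show ?thesis unfolding R_def
      using finS finP disj by (simp only:) (intro sum.union_disjoint, auto)
  qed
  let ?b1 = "\<Sum>l\<in>{l \<in> S. gap l < \<kappa> v}. \<Sum>t\<in>S - {l}. val l * of_bool ({l, t} \<subseteq> F)"
  let ?b2 = "\<Sum>t\<in>{t \<in> S. gap t < \<kappa> v}. \<Sum>t'\<in>{t' \<in> S - {t}. gap t \<le> gap t'}.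
        of_bool ({t, t'} \<subseteq> F) * (R + overflow v)"
  let ?b3 = "\<Sum>t\<in>{t \<in> S. \<kappa> v \<le> gap t}. (\<phi> v - val t) / \<phi> (\<kappa> v) *
        (of_bool ({t} \<subseteq> F) * (R + overflow v))"
  have b: "burden v S P F = ?b1 + ?b2 + ?b3" unfolding burden_def R' ..
  have b1: "(\<Sum>l\<in>{l \<in> F \<inter> S. gap l < \<kappa> v}. val l) \<le> ?b1"
  proof -
    have "(\<Sum>l\<in>{l \<in> F \<inter> S. gap l < \<kappa> v}. val l)
        \<le> (\<Sum>l\<in>{l \<in> F \<inter> S. gap l < \<kappa> v}. \<Sum>t\<in>S - {l}. val l * of_bool ({l, t} \<subseteq> F))"
    proof (rule sum_mono)
      fix l assume l: "l \<in> {l \<in> F \<inter> S. gap l < \<kappa> v}"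
      have "\<exists>t. t \<in> F \<inter> S \<and> t \<noteq> l"
      proof (rule ccontr)
        assume "\<not> ?thesis"
        then have "F \<inter> S \<subseteq> {l}" by auto
        then have "card (F \<inter> S) \<le> 1" using card_mono[of "{l}" "F \<inter> S"] by simp
        then show False using two by simp
      qed
      then obtain t where t: "t \<in> F" "t \<in> S" "t \<noteq> l" by auto
      have "(\<Sum>t\<in>{t}. val l * of_bool ({l, t} \<subseteq> F)) \<le> (\<Sum>t\<in>S - {l}. val l * of_bool ({l, t} \<subseteq> F))"
        using t finS l valS by (intro sum_mono2) auto
      then show "val l \<le> (\<Sum>t\<in>S - {l}. val l * of_bool ({l, t} \<subseteq> F))" using t l by simp
    qed
    also have "\<dots> \<le> ?b1"
      using finS valS by (intro sum_mono2) (auto intro!: sum_nonneg)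
    finally show ?thesis .
  qed
  have b2: "0 \<le> ?b2" using R0 O0 by (intro sum_nonneg) auto
  have dnn: "0 \<le> \<phi> v - val i" if "i \<in> S" for i using val_mono[of i v] that S v by auto
  have k1: "1 \<le> \<phi> (\<kappa> v)" using phi_kappa_ge1[OF v] .
  have b3: "0 \<le> ?b3" using R0 O0 dnn k1
    by (intro sum_nonneg mult_nonneg_nonneg divide_nonneg_nonneg) auto
  have "R + \<delta> * overflow v \<le> ?b2 + ?b3"
  proof (cases "{t \<in> F \<inter> S. gap t < \<kappa> v} = {}")
    case False
    let ?T = "F \<inter> S"
    have "?T \<noteq> {}" "finite ?T" using False finS by auto
    then obtain z where z: "z \<in> ?T" "\<And>x. x \<in> ?T \<Longrightarrow> gap z \<le> gap x"
      using ex_min_if_finite[of "gap ` ?T"] by (auto simp: not_less)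
    have zk: "gap z < \<kappa> v" using False z(2) by force
    have "max 1 \<delta> \<le> real (card ?T) - 1" using two \<delta> by simp
    then have "max 1 \<delta> * (R + overflow v) \<le> (real (card ?T) - 1) * (R + overflow v)"
      using R0 O0 by (intro mult_right_mono) auto
    also have "\<dots> = (\<Sum>t'\<in>?T - {z}. R + overflow v)"
      using z(1) \<open>finite ?T\<close> two by (simp add: of_nat_diff)
    also have "\<dots> = (\<Sum>t'\<in>?T - {z}. of_bool ({z, t'} \<subseteq> F) * (R + overflow v))"
      using z(1) by (intro sum.cong) auto
    also have "\<dots> \<le> (\<Sum>t'\<in>{t' \<in> S - {z}. gap z \<le> gap t'}. of_bool ({z, t'} \<subseteq> F) * (R + overflow v))"
      using z R0 O0 finS by (intro sum_mono2) auto
    also have "\<dots> = (\<Sum>t\<in>{z}. \<Sum>t'\<in>{t' \<in> S - {t}. gap t \<le> gap t'}. of_bool ({t, t'} \<subseteq> F) * (R + overflow v))"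
      by simp
    also have "\<dots> \<le> ?b2"
      using z zk finS R0 O0 by (intro sum_mono2) (auto intro!: sum_nonneg)
    finally have "max 1 \<delta> * (R + overflow v) \<le> ?b2" .
    moreover have "1 * R \<le> max 1 \<delta> * R" using R0 by (intro mult_right_mono) auto
    moreover have "\<delta> * overflow v \<le> max 1 \<delta> * overflow v" using O0 by (intro mult_right_mono) auto
    ultimately show ?thesis using b3 by (simp add: distrib_left)
  next
    case True
    then consider "R + \<delta> * overflow v = 0" | "max 1 \<delta> * \<phi> (\<kappa> v) \<le> (\<Sum>t\<in>F \<inter> S. \<phi> v - val t)"
      using high R_def by auto
    then show ?thesis
    proof cases
      case 1 then show ?thesis using b2 b3 by simp
    next
      case 2
      have all: "\<kappa> v \<le> gap t" if "t \<in> F \<inter> S" for t using True that by force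
      have "max 1 \<delta> \<le> (\<Sum>t\<in>F \<inter> S. \<phi> v - val t) / \<phi> (\<kappa> v)"
        by (rule iffD2[OF pos_le_divide_eq 2]) (use k1 in simp)
      then have "max 1 \<delta> * (R + overflow v) \<le> (\<Sum>t\<in>F \<inter> S. \<phi> v - val t) / \<phi> (\<kappa> v) * (R + overflow v)"
        using R0 O0 by (intro mult_right_mono) auto
      also have "\<dots> = (\<Sum>t\<in>F \<inter> S. (\<phi> v - val t) / \<phi> (\<kappa> v) * (R + overflow v))"
        by (simp only: sum_divide_distrib sum_distrib_right)
      also have "\<dots> = ?b3"
        using finS all by (intro sum.mono_neutral_cong_left) auto
      finally have "max 1 \<delta> * (R + overflow v) \<le> ?b3" .
      moreover have "1 * R \<le> max 1 \<delta> * R" using R0 by (intro mult_right_mono) auto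
      moreover have "\<delta> * overflow v \<le> max 1 \<delta> * overflow v" using O0 by (intro mult_right_mono) auto
      ultimately show ?thesis using b2 by (simp add: distrib_left)
    qed
  qed
  then show ?thesis unfolding split b using b1 by simp
qed


lemma val_growth:
  assumes v: "v \<in> levels" and l: "l \<in> {1..n}" "gap l < \<kappa> v"
    and S: "S \<subseteq> {1..n}" "\<And>t. t \<in> S \<Longrightarrow> gap t \<le> v"
  shows "val l * (1 + 48 * (real (card {t \<in> S. gap l \<le> gap t}) / real n)) \<le> \<phi> v"
proof (cases "gap l = 0")
  case True
  then show ?thesis using phi_0 phi_ge1[OF v] by (simp add: val_def)
next
  case False
  then have lev: "gap l \<in> levels" using gap_cases[OF l(1)] by simp
  let ?c = "card {t \<in> S. gap l \<le> gap t}"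
  have "?c \<le> item_count (gap l) v"
    unfolding item_count_def using S by (intro card_mono) (auto simp: item_value_def)
  then have "(1 + 48 / real n) ^ ?c \<le> (1 + 48 / real n) ^ item_count (gap l) v"
    by (intro power_increasing) auto
  moreover have "1 + real ?c * (48 / real n) \<le> (1 + 48 / real n) ^ ?c"
    using n_ge1 by (intro Bernoulli_inequality) (auto intro: order_trans[of _ 0])
  ultimately have "1 + 48 * (real ?c / real n) \<le> (1 + 48 / real n) ^ item_count (gap l) v"
    by (simp add: mult.commute)
  then have "val l * (1 + 48 * (real ?c / real n)) \<le> val l * (1 + 48 / real n) ^ item_count (gap l) v"
    using val_nonneg[OF l(1)] by (intro mult_left_mono) auto
  also have "\<dots> \<le> \<phi> v" using growth[OF v lev l(2)] by (simp add: val_def)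
  finally show ?thesis .
qed

lemma same_side_loss:
  assumes v: "v \<in> levels" and S: "S \<subseteq> {1..n}" "\<And>t. t \<in> S \<Longrightarrow> gap t \<le> v"
  defines "T \<equiv> {l \<in> S. gap l < \<kappa> v}"
  shows "(\<Sum>l\<in>T. val l * real (card S)) \<le> real n / 24 * (\<Sum>l\<in>T. \<phi> v - val l)" (is ?A)
    and "(\<Sum>t\<in>T. real (card {t' \<in> S. gap t \<le> gap t'}) * \<phi> (\<kappa> v)) \<le> 2 * real n * (\<Sum>t\<in>T. \<phi> v - val t)" (is ?B)
proof -
  have finS: "finite S" using S finite_bits by simp
  then have finT: "finite T" by (simp add: T_def)
  have npos: "0 < real n" using n_ge1 by simp
  let ?c = "\<lambda>l. real (card {t \<in> S. gap l \<le> gap t})"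
  have T: "l \<in> {1..n}" "gap l < \<kappa> v" "gap l \<le> v" "0 \<le> val l" if "l \<in> T" for l
    using that S val_nonneg by (auto simp: T_def)
  have gr: "val l * (1 + 48 * (?c l / real n)) \<le> \<phi> v" if "l \<in> T" for l
    using val_growth[OF v T(1,2)[OF that] S] .
  have up: "val l * ?c l \<le> real n / 48 * (\<phi> v - val l)" if "l \<in> T" for l
    using gr[OF that] npos by (simp add: field_simps)
  have low: "(\<Sum>l\<in>{l \<in> T. gap t < gap l}. val l) \<le> real n / 48 * (\<phi> v - val t)" if t: "t \<in> T" for t
  proof -
    have "(\<Sum>l\<in>{l \<in> T. gap t < gap l}. val l) \<le> (\<Sum>i\<in>{i \<in> {1..n}. gap t < gap i \<and> gap i < \<kappa> v}. val i)"
      using T val_nonneg by (intro sum_mono2) auto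
    then have "48 / real n * (\<Sum>l\<in>{l \<in> T. gap t < gap l}. val l)
        \<le> 48 / real n * (\<Sum>i\<in>{i \<in> {1..n}. gap t < gap i \<and> gap i < \<kappa> v}. val i)"
      by (intro mult_left_mono) auto
    also have "\<dots> \<le> \<phi> v - val t"
      using low_bits_sum[OF v gap_cases[OF T(1)[OF t]] T(2)[OF t]] phi_kappa_le[OF v] by (simp add: val_def)
    finally show ?thesis using npos by (simp add: field_simps)
  qed
  have "(\<Sum>l\<in>T. val l * real (card S)) = (\<Sum>l\<in>T. val l * ?c l + val l * real (card {t \<in> T. gap t < gap l}))"
  proof (rule sum.cong[OF refl])
    fix l assume l: "l \<in> T"
    have "S = {t \<in> S. gap l \<le> gap t} \<union> {t \<in> T. gap t < gap l}"
      using T(2)[OF l] by (auto simp: T_def)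
    moreover have "card ({t \<in> S. gap l \<le> gap t} \<union> {t \<in> T. gap t < gap l})
       = card {t \<in> S. gap l \<le> gap t} + card {t \<in> T. gap t < gap l}"
      using finS finT by (intro card_Un_disjoint) auto
    ultimately have "real (card S) = ?c l + real (card {t \<in> T. gap t < gap l})" by simp
    then show "val l * real (card S) = val l * ?c l + val l * real (card {t \<in> T. gap t < gap l})"
      by (simp only: distrib_left)
  qed
  also have "\<dots> = (\<Sum>l\<in>T. val l * ?c l) + (\<Sum>l\<in>T. \<Sum>t\<in>{t \<in> T. gap t < gap l}. val l)"
    by (simp add: sum.distrib mult.commute)
  also have "(\<Sum>l\<in>T. \<Sum>t\<in>{t \<in> T. gap t < gap l}. val l) = (\<Sum>t\<in>T. \<Sum>l\<in>{l \<in> T. gap t < gap l}. val l)"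
    using finT by (intro sum.swap_restrict) auto
  also have "(\<Sum>l\<in>T. val l * ?c l) + (\<Sum>t\<in>T. \<Sum>l\<in>{l \<in> T. gap t < gap l}. val l)
      \<le> (\<Sum>l\<in>T. real n / 48 * (\<phi> v - val l)) + (\<Sum>t\<in>T. real n / 48 * (\<phi> v - val t))"
    using up low by (intro add_mono sum_mono) auto
  also have "\<dots> = real n / 24 * (\<Sum>l\<in>T. \<phi> v - val l)"
    unfolding sum_distrib_left[symmetric] by simp
  finally show ?A .
  have "?c t * \<phi> (\<kappa> v) \<le> 2 * real n * (\<phi> v - val t)" if t: "t \<in> T" for t
  proof -
    define x where "x = ?c t / real n"
    have "card {t' \<in> S. gap t \<le> gap t'} \<le> card {1..n}" using S by (intro card_mono) auto
    then have x: "0 \<le> x" "x \<le> 1" using npos by (auto simp: x_def)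
    have d: "0 \<le> \<phi> v - val t" using val_mono[OF T(1)[OF t] v T(3)[OF t]] by simp
    have "val t * (1 + 48 * x) \<le> \<phi> v" using gr[OF t] by (simp add: x_def)
    then have "48 * (x * \<phi> v) \<le> (\<phi> v - val t) * (1 + 48 * x)" by (simp add: algebra_simps)
    also have "\<dots> \<le> (\<phi> v - val t) * 49" using d x by (intro mult_left_mono) auto
    finally have "x * \<phi> v \<le> 2 * (\<phi> v - val t)" using d by simp
    moreover have "x * \<phi> (\<kappa> v) \<le> x * \<phi> v" using x phi_kappa_le[OF v] by (intro mult_left_mono) auto
    ultimately have "x * \<phi> (\<kappa> v) \<le> 2 * (\<phi> v - val t)" by simp
    then have "real n * (x * \<phi> (\<kappa> v)) \<le> real n * (2 * (\<phi> v - val t))" using npos by (intro mult_left_mono) auto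
    moreover have "real n * (x * \<phi> (\<kappa> v)) = ?c t * \<phi> (\<kappa> v)" using npos by (simp add: x_def)
    ultimately show ?thesis by (simp only: mult.left_commute mult.assoc)
  qed
  then show ?B unfolding sum_distrib_left by (intro sum_mono)
qed

lemma mean_low_weight:
  assumes v: "v \<in> levels" and P: "P \<subseteq> {1..n}" and Q: "Q \<subseteq> {1..n}" "Q \<inter> P = {}"
  shows "mutation_mean n (\<lambda>F. of_bool (Q \<subseteq> F) *
      ((\<Sum>u\<in>{u \<in> P. gap u < \<kappa> v}. of_bool (u \<in> F) * val u) + overflow v))
    \<le> (1 / real n) ^ card Q * \<phi> (\<kappa> v) / 48"
proof -
  let ?R = "{u \<in> P. gap u < \<kappa> v}" and ?p = "1 / real n"
  have finQ: "finite Q" using Q finite_bits by simp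
  have "mutation_mean n (\<lambda>F. of_bool (Q \<subseteq> F) * ((\<Sum>u\<in>?R. of_bool (u \<in> F) * val u) + overflow v))
    = mutation_mean n (\<lambda>F. (\<Sum>u\<in>?R. val u * of_bool (insert u Q \<subseteq> F)) + overflow v * of_bool (Q \<subseteq> F))"
    by (simp add: distrib_left sum_distrib_left of_bool_conj mult_ac)
  also have "\<dots> = (\<Sum>u\<in>?R. val u * ?p ^ card (insert u Q)) + overflow v * ?p ^ card Q"
    unfolding mutation_mean_add mutation_mean_sum mutation_mean_cmult
    using P Q by (intro arg_cong2[of _ _ _ _ "(+)"] sum.cong arg_cong2[of _ _ _ _ "(*)"] mutation_mean_superset) auto
  also have "(\<Sum>u\<in>?R. val u * ?p ^ card (insert u Q)) = (\<Sum>u\<in>?R. val u) * (?p * ?p ^ card Q)"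
    unfolding sum_distrib_right using Q finQ by (intro sum.cong refl) (auto simp: card_insert_if)
  also have "\<dots> + overflow v * ?p ^ card Q = ?p ^ card Q * ((\<Sum>u\<in>?R. val u) / real n + overflow v)"
    by (simp add: algebra_simps)
  also have "\<dots> \<le> ?p ^ card Q * (\<phi> (\<kappa> v) / 48)"
  proof (rule mult_left_mono)
    have "(\<Sum>u\<in>?R. val u) \<le> (\<Sum>l\<in>{l \<in> {1..n}. gap l < \<kappa> v}. val l)"
      using P val_nonneg by (intro sum_mono2) auto
    then have "(\<Sum>u\<in>?R. val u) / real n \<le> (\<Sum>l\<in>{l \<in> {1..n}. gap l < \<kappa> v}. val l) / real n"
      by (intro divide_right_mono) auto
    then show "(\<Sum>u\<in>?R. val u) / real n + overflow v \<le> \<phi> (\<kappa> v) / 48"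
      using low_weight_le[OF v] by linarith
  qed auto
  finally show ?thesis by simp
qed

lemma mean_burden:
  assumes v: "v \<in> levels" and S: "S \<subseteq> {1..n}" "\<And>t. t \<in> S \<Longrightarrow> gap t \<le> v" and P: "P \<subseteq> {1..n}"
    and disj: "S \<inter> P = {}" and Q: "Q \<subseteq> {1..n}" "Q \<inter> (S \<union> P) = {}"
  shows "mutation_mean n (\<lambda>F. of_bool (Q \<subseteq> F) * burden v S P F)
    \<le> (1 / real n) ^ card Q / real n * (5 / 48 * (\<Sum>t\<in>S. \<phi> v - val t))"
proof -
  let ?T = "{l \<in> S. gap l < \<kappa> v}" and ?H = "{t \<in> S. \<kappa> v \<le> gap t}" and ?p = "1 / real n"
  let ?o = "\<lambda>F. (\<Sum>u\<in>{u \<in> P. gap u < \<kappa> v}. of_bool (u \<in> F) * val u) + overflow v"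
  let ?N = "\<lambda>t. {t' \<in> S - {t}. gap t \<le> gap t'}"
  have finS: "finite S" and finQ: "finite Q" using S Q finite_bits by auto
  have npos: "0 < real n" using n_ge1 by simp
  have k1: "1 \<le> \<phi> (\<kappa> v)" using phi_kappa_ge1[OF v] .
  have dnn: "0 \<le> \<phi> v - val i" if "i \<in> S" for i using val_mono[of i v] that S v by auto
  define sT where "sT = (\<Sum>t\<in>?T. \<phi> v - val t)"
  define sH where "sH = (\<Sum>t\<in>?H. \<phi> v - val t)"
  have sS: "(\<Sum>t\<in>S. \<phi> v - val t) = sT + sH"
  proof -
    have "S = ?T \<union> ?H" by auto
    then have "(\<Sum>t\<in>S. \<phi> v - val t) = (\<Sum>t\<in>?T \<union> ?H. \<phi> v - val t)" by simp
    also have "\<dots> = sT + sH" unfolding sT_def sH_def using finS by (intro sum.union_disjoint) auto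
    finally show ?thesis .
  qed
  have nn: "0 \<le> sT" "0 \<le> sH" unfolding sT_def sH_def using dnn by (auto intro!: sum_nonneg)
  have card2: "card (Q \<union> {t, t'}) = card Q + 2" if "t \<in> S" "t' \<in> S" "t \<noteq> t'" for t t'
  proof -
    have "card (Q \<union> {t, t'}) = card Q + card {t, t'}"
      using that Q finQ by (intro card_Un_disjoint) auto
    then show ?thesis using that by simp
  qed
  have card1: "card (Q \<union> {t}) = card Q + 1" if "t \<in> S" for t
  proof -
    have "t \<notin> Q" using that Q by blast
    then show ?thesis using finQ by simp
  qed
  have split: "mutation_mean n (\<lambda>F. of_bool (Q \<subseteq> F) * burden v S P F)
     = (\<Sum>l\<in>?T. \<Sum>t\<in>S - {l}. val l * mutation_mean n (\<lambda>F. of_bool (Q \<union> {l, t} \<subseteq> F)))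
     + (\<Sum>t\<in>?T. \<Sum>t'\<in>?N t. mutation_mean n (\<lambda>F. of_bool (Q \<union> {t, t'} \<subseteq> F) * ?o F))
     + (\<Sum>t\<in>?H. (\<phi> v - val t) / \<phi> (\<kappa> v) * mutation_mean n (\<lambda>F. of_bool (Q \<union> {t} \<subseteq> F) * ?o F))"
  proof -
    have "of_bool (Q \<subseteq> F) * burden v S P F
      = (\<Sum>l\<in>?T. \<Sum>t\<in>S - {l}. val l * of_bool (Q \<union> {l, t} \<subseteq> F))
      + (\<Sum>t\<in>?T. \<Sum>t'\<in>?N t. of_bool (Q \<union> {t, t'} \<subseteq> F) * ?o F)
      + (\<Sum>t\<in>?H. (\<phi> v - val t) / \<phi> (\<kappa> v) * (of_bool (Q \<union> {t} \<subseteq> F) * ?o F))" for F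
      by (cases "Q \<subseteq> F") (simp_all add: burden_def)
    then show ?thesis
      by (simp only: mutation_mean_add mutation_mean_sum mutation_mean_cmult)
  qed
  have "(\<Sum>l\<in>?T. \<Sum>t\<in>S - {l}. val l * mutation_mean n (\<lambda>F. of_bool (Q \<union> {l, t} \<subseteq> F)))
      = (\<Sum>l\<in>?T. \<Sum>t\<in>S - {l}. val l * ?p ^ (card Q + 2))"
    using S Q card2 by (intro sum.cong refl arg_cong2[of _ _ _ _ "(*)"]) (subst mutation_mean_superset, auto)
  also have "\<dots> \<le> (\<Sum>l\<in>?T. \<Sum>t\<in>S. val l * ?p ^ (card Q + 2))"
    using S val_nonneg finS by (intro sum_mono sum_mono2) (auto intro!: mult_nonneg_nonneg)
  also have "\<dots> = ?p ^ (card Q + 2) * (\<Sum>l\<in>?T. val l * real (card S))"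
    by (simp add: sum_distrib_left mult_ac)
  also have "\<dots> \<le> ?p ^ (card Q + 2) * (real n / 24 * sT)"
    unfolding sT_def by (intro mult_left_mono same_side_loss(1)[OF v S]) auto
  also have "\<dots> = ?p ^ card Q / real n * (2 / 48 * sT)"
    using npos by (simp add: field_simps power2_eq_square)
  finally have 1: "(\<Sum>l\<in>?T. \<Sum>t\<in>S - {l}. val l * mutation_mean n (\<lambda>F. of_bool (Q \<union> {l, t} \<subseteq> F)))
      \<le> ?p ^ card Q / real n * (2 / 48 * sT)" .
  have "(\<Sum>t\<in>?T. \<Sum>t'\<in>?N t. mutation_mean n (\<lambda>F. of_bool (Q \<union> {t, t'} \<subseteq> F) * ?o F))
      \<le> (\<Sum>t\<in>?T. \<Sum>t'\<in>?N t. ?p ^ (card Q + 2) * \<phi> (\<kappa> v) / 48)"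
  proof (intro sum_mono)
    fix t t' assume t: "t \<in> ?T" "t' \<in> ?N t"
    have "mutation_mean n (\<lambda>F. of_bool (Q \<union> {t, t'} \<subseteq> F) * ?o F) \<le> ?p ^ card (Q \<union> {t, t'}) * \<phi> (\<kappa> v) / 48"
      using t S Q disj by (intro mean_low_weight[OF v P]) auto
    then show "mutation_mean n (\<lambda>F. of_bool (Q \<union> {t, t'} \<subseteq> F) * ?o F) \<le> ?p ^ (card Q + 2) * \<phi> (\<kappa> v) / 48"
      using card2[of t t'] t by simp
  qed
  also have "\<dots> \<le> (\<Sum>t\<in>?T. \<Sum>t'\<in>{t' \<in> S. gap t \<le> gap t'}. ?p ^ (card Q + 2) * \<phi> (\<kappa> v) / 48)"
    using finS k1 by (intro sum_mono sum_mono2) auto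
  also have "\<dots> = ?p ^ (card Q + 2) / 48 * (\<Sum>t\<in>?T. real (card {t' \<in> S. gap t \<le> gap t'}) * \<phi> (\<kappa> v))"
    by (simp add: sum_distrib_left mult_ac)
  also have "\<dots> \<le> ?p ^ (card Q + 2) / 48 * (2 * real n * sT)"
    unfolding sT_def by (intro mult_left_mono same_side_loss(2)[OF v S]) auto
  also have "\<dots> = ?p ^ card Q / real n * (2 / 48 * sT)"
    using npos by (simp add: field_simps power2_eq_square)
  finally have 2: "(\<Sum>t\<in>?T. \<Sum>t'\<in>?N t. mutation_mean n (\<lambda>F. of_bool (Q \<union> {t, t'} \<subseteq> F) * ?o F))
      \<le> ?p ^ card Q / real n * (2 / 48 * sT)" .
  have "(\<Sum>t\<in>?H. (\<phi> v - val t) / \<phi> (\<kappa> v) * mutation_mean n (\<lambda>F. of_bool (Q \<union> {t} \<subseteq> F) * ?o F))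
      \<le> (\<Sum>t\<in>?H. (\<phi> v - val t) / \<phi> (\<kappa> v) * (?p ^ (card Q + 1) * \<phi> (\<kappa> v) / 48))"
  proof (intro sum_mono mult_left_mono)
    fix t assume t: "t \<in> ?H"
    have "mutation_mean n (\<lambda>F. of_bool (Q \<union> {t} \<subseteq> F) * ?o F) \<le> ?p ^ card (Q \<union> {t}) * \<phi> (\<kappa> v) / 48"
      using t S Q disj by (intro mean_low_weight[OF v P]) auto
    then show "mutation_mean n (\<lambda>F. of_bool (Q \<union> {t} \<subseteq> F) * ?o F) \<le> ?p ^ (card Q + 1) * \<phi> (\<kappa> v) / 48"
      using card1[of t] t by simp
    show "0 \<le> (\<phi> v - val t) / \<phi> (\<kappa> v)" using t dnn k1 by auto
  qed
  also have "\<dots> = (\<Sum>t\<in>?H. ?p ^ card Q / real n / 48 * (\<phi> v - val t))"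
  proof (rule sum.cong[OF refl])
    fix t
    have cancel: "d / k * (c * (1 / m) * k / 48) = c / m / 48 * d" if "k \<noteq> 0" for d k c m :: real
      using that by simp
    show "(\<phi> v - val t) / \<phi> (\<kappa> v) * (?p ^ (card Q + 1) * \<phi> (\<kappa> v) / 48)
        = ?p ^ card Q / real n / 48 * (\<phi> v - val t)"
      unfolding power_add power_one_right by (rule cancel) (use k1 in simp)
  qed
  also have "\<dots> = ?p ^ card Q / real n * (1 / 48 * sH)"
    by (simp add: sum_distrib_left sH_def)
  finally have 3: "(\<Sum>t\<in>?H. (\<phi> v - val t) / \<phi> (\<kappa> v) * mutation_mean n (\<lambda>F. of_bool (Q \<union> {t} \<subseteq> F) * ?o F))
      \<le> ?p ^ card Q / real n * (1 / 48 * sH)" .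
  have "mutation_mean n (\<lambda>F. of_bool (Q \<subseteq> F) * burden v S P F)
      \<le> ?p ^ card Q / real n * (2 / 48 * sT + 2 / 48 * sT + 1 / 48 * sH)"
    unfolding split using 1 2 3 by (simp add: distrib_left)
  also have "\<dots> \<le> ?p ^ card Q / real n * (5 / 48 * (\<Sum>t\<in>S. \<phi> v - val t))"
    unfolding sS using nn by (intro mult_left_mono) auto
  finally show ?thesis .
qed


section \<open>Drift of the potential\<close>

definition flip :: "nat set \<Rightarrow> nat set \<Rightarrow> nat set" where
  "flip Y F = (Y - F) \<union> (F - Y)"

definition cost :: "nat set \<Rightarrow> real" where
  "cost Y = sum gap Y + surplus Y * w B"

definition pot :: "nat set \<Rightarrow> real" where
  "pot Y = sum val Y + surplus Y * top_phi"

definition accepted :: "nat set \<Rightarrow> nat set \<Rightarrow> bool" where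
  "accepted Y F \<longleftrightarrow> 0 \<le> surplus (flip Y F) \<and> cost (flip Y F) \<le> cost Y"

definition pot_drop :: "nat set \<Rightarrow> nat set \<Rightarrow> real" where
  "pot_drop Y F = (if accepted Y F then pot Y - pot (flip Y F) else 0)"

lemma sum_flip:
  fixes h :: "nat \<Rightarrow> real"
  assumes "finite Y" "finite F"
  shows "sum h (flip Y F) = sum h Y - sum h (F \<inter> Y) + sum h (F - Y)"
proof -
  have "sum h (flip Y F) = sum h (Y - F) + sum h (F - Y)"
    unfolding flip_def using assms by (intro sum.union_disjoint) auto
  moreover have "sum h Y = sum h (Y - F) + sum h (F \<inter> Y)"
    using sum.Int_Diff[of Y h F] assms by (simp add: Int_commute)
  ultimately show ?thesis by simp
qed

lemma surplus_flip:
  assumes "finite Y" "finite F"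
  shows "surplus (flip Y F) = surplus Y + (surplus (F - Y) - surplus (F \<inter> Y))"
  unfolding surplus_def using sum_flip[OF assms, of side] by simp

lemma cost_flip_le_iff:
  assumes "finite Y" "finite F"
  shows "cost (flip Y F) \<le> cost Y \<longleftrightarrow>
    sum gap (F - Y) + (surplus (F - Y) - surplus (F \<inter> Y)) * w B \<le> sum gap (F \<inter> Y)"
  unfolding cost_def surplus_flip[OF assms] sum_flip[OF assms] by (simp add: algebra_simps)

lemma pot_flip:
  assumes "finite Y" "finite F"
  shows "pot Y - pot (flip Y F) =
    sum val (F \<inter> Y) - sum val (F - Y) - (surplus (F - Y) - surplus (F \<inter> Y)) * top_phi"
  unfolding pot_def surplus_flip[OF assms] sum_flip[OF assms] by (simp add: algebra_simps)

lemma abs_surplus_le: "\<bar>surplus X\<bar> \<le> real (card X)"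
proof -
  have "\<bar>surplus X\<bar> \<le> (\<Sum>i\<in>X. \<bar>side i\<bar>)" unfolding surplus_def by (rule sum_abs)
  also have "\<dots> = (\<Sum>i\<in>X. 1)" by (intro sum.cong) (auto simp: side_def)
  also have "\<dots> = real (card X)" by simp
  finally show ?thesis .
qed

lemma surplus_eq:
  assumes "finite X"
  shows "surplus X = real (card {i \<in> X. \<not> i \<le> B}) - real (card {i \<in> X. i \<le> B})"
proof -
  have "surplus X = (\<Sum>i\<in>X. of_bool (\<not> i \<le> B) - of_bool (i \<le> B))"
    unfolding surplus_def side_def by (intro sum.cong) auto
  then show ?thesis using assms by (simp add: sum_subtractf Int_def)
qed

lemma zero_gap_step:
  assumes A: "A \<subseteq> {1..n}" "\<And>a. a \<in> A \<Longrightarrow> gap a = 0" and U: "U \<subseteq> {1..n}"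
    and \<delta>: "0 \<le> \<delta>" and acc: "sum gap U + \<delta> * w B \<le> sum gap A"
  shows "sum val A - sum val U - \<delta> * top_phi = 0"
proof -
  have "sum gap A = 0" using A by simp
  moreover have "0 \<le> sum gap U" by (simp add: sum_nonneg)
  moreover have "0 \<le> \<delta> * w B" using \<delta> wB_pos by simp
  ultimately have "sum gap U = 0" "\<delta> * w B = 0" using acc by linarith+
  then have "\<delta> = 0" "\<And>u. u \<in> U \<Longrightarrow> gap u = 0"
    using wB_pos finite_bits[OF U] by (auto simp: sum_nonneg_eq_0_iff)
  then show ?thesis using A phi_0 by (simp add: val_def)
qed

lemma low_flipped_sum:
  assumes "F \<subseteq> {1..n}"
  shows "(\<Sum>u\<in>{u \<in> {1..n} - Y. gap u < \<kappa> v}. of_bool (u \<in> F) * val u)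
    = (\<Sum>l\<in>{l \<in> F - Y. gap l < \<kappa> v}. val l)"
  using assms by (intro sum.mono_neutral_cong_right) auto

lemma overflow_le: "v \<in> levels \<Longrightarrow> overflow v \<le> \<phi> (\<kappa> v) / 48"
proof -
  assume v: "v \<in> levels"
  have "0 \<le> (\<Sum>l\<in>{l \<in> {1..n}. gap l < \<kappa> v}. val l) / real n"
    using val_nonneg by (intro divide_nonneg_nonneg sum_nonneg) auto
  then show ?thesis using low_weight_le[OF v] by linarith
qed

definition low_loss :: "nat set \<Rightarrow> real \<Rightarrow> nat set \<Rightarrow> real" where
  "low_loss Y v F =
     (\<Sum>u\<in>{u \<in> {1..n} - Y. gap u < \<kappa> v}. of_bool (u \<in> F) * val u) + real (card F) * overflow v"

lemma low_loss_nonneg: "0 \<le> low_loss Y v F"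
  unfolding low_loss_def using val_nonneg overflow_nonneg
  by (intro add_nonneg_nonneg sum_nonneg mult_nonneg_nonneg) auto

lemma mean_low_loss:
  assumes v: "v \<in> levels" and Y: "Y \<subseteq> {1..n}" and Q: "Q \<subseteq> Y"
  shows "mutation_mean n (\<lambda>F. of_bool (Q \<subseteq> F) * low_loss Y v F)
    \<le> (real (card Q) + 2) / 48 * (1 / real n) ^ card Q * \<phi> (\<kappa> v)"
proof -
  let ?p = "1 / real n"
  let ?o = "\<lambda>F. (\<Sum>u\<in>{u \<in> {1..n} - Y. gap u < \<kappa> v}. of_bool (u \<in> F) * val u) + overflow v"
  have "mutation_mean n (\<lambda>F. of_bool (Q \<subseteq> F) * low_loss Y v F)
      \<le> mutation_mean n (\<lambda>F. of_bool (Q \<subseteq> F) * ?o F + overflow v * (of_bool (Q \<subseteq> F) * real (card F)))"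
    using overflow_nonneg[of v] by (intro mutation_mean_mono) (auto simp: low_loss_def mult.commute)
  also have "\<dots> = mutation_mean n (\<lambda>F. of_bool (Q \<subseteq> F) * ?o F)
      + overflow v * mutation_mean n (\<lambda>F. of_bool (Q \<subseteq> F) * real (card F))"
    by (simp add: mutation_mean_add mutation_mean_cmult)
  also have "\<dots> \<le> ?p ^ card Q * \<phi> (\<kappa> v) / 48 + \<phi> (\<kappa> v) / 48 * ((real (card Q) + 1) * ?p ^ card Q)"
  proof (rule add_mono)
    show "mutation_mean n (\<lambda>F. of_bool (Q \<subseteq> F) * ?o F) \<le> ?p ^ card Q * \<phi> (\<kappa> v) / 48"
      using Y Q by (intro mean_low_weight[OF v]) auto
    have m: "mutation_mean n (\<lambda>F. of_bool (Q \<subseteq> F) * real (card F)) \<le> (real (card Q) + 1) * ?p ^ card Q"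
      using mutation_mean_card_superset_le[of n Q] n_ge1 Y Q by auto
    have "overflow v * mutation_mean n (\<lambda>F. of_bool (Q \<subseteq> F) * real (card F))
       \<le> overflow v * ((real (card Q) + 1) * ?p ^ card Q)"
      using m overflow_nonneg by (intro mult_left_mono)
    also have "\<dots> \<le> \<phi> (\<kappa> v) / 48 * ((real (card Q) + 1) * ?p ^ card Q)"
      using overflow_le[OF v] by (intro mult_right_mono) auto
    finally show "overflow v * mutation_mean n (\<lambda>F. of_bool (Q \<subseteq> F) * real (card F))
       \<le> \<phi> (\<kappa> v) / 48 * ((real (card Q) + 1) * ?p ^ card Q)" .
  qed
  also have "\<dots> = (real (card Q) + 2) / 48 * ?p ^ card Q * \<phi> (\<kappa> v)"
  proof -
    have "c * k / 48 + k / 48 * ((q + 1) * c) = (q + 2) / 48 * c * k" for c k q :: real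
      by (simp add: field_simps)
    then show ?thesis .
  qed
  finally show ?thesis .
qed

definition same_side :: "nat set \<Rightarrow> nat \<Rightarrow> nat set" where
  "same_side Y i = {l \<in> {1..n} - Y. side l = side i \<and> gap l \<le> gap i}"

definition other_side :: "nat set \<Rightarrow> nat \<Rightarrow> nat set" where
  "other_side Y i = {l \<in> {1..n} - Y. side l \<noteq> side i}"

text \<open>The first sum covers steps repairing at least two misplaced bits, the second those
  repairing exactly one.\<close>

definition tight_loss :: "nat set \<Rightarrow> nat set \<Rightarrow> real" where
  "tight_loss Y F =
     (\<Sum>i\<in>{i \<in> Y. 0 < gap i}. \<Sum>j\<in>Y - {i}. of_bool ({i, j} \<subseteq> F) * low_loss Y (gap i) F)
   + (\<Sum>i\<in>{i \<in> Y. 0 < gap i}. of_bool ({i} \<subseteq> F) * burden (gap i) (same_side Y i) (other_side Y i) F)"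

lemma tight_burden_nonneg:
  assumes "Y \<subseteq> {1..n}" "i \<in> Y" "0 < gap i"
  shows "0 \<le> burden (gap i) (same_side Y i) (other_side Y i) F"
  using assms gap_level by (intro burden_nonneg) (auto simp: same_side_def other_side_def)

lemma tight_loss_ge_low_loss:
  assumes Y: "Y \<subseteq> {1..n}" and i: "i \<in> Y" "0 < gap i" "j \<in> Y - {i}" "{i, j} \<subseteq> F"
  shows "low_loss Y (gap i) F \<le> tight_loss Y F"
proof -
  have fin: "finite Y" using Y finite_bits by simp
  have "low_loss Y (gap i) F = (\<Sum>j\<in>{j}. of_bool ({i, j} \<subseteq> F) * low_loss Y (gap i) F)" using i by simp
  also have "\<dots> \<le> (\<Sum>j\<in>Y - {i}. of_bool ({i, j} \<subseteq> F) * low_loss Y (gap i) F)"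
    using i fin low_loss_nonneg by (intro sum_mono2) auto
  also have "\<dots> = (\<Sum>i\<in>{i}. \<Sum>j\<in>Y - {i}. of_bool ({i, j} \<subseteq> F) * low_loss Y (gap i) F)" by simp
  also have "\<dots> \<le> (\<Sum>i\<in>{i \<in> Y. 0 < gap i}. \<Sum>j\<in>Y - {i}. of_bool ({i, j} \<subseteq> F) * low_loss Y (gap i) F)"
    using i fin low_loss_nonneg by (intro sum_mono2) (auto intro!: sum_nonneg)
  moreover have "0 \<le> (\<Sum>i\<in>{i \<in> Y. 0 < gap i}. of_bool ({i} \<subseteq> F) * burden (gap i) (same_side Y i) (other_side Y i) F)"
    using tight_burden_nonneg[OF Y] by (intro sum_nonneg) auto
  ultimately show ?thesis unfolding tight_loss_def by linarith
qed

lemma tight_loss_ge_burden: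
  assumes Y: "Y \<subseteq> {1..n}" and i: "i \<in> Y" "0 < gap i" "i \<in> F"
  shows "burden (gap i) (same_side Y i) (other_side Y i) F \<le> tight_loss Y F"
proof -
  have fin: "finite Y" using Y finite_bits by simp
  have "burden (gap i) (same_side Y i) (other_side Y i) F
      = (\<Sum>i\<in>{i}. of_bool ({i} \<subseteq> F) * burden (gap i) (same_side Y i) (other_side Y i) F)" using i by simp
  also have "\<dots> \<le> (\<Sum>i\<in>{i \<in> Y. 0 < gap i}. of_bool ({i} \<subseteq> F) * burden (gap i) (same_side Y i) (other_side Y i) F)"
    using i fin tight_burden_nonneg[OF Y] by (intro sum_mono2) auto
  moreover have "0 \<le> (\<Sum>i\<in>{i \<in> Y. 0 < gap i}. \<Sum>j\<in>Y - {i}. of_bool ({i, j} \<subseteq> F) * low_loss Y (gap i) F)"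
    using low_loss_nonneg by (intro sum_nonneg) auto
  ultimately show ?thesis unfolding tight_loss_def by linarith
qed

lemma tight_loss_nonneg: "Y \<subseteq> {1..n} \<Longrightarrow> 0 \<le> tight_loss Y F"
  unfolding tight_loss_def using low_loss_nonneg tight_burden_nonneg
  by (intro add_nonneg_nonneg sum_nonneg mult_nonneg_nonneg) auto

lemma obtain_max_gap:
  assumes "finite A" "A \<noteq> {}"
  obtains i where "i \<in> A" "\<And>a. a \<in> A \<Longrightarrow> gap a \<le> gap i"
proof -
  have "Max (gap ` A) \<in> gap ` A" using assms by (intro Max_in) auto
  then obtain i where "i \<in> A" "gap i = Max (gap ` A)" by (auto simp: image_iff)
  then show thesis using that assms by auto
qed

lemma side_pm: "side i = 1 \<or> side i = - 1"
  by (simp add: side_def)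

lemma surplus_same_other:
  assumes "finite U"
  shows "surplus U = side i * (real (card {l \<in> U. side l = side i}) - real (card {l \<in> U. side l \<noteq> side i}))"
proof -
  have "surplus U = (\<Sum>l\<in>U. side i * (of_bool (side l = side i) - of_bool (side l \<noteq> side i)))"
    unfolding surplus_def
  proof (rule sum.cong[OF refl])
    fix l
    show "side l = side i * (of_bool (side l = side i) - of_bool (side l \<noteq> side i))"
      using side_pm[of i] side_pm[of l] by auto
  qed
  also have "\<dots> = side i * (\<Sum>l\<in>U. of_bool (side l = side i) - of_bool (side l \<noteq> side i))"
    by (simp only: sum_distrib_left)
  finally show ?thesis using assms by (simp add: sum_subtractf Int_def)
qed

lemma pot_drop_plus_tight_loss_nonneg:
  assumes Y: "Y \<subseteq> {1..n}" and tight: "surplus Y = 0" and F: "F \<subseteq> {1..n}"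
  shows "0 \<le> pot_drop Y F + tight_loss Y F"
proof (cases "accepted Y F")
  case False
  then show ?thesis using tight_loss_nonneg[OF Y] by (simp add: pot_drop_def)
next
  case True
  have finY: "finite Y" and finF: "finite F" using Y F finite_bits by auto
  define A where "A = F \<inter> Y"
  define U where "U = F - Y"
  define \<delta> where "\<delta> = surplus U - surplus A"
  have AU: "A \<subseteq> {1..n}" "U \<subseteq> {1..n}" "finite A" "finite U" using F finF by (auto simp: A_def U_def)
  have drop: "pot_drop Y F = sum val A - sum val U - \<delta> * top_phi"
    using True pot_flip[OF finY finF] by (simp add: pot_drop_def A_def U_def \<delta>_def)
  have \<delta>0: "0 \<le> \<delta>" using True tight surplus_flip[OF finY finF]
    by (simp add: accepted_def A_def U_def \<delta>_def)
  have acc: "sum gap U + \<delta> * w B \<le> sum gap A"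
    using True cost_flip_le_iff[OF finY finF] by (simp add: accepted_def A_def U_def \<delta>_def)
  show ?thesis
  proof (cases "\<forall>a\<in>A. gap a = 0")
    case zero: True
    then show ?thesis using zero_gap_step[OF AU(1) _ AU(2) \<delta>0 acc] drop tight_loss_nonneg[OF Y] by simp
  next
    case False
    then have "A \<noteq> {}" by auto
    then obtain i where i: "i \<in> A" "\<And>a. a \<in> A \<Longrightarrow> gap a \<le> gap i"
      using obtain_max_gap AU by blast
    obtain a0 where "a0 \<in> A" "gap a0 \<noteq> 0" using False by auto
    then have "0 < gap i" using i(2)[of a0] gap_nonneg[of a0] by linarith
    have iY: "i \<in> Y" "i \<in> F" "i \<in> {1..n}" using i Y by (auto simp: A_def)
    have lev: "gap i \<in> levels" using gap_level iY \<open>0 < gap i\<close> by simp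
    have loss: "sum val U + \<delta> * top_phi - sum val A
        \<le> (\<Sum>l\<in>{l \<in> U. gap l < \<kappa> (gap i)}. val l) + \<delta> * overflow (gap i)"
      using accepted_loss_bound[OF lev AU(1) i(2) AU(2) _ acc] \<delta>0 by simp
    show ?thesis
    proof (cases "A = {i}")
      case False
      then obtain j where j: "j \<in> A" "j \<noteq> i" using i by auto
      have "\<delta> \<le> real (card U) + real (card A)"
        using abs_surplus_le[of U] abs_surplus_le[of A] by (simp add: \<delta>_def)
      also have "\<dots> = real (card F)"
        using card_Un_disjoint[of U A] AU by (simp add: A_def U_def Un_Diff_Int disjoint_iff)
      finally have "\<delta> * overflow (gap i) \<le> real (card F) * overflow (gap i)"
        using overflow_nonneg by (intro mult_right_mono)
      then have "sum val U + \<delta> * top_phi - sum val A \<le> low_loss Y (gap i) F"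
        using loss low_flipped_sum[OF F] by (simp add: low_loss_def U_def)
      then show ?thesis
        using tight_loss_ge_low_loss[OF Y iY(1) \<open>0 < gap i\<close>, of j F] j i drop by (auto simp: A_def)
    next
      case A: True
      let ?S = "same_side Y i" and ?P = "other_side Y i"
      let ?US = "{l \<in> U. side l = side i}" and ?UP = "{l \<in> U. side l \<noteq> side i}"
      have acc': "sum gap U + \<delta> * w B \<le> gap i" using acc A by simp
      have \<delta>w: "0 \<le> \<delta> * w B" using \<delta>0 wB_pos by simp
      have gapU: "gap l \<le> gap i" if "l \<in> U" for l
        using member_le_sum[of l U gap] AU that acc' \<delta>w by simp
      have FS: "F \<inter> ?S = ?US" and FP: "F \<inter> ?P = ?UP"
        using gapU F by (auto simp: same_side_def other_side_def U_def)
      have deq: "\<delta> = side i * (real (card ?US) - real (card ?UP)) - side i"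
        using surplus_same_other[OF AU(4), of i] A by (simp add: \<delta>_def surplus_def)
      have count: "real (card ?US) = 1 + \<delta> + real (card ?UP)"
      proof (cases "i \<le> B")
        case False
        then have "side i = 1" by (simp add: side_def)
        then show ?thesis using deq by simp
      next
        case True
        then have s: "side i = - 1" by (simp add: side_def)
        have "0 \<le> sum gap U" by (simp add: sum_nonneg)
        then have "\<delta> * w B < 1 * w B"
          using acc' gap_less_wB[of i] True iY by simp
        then have "\<delta> < 1" using wB_pos mult_less_cancel_right_pos by blast
        moreover have deq': "\<delta> = 1 + real (card ?UP) - real (card ?US)" using deq s by simp
        ultimately have "real (card ?UP) < real (card ?US)" "real (card ?US) \<le> real (card ?UP + 1)"
          using \<delta>0 by auto
        then have "card ?US = card ?UP + 1" unfolding of_nat_less_iff of_nat_le_iff by simp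
        then have "\<delta> = 0" using deq' by simp
        then show ?thesis using deq' by simp
      qed
      show ?thesis
      proof (cases "card ?US = 1")
        case True
        then have "\<delta> = 0" "card ?UP = 0" using count \<delta>0 by linarith+
        then have "?UP = {}" using AU by simp
        obtain l where l: "?US = {l}" using True card_1_singletonE by blast
        then have U: "U = {l}" using \<open>?UP = {}\<close> by blast
        then have "val l \<le> val i"
          using val_mono[of l "gap i"] AU lev gapU by (simp add: val_def)
        then show ?thesis using drop A U \<open>\<delta> = 0\<close> tight_loss_nonneg[OF Y, of F] by simp
      next
        case False
        then have two: "2 \<le> card ?US" using count \<delta>0 by linarith
        have S: "?S \<subseteq> {1..n}" "\<And>t. t \<in> ?S \<Longrightarrow> gap t \<le> gap i" and P: "?P \<subseteq> {1..n}" "?S \<inter> ?P = {}"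
          by (auto simp: same_side_def other_side_def)
        have "(\<Sum>l\<in>{l \<in> F \<inter> (?S \<union> ?P). gap l < \<kappa> (gap i)}. val l) + \<delta> * overflow (gap i)
            \<le> burden (gap i) ?S ?P F"
        proof (rule burden_ge[OF lev S P])
          show "2 \<le> card (F \<inter> ?S)" using two FS by simp
          show "0 \<le> \<delta>" by (rule \<delta>0)
          show "\<delta> + 1 \<le> real (card (F \<inter> ?S))" using count FS by simp
          assume high: "{t \<in> F \<inter> ?S. gap t < \<kappa> (gap i)} = {}"
          have each: "\<phi> (\<kappa> (gap i)) \<le> \<phi> (gap i) - val t" if t: "t \<in> ?US" for t
          proof -
            have "\<exists>t'. t' \<in> ?US \<and> t' \<noteq> t"
            proof (rule ccontr)
              assume "\<not> ?thesis"
              then have "?US \<subseteq> {t}" by auto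
              then have "card ?US \<le> 1" using card_mono[of "{t}" ?US] by simp
              then show False using two by simp
            qed
            then obtain t' where t': "t' \<in> ?US" "t' \<noteq> t" by blast
            have "sum gap {t, t'} \<le> sum gap U" using t t' AU by (intro sum_mono2) auto
            then have "gap t + gap t' \<le> gap i" using t' acc' \<delta>w by simp
            moreover have "\<kappa> (gap i) \<le> gap t'" "\<kappa> (gap i) \<le> gap t" using high FS t t' by force+
            ultimately have "\<kappa> (gap i) \<le> gap i - gap t" by simp
            then have "slope (gap i) * \<kappa> (gap i) \<le> slope (gap i) * (gap i - gap t)"
              using slope_pos[OF lev] by (intro mult_left_mono) auto
            moreover have "val t \<le> slope (gap i) * gap t"
              using val_le_slope[of t "gap i"] lev t AU \<open>\<kappa> (gap i) \<le> gap t\<close> by auto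
            moreover have "slope (gap i) * gap i \<le> \<phi> (gap i)" using phi_ge_slope[OF lev lev] by simp
            ultimately show ?thesis using slope_kappa[OF lev] by (simp add: right_diff_distrib)
          qed
          have "max 1 \<delta> \<le> real (card ?US)" using count \<delta>0 by simp
          then have "max 1 \<delta> * \<phi> (\<kappa> (gap i)) \<le> real (card ?US) * \<phi> (\<kappa> (gap i))"
            using phi_kappa_ge1[OF lev] by (intro mult_right_mono) auto
          also have "\<dots> = (\<Sum>t\<in>?US. \<phi> (\<kappa> (gap i)))" by simp
          also have "\<dots> \<le> (\<Sum>t\<in>?US. \<phi> (gap i) - val t)" using each by (intro sum_mono) simp
          finally show "(\<Sum>u\<in>{u \<in> F \<inter> ?P. gap u < \<kappa> (gap i)}. val u) + \<delta> * overflow (gap i) = 0 \<or>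
              max 1 \<delta> * \<phi> (\<kappa> (gap i)) \<le> (\<Sum>t\<in>F \<inter> ?S. \<phi> (gap i) - val t)" using FS by simp
        qed
        moreover have "F \<inter> (?S \<union> ?P) = U" using FS FP by blast
        ultimately show ?thesis
          using loss drop tight_loss_ge_burden[OF Y iY(1) \<open>0 < gap i\<close> iY(2)] by simp
      qed
    qed
  qed
qed


lemma mean_tight_loss:
  assumes Y: "Y \<subseteq> {1..n}"
  shows "mutation_mean n (tight_loss Y) \<le> (1 / real n)\<^sup>2 *
     (real (card Y) / 12 * sum val Y
      + 5 / 48 * (\<Sum>i\<in>{i \<in> Y. 0 < gap i}. \<Sum>l\<in>same_side Y i. val i - val l))"
proof -
  let ?p = "1 / real n" and ?Y = "{i \<in> Y. 0 < gap i}"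
  have fin: "finite Y" using Y finite_bits by simp
  have "mutation_mean n (tight_loss Y)
     = (\<Sum>i\<in>?Y. \<Sum>j\<in>Y - {i}. mutation_mean n (\<lambda>F. of_bool ({i, j} \<subseteq> F) * low_loss Y (gap i) F))
     + (\<Sum>i\<in>?Y. mutation_mean n (\<lambda>F. of_bool ({i} \<subseteq> F) * burden (gap i) (same_side Y i) (other_side Y i) F))"
    unfolding tight_loss_def by (simp only: mutation_mean_add mutation_mean_sum)
  also have "\<dots> \<le> (\<Sum>i\<in>?Y. \<Sum>j\<in>Y - {i}. ?p\<^sup>2 / 12 * val i)
     + (\<Sum>i\<in>?Y. ?p\<^sup>2 * (5 / 48 * (\<Sum>l\<in>same_side Y i. val i - val l)))"
  proof (intro add_mono sum_mono)
    fix i j assume i: "i \<in> ?Y" and j: "j \<in> Y - {i}"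
    have lev: "gap i \<in> levels" using i Y gap_level by auto
    have "mutation_mean n (\<lambda>F. of_bool ({i, j} \<subseteq> F) * low_loss Y (gap i) F)
        \<le> (real (card {i, j}) + 2) / 48 * ?p ^ card {i, j} * \<phi> (\<kappa> (gap i))"
      using i j by (intro mean_low_loss[OF lev Y]) auto
    also have "\<dots> = ?p\<^sup>2 / 12 * \<phi> (\<kappa> (gap i))" using j by (simp add: power2_eq_square)
    also have "\<dots> \<le> ?p\<^sup>2 / 12 * val i"
      using phi_kappa_le[OF lev] unfolding val_def by (intro mult_left_mono) auto
    finally show "mutation_mean n (\<lambda>F. of_bool ({i, j} \<subseteq> F) * low_loss Y (gap i) F) \<le> ?p\<^sup>2 / 12 * val i" .
  next
    fix i assume i: "i \<in> ?Y"
    have lev: "gap i \<in> levels" using i Y gap_level by auto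
    have "mutation_mean n (\<lambda>F. of_bool ({i} \<subseteq> F) * burden (gap i) (same_side Y i) (other_side Y i) F)
       \<le> ?p ^ card {i} / real n * (5 / 48 * (\<Sum>l\<in>same_side Y i. \<phi> (gap i) - val l))"
      using i Y by (intro mean_burden[OF lev]) (auto simp: same_side_def other_side_def)
    then show "mutation_mean n (\<lambda>F. of_bool ({i} \<subseteq> F) * burden (gap i) (same_side Y i) (other_side Y i) F)
       \<le> ?p\<^sup>2 * (5 / 48 * (\<Sum>l\<in>same_side Y i. val i - val l))"
      by (simp add: val_def[of i] power2_eq_square)
  qed
  also have "(\<Sum>i\<in>?Y. \<Sum>j\<in>Y - {i}. ?p\<^sup>2 / 12 * val i) \<le> (\<Sum>i\<in>Y. \<Sum>j\<in>Y. ?p\<^sup>2 / 12 * val i)"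
  proof (rule order_trans)
    have nn: "0 \<le> ?p\<^sup>2 / 12 * val i" if "i \<in> Y" for i using val_nonneg that Y by auto
    show "(\<Sum>i\<in>?Y. \<Sum>j\<in>Y - {i}. ?p\<^sup>2 / 12 * val i) \<le> (\<Sum>i\<in>?Y. \<Sum>j\<in>Y. ?p\<^sup>2 / 12 * val i)"
      using fin nn by (intro sum_mono sum_mono2) auto
    show "(\<Sum>i\<in>?Y. \<Sum>j\<in>Y. ?p\<^sup>2 / 12 * val i) \<le> (\<Sum>i\<in>Y. \<Sum>j\<in>Y. ?p\<^sup>2 / 12 * val i)"
      using fin nn by (intro sum_mono2) (auto intro!: sum_nonneg)
  qed
  also have "(\<Sum>i\<in>Y. \<Sum>j\<in>Y. ?p\<^sup>2 / 12 * val i) = ?p\<^sup>2 * (real (card Y) / 12 * sum val Y)"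
    by (simp add: sum_distrib_left mult_ac)
  also have "?p\<^sup>2 * (real (card Y) / 12 * sum val Y)
      + (\<Sum>i\<in>?Y. ?p\<^sup>2 * (5 / 48 * (\<Sum>l\<in>same_side Y i. val i - val l)))
     = ?p\<^sup>2 * (real (card Y) / 12 * sum val Y + 5 / 48 * (\<Sum>i\<in>?Y. \<Sum>l\<in>same_side Y i. val i - val l))"
    by (simp only: sum_distrib_left[symmetric] distrib_left)
  finally show ?thesis by simp
qed

lemma tight_drift:
  assumes Y: "Y \<subseteq> {1..n}" and tight: "surplus Y = 0"
  shows "pot Y / (6 * (real n)\<^sup>2) \<le> mutation_mean n (pot_drop Y)"
proof (cases "Y = {}")
  case True
  have "pot_drop {} F \<ge> 0" if F: "F \<subseteq> {1..n}" for F
    using pot_drop_plus_tight_loss_nonneg[of "{}" F] F tight True by (simp add: tight_loss_def)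
  then have "mutation_mean n (\<lambda>_. 0) \<le> mutation_mean n (pot_drop Y)"
    using True by (intro mutation_mean_mono) auto
  then show ?thesis using True by (simp add: mutation_mean_const pot_def surplus_def)
next
  case False
  let ?p = "1 / real n" and ?Yp = "{i \<in> Y. 0 < gap i}"
  let ?YH = "{i \<in> Y. \<not> i \<le> B}" and ?YL = "{i \<in> Y. i \<le> B}"
  have fin: "finite Y" using Y finite_bits by simp
  have pot: "pot Y = sum val Y" using tight by (simp add: pot_def)
  define k where "k = card ?YL"
  have k1: "card ?YH = k" using surplus_eq[OF fin] tight by (simp add: k_def)
  have "Y = ?YH \<union> ?YL" by auto
  moreover have "card (?YH \<union> ?YL) = card ?YH + card ?YL" using fin by (intro card_Un_disjoint) auto
  ultimately have cardY: "card Y = 2 * k" using k1 k_def by simp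
  have sumY: "sum val Y = sum val ?YH + sum val ?YL"
  proof -
    have "sum val (?YH \<union> ?YL) = sum val ?YH + sum val ?YL" using fin by (intro sum.union_disjoint) auto
    then show ?thesis using \<open>Y = ?YH \<union> ?YL\<close> by simp
  qed
  have "1 \<le> k" using cardY False fin by (cases k) auto
  define sw where "sw = (\<Sum>i\<in>?Yp. \<Sum>l\<in>same_side Y i. val i - val l)"
  have sw0: "0 \<le> sw"
  proof -
    have "0 \<le> val i - val l" if "i \<in> ?Yp" "l \<in> same_side Y i" for i l
    proof -
      have "gap i \<in> levels" using that Y by (intro gap_level) auto
      then show ?thesis using val_mono[of l "gap i"] that by (simp add: same_side_def val_def[of i])
    qed
    then show ?thesis unfolding sw_def by (auto intro!: sum_nonneg)
  qed
  let ?h = "\<lambda>F. pot_drop Y F + tight_loss Y F"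
  let ?pair = "\<lambda>(i, l). {i, l :: nat}"
  define D1 where "D1 = Sigma ?Yp (same_side Y)"
  define D2 where "D2 = ?YH \<times> ?YL"
  have D1: "i \<in> Y" "l \<in> {1..n}" "l \<notin> Y" "side l = side i" "gap l \<le> gap i" "0 < gap i" "i \<noteq> l"
    if "(i, l) \<in> D1" for i l using that by (auto simp: D1_def same_side_def)
  have D2: "i \<in> Y" "l \<in> Y" "\<not> i \<le> B" "l \<le> B" if "(i, l) \<in> D2" for i l
    using that by (auto simp: D2_def)
  have finD: "finite D1" "finite D2" using fin by (auto simp: D1_def D2_def same_side_def)
  have inj1: "inj_on ?pair D1"
  proof (rule inj_onI)
    fix x y assume xy: "x \<in> D1" "y \<in> D1" "?pair x = ?pair y"
    obtain i l i' l' where eq: "x = (i, l)" "y = (i', l')" by (cases x, cases y)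
    then show "x = y"
      using xy D1(1,3)[of i l] D1(1,3)[of i' l'] by (auto simp: doubleton_eq_iff)
  qed
  have inj2: "inj_on ?pair D2"
  proof (rule inj_onI)
    fix x y assume xy: "x \<in> D2" "y \<in> D2" "?pair x = ?pair y"
    obtain i l i' l' where eq: "x = (i, l)" "y = (i', l')" by (cases x, cases y)
    then show "x = y"
      using xy D2(3,4)[of i l] D2(3,4)[of i' l'] by (auto simp: doubleton_eq_iff)
  qed
  have disj: "?pair ` D1 \<inter> ?pair ` D2 = {}"
    by (auto simp: doubleton_eq_iff) (use D1(3) D2(1,2) in blast)+
  have h1: "val i - val l \<le> ?h {i, l}" if il: "(i, l) \<in> D1" for i l
  proof -
    note d = D1[OF il]
    have eq: "{i, l} \<inter> Y = {i}" "{i, l} - Y = {l}" using d by auto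
    have "accepted Y {i, l}"
      using surplus_flip[OF fin, of "{i, l}"] cost_flip_le_iff[OF fin, of "{i, l}"] tight d
      by (simp add: accepted_def eq surplus_def)
    then have "pot_drop Y {i, l} = val i - val l"
      using pot_flip[OF fin, of "{i, l}"] d by (simp add: pot_drop_def eq surplus_def)
    then show ?thesis using tight_loss_nonneg[OF Y, of "{i, l}"] by simp
  qed
  have h2: "val i + val j \<le> ?h {i, j}" if ij: "(i, j) \<in> D2" for i j
  proof -
    note d = D2[OF ij]
    have ne: "i \<noteq> j" using d by auto
    have eq: "{i, j} \<inter> Y = {i, j}" "{i, j} - Y = {}" using d by auto
    have sides: "surplus {i, j} = 0" using ne d by (simp add: surplus_def side_def)
    have "accepted Y {i, j}"
      using surplus_flip[OF fin, of "{i, j}"] cost_flip_le_iff[OF fin, of "{i, j}"] tight ne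
      unfolding accepted_def eq sides by (simp add: surplus_def)
    then have "pot_drop Y {i, j} = val i + val j"
      using pot_flip[OF fin, of "{i, j}"] ne unfolding pot_drop_def eq sides by (simp add: surplus_def)
    then show ?thesis using tight_loss_nonneg[OF Y, of "{i, j}"] by simp
  qed
  have "?p\<^sup>2 * (sw + real k * sum val Y) =
     (\<Sum>(i, l)\<in>D1. ?p\<^sup>2 * (val i - val l)) + (\<Sum>(i, j)\<in>D2. ?p\<^sup>2 * (val i + val j))"
  proof -
    have "(\<Sum>(i, l)\<in>D1. ?p\<^sup>2 * (val i - val l)) = ?p\<^sup>2 * sw"
      unfolding D1_def sw_def sum_distrib_left using fin
      by (subst sum.Sigma) (auto simp: same_side_def)
    moreover have "(\<Sum>(i, j)\<in>D2. ?p\<^sup>2 * (val i + val j)) = ?p\<^sup>2 * (\<Sum>i\<in>?YH. \<Sum>j\<in>?YL. val i + val j)"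
      unfolding D2_def sum_distrib_left by (rule sum.cartesian_product[symmetric])
    moreover have "(\<Sum>i\<in>?YH. \<Sum>j\<in>?YL. val i + val j) = real k * sum val Y"
      using k1 unfolding sumY by (simp add: sum.distrib k_def sum_distrib_left distrib_left)
    ultimately show ?thesis by (simp add: distrib_left)
  qed
  also have "\<dots> \<le> (\<Sum>x\<in>D1. ?p ^ card (?pair x) * ?h (?pair x)) + (\<Sum>x\<in>D2. ?p ^ card (?pair x) * ?h (?pair x))"
  proof (intro add_mono sum_mono)
    fix x assume x: "x \<in> D1"
    obtain i l where il: "x = (i, l)" by (cases x)
    then have "card {i, l} = 2" using D1[of i l] x by simp
    then show "(case x of (i, l) \<Rightarrow> ?p\<^sup>2 * (val i - val l)) \<le> ?p ^ card (?pair x) * ?h (?pair x)"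
      unfolding il prod.case using h1[of i l] x il by (simp only:) (intro mult_left_mono, auto)
  next
    fix x assume x: "x \<in> D2"
    obtain i j where ij: "x = (i, j)" by (cases x)
    then have "i \<noteq> j" using D2[of i j] x by auto
    then have "card {i, j} = 2" by simp
    then show "(case x of (i, j) \<Rightarrow> ?p\<^sup>2 * (val i + val j)) \<le> ?p ^ card (?pair x) * ?h (?pair x)"
      unfolding ij prod.case using h2[of i j] x ij by (simp only:) (intro mult_left_mono, auto)
  qed
  also have "\<dots> = (\<Sum>F\<in>?pair ` D1. ?p ^ card F * ?h F) + (\<Sum>F\<in>?pair ` D2. ?p ^ card F * ?h F)"
    by (simp only: sum.reindex[OF inj1] sum.reindex[OF inj2] o_def)
  also have "\<dots> = (\<Sum>F\<in>?pair ` D1 \<union> ?pair ` D2. ?p ^ card F * ?h F)"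
    using finD disj by (intro sum.union_disjoint[symmetric]) auto
  finally have "?p\<^sup>2 * (sw + real k * sum val Y) / 3
      \<le> (\<Sum>F\<in>?pair ` D1 \<union> ?pair ` D2. ?p ^ card F * ?h F) / 3"
    by (intro divide_right_mono) auto
  also have "\<dots> \<le> mutation_mean n ?h"
  proof (rule mutation_mean_ge_sum[OF n_ge1])
    show "?pair ` D1 \<union> ?pair ` D2 \<subseteq> Pow {1..n} - {{}}"
      using Y D1 D2 by fastforce
    show "0 \<le> ?h F" if "F \<subseteq> {1..n}" for F
      using pot_drop_plus_tight_loss_nonneg[OF Y tight that] .
  qed
  also have "\<dots> = mutation_mean n (pot_drop Y) + mutation_mean n (tight_loss Y)"
    by (rule mutation_mean_add)
  also have "mutation_mean n (tight_loss Y) \<le> ?p\<^sup>2 * (real (card Y) / 12 * sum val Y + 5 / 48 * sw)"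
    using mean_tight_loss[OF Y] by (simp add: sw_def)
  also have "\<dots> \<le> ?p\<^sup>2 * (real k * sum val Y / 6 + sw / 3)"
    using cardY sw0 by (intro mult_left_mono) auto
  finally have "?p\<^sup>2 * (sw + real k * sum val Y) / 3
      \<le> mutation_mean n (pot_drop Y) + ?p\<^sup>2 * (real k * sum val Y / 6 + sw / 3)" by simp
  moreover have "p * (b / 6) \<le> m" if "p * (a + b) / 3 \<le> m + p * (b / 6 + a / 3)" for p a b m :: real
    using that by (simp add: field_simps)
  ultimately have "?p\<^sup>2 * (real k * sum val Y / 6) \<le> mutation_mean n (pot_drop Y)" by blast
  moreover have "1 * sum val Y \<le> real k * sum val Y"
    using \<open>1 \<le> k\<close> Y val_nonneg by (intro mult_right_mono sum_nonneg) auto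
  then have "?p\<^sup>2 * (sum val Y / 6) \<le> ?p\<^sup>2 * (real k * sum val Y / 6)"
    by (intro mult_left_mono) auto
  ultimately have "?p\<^sup>2 * (sum val Y / 6) \<le> mutation_mean n (pot_drop Y)" by linarith
  then show ?thesis unfolding pot by (simp add: power_one_over mult.commute)
qed

text \<open>With positive surplus, the surplus itself can be the largest decreasing item, which gives the
  terms at level \<open>w B\<close>.\<close>

definition slack_loss :: "nat set \<Rightarrow> nat set \<Rightarrow> real" where
  "slack_loss Y F =
     (\<Sum>i\<in>{i \<in> Y. 0 < gap i}. of_bool ({i} \<subseteq> F) * low_loss Y (gap i) F)
   + (\<Sum>i\<in>Y. of_bool ({i} \<subseteq> F) *
       ((\<Sum>u\<in>{u \<in> {1..n} - Y. gap u < \<kappa> (w B)}. of_bool (u \<in> F) * val u) + overflow (w B)))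
   + burden (w B) {l \<in> {1..n} - Y. l \<le> B} {l \<in> {1..n} - Y. \<not> l \<le> B} F"

lemma low_overflow_nonneg:
  "0 \<le> (\<Sum>u\<in>{u \<in> {1..n} - Y. gap u < \<kappa> v}. of_bool (u \<in> F) * val u) + overflow v"
  using val_nonneg overflow_nonneg by (intro add_nonneg_nonneg sum_nonneg mult_nonneg_nonneg) auto

lemma slack_burden_nonneg:
  "0 \<le> burden (w B) {l \<in> {1..n} - Y. l \<le> B} {l \<in> {1..n} - Y. \<not> l \<le> B} F"
  using wB_level gap_less_wB by (intro burden_nonneg) (auto intro: less_imp_le)

lemma slack_loss_ge_burden:
  "burden (w B) {l \<in> {1..n} - Y. l \<le> B} {l \<in> {1..n} - Y. \<not> l \<le> B} F \<le> slack_loss Y F"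
proof -
  have "0 \<le> (\<Sum>i\<in>{i \<in> Y. 0 < gap i}. of_bool ({i} \<subseteq> F) * low_loss Y (gap i) F)"
    using low_loss_nonneg by (intro sum_nonneg) auto
  moreover have "0 \<le> (\<Sum>i\<in>Y. of_bool ({i} \<subseteq> F) *
       ((\<Sum>u\<in>{u \<in> {1..n} - Y. gap u < \<kappa> (w B)}. of_bool (u \<in> F) * val u) + overflow (w B)))"
    using low_overflow_nonneg by (intro sum_nonneg mult_nonneg_nonneg) auto
  ultimately show ?thesis unfolding slack_loss_def by linarith
qed

lemma slack_loss_nonneg: "0 \<le> slack_loss Y F"
  using slack_burden_nonneg slack_loss_ge_burden by (rule order_trans)

lemma slack_loss_ge_low_loss:
  assumes Y: "Y \<subseteq> {1..n}" and i: "i \<in> Y" "0 < gap i" "i \<in> F"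
  shows "low_loss Y (gap i) F \<le> slack_loss Y F"
proof -
  have "low_loss Y (gap i) F = (\<Sum>i\<in>{i}. of_bool ({i} \<subseteq> F) * low_loss Y (gap i) F)" using i by simp
  also have "\<dots> \<le> (\<Sum>i\<in>{i \<in> Y. 0 < gap i}. of_bool ({i} \<subseteq> F) * low_loss Y (gap i) F)"
    using i finite_bits[OF Y] low_loss_nonneg by (intro sum_mono2) auto
  moreover have "0 \<le> (\<Sum>i\<in>Y. of_bool ({i} \<subseteq> F) *
       ((\<Sum>u\<in>{u \<in> {1..n} - Y. gap u < \<kappa> (w B)}. of_bool (u \<in> F) * val u) + overflow (w B)))"
    using low_overflow_nonneg by (intro sum_nonneg mult_nonneg_nonneg) auto
  ultimately show ?thesis unfolding slack_loss_def using slack_burden_nonneg[of Y F] by linarith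
qed

lemma slack_loss_ge_low:
  assumes Y: "Y \<subseteq> {1..n}" and F: "F \<subseteq> {1..n}" and i: "i \<in> Y" "i \<in> F"
  shows "(\<Sum>l\<in>{l \<in> F - Y. gap l < \<kappa> (w B)}. val l) \<le> slack_loss Y F"
proof -
  let ?o = "(\<Sum>u\<in>{u \<in> {1..n} - Y. gap u < \<kappa> (w B)}. of_bool (u \<in> F) * val u) + overflow (w B)"
  have "(\<Sum>l\<in>{l \<in> F - Y. gap l < \<kappa> (w B)}. val l) \<le> ?o"
    using low_flipped_sum[OF F] overflow_nonneg by simp
  also have "?o = (\<Sum>i\<in>{i}. of_bool ({i} \<subseteq> F) * ?o)" using i by simp
  also have "\<dots> \<le> (\<Sum>i\<in>Y. of_bool ({i} \<subseteq> F) * ?o)"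
    using i finite_bits[OF Y] low_overflow_nonneg
    by (intro sum_mono2 mult_nonneg_nonneg) auto
  moreover have "0 \<le> (\<Sum>i\<in>{i \<in> Y. 0 < gap i}. of_bool ({i} \<subseteq> F) * low_loss Y (gap i) F)"
    using low_loss_nonneg by (intro sum_nonneg) auto
  ultimately show ?thesis unfolding slack_loss_def using slack_burden_nonneg[of Y F] by linarith
qed


lemma pot_drop_plus_slack_loss_nonneg:
  assumes Y: "Y \<subseteq> {1..n}" and F: "F \<subseteq> {1..n}"
  shows "0 \<le> pot_drop Y F + slack_loss Y F"
proof (cases "accepted Y F")
  case False
  then show ?thesis using slack_loss_nonneg by (simp add: pot_drop_def)
next
  case True
  have finY: "finite Y" and finF: "finite F" using Y F finite_bits by auto
  define A where "A = F \<inter> Y"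
  define U where "U = F - Y"
  define \<delta> where "\<delta> = surplus U - surplus A"
  have AU: "A \<subseteq> {1..n}" "U \<subseteq> {1..n}" "finite A" "finite U" using F finF by (auto simp: A_def U_def)
  have drop: "pot_drop Y F = sum val A - sum val U - \<delta> * top_phi"
    using True pot_flip[OF finY finF] by (simp add: pot_drop_def A_def U_def \<delta>_def)
  have acc: "sum gap U + \<delta> * w B \<le> sum gap A"
    using True cost_flip_le_iff[OF finY finF] by (simp add: accepted_def A_def U_def \<delta>_def)
  have zero: ?thesis if "\<forall>a\<in>A. gap a = 0" "0 \<le> \<delta>"
    using zero_gap_step[OF AU(1) _ AU(2) that(2) acc] that(1) drop slack_loss_nonneg[of Y F] by simp
  show ?thesis
  proof (cases "A = {}")
    case False
    then obtain i where i: "i \<in> A" "\<And>a. a \<in> A \<Longrightarrow> gap a \<le> gap i"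
      using obtain_max_gap AU by blast
    have iY: "i \<in> Y" "i \<in> F" "i \<in> {1..n}" using i Y by (auto simp: A_def)
    consider "\<delta> < 0" "gap i \<le> w B" | "0 < gap i" "\<delta> < 0 \<Longrightarrow> w B \<le> gap i" | "gap i = 0" "0 \<le> \<delta>"
      using gap_nonneg[of i] wB_pos by linarith
    then show ?thesis
    proof cases
      case 1
      have "sum val U + \<delta> * top_phi - sum val A
          \<le> (\<Sum>l\<in>{l \<in> U. gap l < \<kappa> (w B)}. val l) + max \<delta> 0 * overflow (w B)"
        using 1 i(2) by (intro accepted_loss_bound[OF wB_level AU(1) _ AU(2) _ acc]) (auto intro: order_trans)
      then have "sum val U + \<delta> * top_phi - sum val A \<le> (\<Sum>l\<in>{l \<in> U. gap l < \<kappa> (w B)}. val l)"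
        using 1 by simp
      then show ?thesis using slack_loss_ge_low[OF Y F iY(1,2)] drop by (simp add: U_def)
    next
      case 2
      have lev: "gap i \<in> levels" using gap_level iY 2 by simp
      have loss: "sum val U + \<delta> * top_phi - sum val A
          \<le> (\<Sum>l\<in>{l \<in> U. gap l < \<kappa> (gap i)}. val l) + max \<delta> 0 * overflow (gap i)"
        by (rule accepted_loss_bound[OF lev AU(1) i(2) AU(2) 2(2) acc])
      have "\<delta> \<le> real (card U) + real (card A)"
        using abs_surplus_le[of U] abs_surplus_le[of A] by (simp add: \<delta>_def)
      also have "\<dots> = real (card F)"
        using card_Un_disjoint[of U A] AU by (simp add: A_def U_def Un_Diff_Int disjoint_iff)
      finally have "max \<delta> 0 * overflow (gap i) \<le> real (card F) * overflow (gap i)"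
        using overflow_nonneg by (intro mult_right_mono) auto
      then have "sum val U + \<delta> * top_phi - sum val A \<le> low_loss Y (gap i) F"
        using loss low_flipped_sum[OF F] by (simp add: low_loss_def U_def)
      then show ?thesis
        using slack_loss_ge_low_loss[OF Y iY(1) 2(1) iY(2)] drop by simp
    next
      case 3
      have "gap a = 0" if "a \<in> A" for a using i(2)[OF that] 3 gap_nonneg[of a] by linarith
      then show ?thesis using zero 3 by simp
    qed
  next
    case A: True
    show ?thesis
    proof (cases "0 \<le> \<delta>")
      case True
      then show ?thesis using zero A by simp
    next
      case False
      let ?S = "{l \<in> {1..n} - Y. l \<le> B}" and ?P = "{l \<in> {1..n} - Y. \<not> l \<le> B}"
      let ?US = "{l \<in> U. l \<le> B}" and ?UP = "{l \<in> U. \<not> l \<le> B}"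
      have FS: "F \<inter> ?S = ?US" and FP: "F \<inter> ?P = ?UP" using F by (auto simp: U_def)
      have FSP: "F \<inter> (?S \<union> ?P) = U" using FS FP by blast
      have acc': "sum gap U + \<delta> * w B \<le> 0" using acc A by simp
      have deq: "\<delta> = real (card ?UP) - real (card ?US)"
        using surplus_eq[OF AU(4)] A by (simp add: \<delta>_def surplus_def[of "{}"])
      have loss: "sum val U + \<delta> * top_phi - sum val A \<le> (\<Sum>l\<in>{l \<in> U. gap l < \<kappa> (w B)}. val l)"
      proof -
        have "sum val U + \<delta> * top_phi - sum val A
          \<le> (\<Sum>l\<in>{l \<in> U. gap l < \<kappa> (w B)}. val l) + max \<delta> 0 * overflow (w B)"
          using A by (intro accepted_loss_bound[OF wB_level AU(1) _ AU(2) _ acc]) auto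
        then show ?thesis using False by simp
      qed
      have less: "card ?UP < card ?US" using deq False by simp
      show ?thesis
      proof (cases "card ?US = 1")
        case True
        then have "card ?UP = 0" using less by simp
        then have "?UP = {}" using AU by simp
        obtain l where l: "?US = {l}" using True card_1_singletonE by blast
        then have U: "U = {l}" using \<open>?UP = {}\<close> by blast
        have "l \<le> B" "l \<in> {1..n}" using l U AU by auto
        then have "val l \<le> top_phi"
          using val_mono[of l "w B"] wB_level gap_less_wB[of l] by simp
        moreover have "\<delta> = - 1" using deq True \<open>card ?UP = 0\<close> by simp
        ultimately show ?thesis using drop A U slack_loss_nonneg[of Y F] by simp
      next
        case False
        then have two: "2 \<le> card ?US" using less by simp
        have S: "?S \<subseteq> {1..n}" "\<And>t. t \<in> ?S \<Longrightarrow> gap t \<le> w B" and P: "?P \<subseteq> {1..n}" "?S \<inter> ?P = {}"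
          using gap_less_wB by (auto intro: less_imp_le)
        have "(\<Sum>l\<in>{l \<in> F \<inter> (?S \<union> ?P). gap l < \<kappa> (w B)}. val l) + 0 * overflow (w B)
            \<le> burden (w B) ?S ?P F"
        proof (rule burden_ge[OF wB_level S P])
          show "2 \<le> card (F \<inter> ?S)" using two FS by simp
          show "(0 :: real) \<le> 0" by simp
          show "0 + 1 \<le> real (card (F \<inter> ?S))" using two FS by simp
          assume high: "{t \<in> F \<inter> ?S. gap t < \<kappa> (w B)} = {}"
          show "(\<Sum>u\<in>{u \<in> F \<inter> ?P. gap u < \<kappa> (w B)}. val u) + 0 * overflow (w B) = 0 \<or>
              max 1 0 * \<phi> (\<kappa> (w B)) \<le> (\<Sum>t\<in>F \<inter> ?S. \<phi> (w B) - val t)"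
          proof (cases "?UP = {}")
            case True
            then have "{u \<in> F \<inter> ?P. gap u < \<kappa> (w B)} = {}" using FP by blast
            then show ?thesis by (simp only: sum.empty) simp
          next
            case False
            then have "1 \<le> real (card ?UP)" using AU by (simp add: Suc_le_eq card_gt_0_iff)
            then have "1 * w B \<le> real (card ?UP) * w B" using wB_pos by (intro mult_right_mono) auto
            moreover have "sum gap ?US \<le> sum gap U" using AU by (intro sum_mono2) auto
            then have "real (card ?UP) * w B \<le> real (card ?US) * w B - sum gap ?US"
              using acc' unfolding deq left_diff_distrib by linarith
            moreover have "real (card ?US) * w B - sum gap ?US = (\<Sum>t\<in>?US. w B - gap t)"
              by (simp add: sum_subtractf)
            ultimately have "w B \<le> (\<Sum>t\<in>?US. w B - gap t)" by linarith
            then have "slope (w B) * \<kappa> (w B) \<le> slope (w B) * (\<Sum>t\<in>?US. w B - gap t)"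
              using slope_pos[OF wB_level] kappa_le[OF wB_level] by (intro mult_left_mono) auto
            also have "\<dots> = (\<Sum>t\<in>?US. slope (w B) * w B - slope (w B) * gap t)"
              by (simp only: sum_distrib_left right_diff_distrib)
            also have "\<dots> \<le> (\<Sum>t\<in>?US. \<phi> (w B) - val t)"
            proof (rule sum_mono)
              fix t assume t: "t \<in> ?US"
              then have "\<kappa> (w B) \<le> gap t" using high FS by force
              then have "val t \<le> slope (w B) * gap t"
                using val_le_slope[of t "w B"] wB_level t AU by auto
              moreover have "slope (w B) * w B \<le> \<phi> (w B)" using phi_ge_slope[OF wB_level wB_level] by simp
              ultimately show "slope (w B) * w B - slope (w B) * gap t \<le> \<phi> (w B) - val t" by linarith
            qed
            finally show ?thesis using slope_kappa[OF wB_level] FS by simp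
          qed
        qed
        then have "(\<Sum>l\<in>{l \<in> U. gap l < \<kappa> (w B)}. val l) \<le> burden (w B) ?S ?P F"
          unfolding FSP by simp
        then show ?thesis using loss drop slack_loss_ge_burden[of Y F] by linarith
      qed
    qed
  qed
qed

lemma mean_slack_loss:
  assumes Y: "Y \<subseteq> {1..n}"
  shows "mutation_mean n (slack_loss Y) \<le> 1 / real n * (sum val Y / 16 + real (card Y) * top_phi / 48
      + 5 / 48 * (\<Sum>l\<in>{l \<in> {1..n} - Y. l \<le> B}. top_phi - val l))"
proof -
  let ?p = "1 / real n" and ?Y = "{i \<in> Y. 0 < gap i}"
  let ?S = "{l \<in> {1..n} - Y. l \<le> B}" and ?P = "{l \<in> {1..n} - Y. \<not> l \<le> B}"
  let ?o = "\<lambda>F. (\<Sum>u\<in>{u \<in> {1..n} - Y. gap u < \<kappa> (w B)}. of_bool (u \<in> F) * val u) + overflow (w B)"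
  have fin: "finite Y" using Y finite_bits by simp
  have "mutation_mean n (slack_loss Y)
     = (\<Sum>i\<in>?Y. mutation_mean n (\<lambda>F. of_bool ({i} \<subseteq> F) * low_loss Y (gap i) F))
     + (\<Sum>i\<in>Y. mutation_mean n (\<lambda>F. of_bool ({i} \<subseteq> F) * ?o F))
     + mutation_mean n (burden (w B) ?S ?P)"
    unfolding slack_loss_def by (simp only: mutation_mean_add mutation_mean_sum)
  also have "\<dots> \<le> (\<Sum>i\<in>?Y. ?p / 16 * val i) + (\<Sum>i\<in>Y. ?p * (top_phi / 48))
     + ?p * (5 / 48 * (\<Sum>l\<in>?S. top_phi - val l))"
  proof (intro add_mono sum_mono)
    fix i assume i: "i \<in> ?Y"
    have lev: "gap i \<in> levels" using i Y gap_level by auto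
    have "mutation_mean n (\<lambda>F. of_bool ({i} \<subseteq> F) * low_loss Y (gap i) F)
        \<le> (real (card {i}) + 2) / 48 * ?p ^ card {i} * \<phi> (\<kappa> (gap i))"
      using i by (intro mean_low_loss[OF lev Y]) auto
    also have "\<dots> = ?p / 16 * \<phi> (\<kappa> (gap i))" by simp
    also have "\<dots> \<le> ?p / 16 * val i"
      using phi_kappa_le[OF lev] unfolding val_def by (intro mult_left_mono) auto
    finally show "mutation_mean n (\<lambda>F. of_bool ({i} \<subseteq> F) * low_loss Y (gap i) F) \<le> ?p / 16 * val i" .
  next
    fix i assume i: "i \<in> Y"
    have "mutation_mean n (\<lambda>F. of_bool ({i} \<subseteq> F) * ?o F) \<le> ?p ^ card {i} * \<phi> (\<kappa> (w B)) / 48"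
      using i Y by (intro mean_low_weight[OF wB_level]) auto
    also have "\<dots> = ?p * (\<phi> (\<kappa> (w B)) / 48)" by simp
    also have "\<dots> \<le> ?p * (top_phi / 48)"
      using phi_kappa_le[OF wB_level] by (intro mult_left_mono) auto
    finally show "mutation_mean n (\<lambda>F. of_bool ({i} \<subseteq> F) * ?o F) \<le> ?p * (top_phi / 48)" .
  next
    have "mutation_mean n (\<lambda>F. of_bool ({} \<subseteq> F) * burden (w B) ?S ?P F)
       \<le> ?p ^ card ({} :: nat set) / real n * (5 / 48 * (\<Sum>l\<in>?S. \<phi> (w B) - val l))"
      using gap_less_wB by (intro mean_burden[OF wB_level]) (auto intro: less_imp_le)
    then show "mutation_mean n (burden (w B) ?S ?P) \<le> ?p * (5 / 48 * (\<Sum>l\<in>?S. top_phi - val l))"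
      by simp
  qed
  also have "(\<Sum>i\<in>?Y. ?p / 16 * val i) \<le> (\<Sum>i\<in>Y. ?p / 16 * val i)"
    using fin val_nonneg Y by (intro sum_mono2) auto
  also have "(\<Sum>i\<in>Y. ?p / 16 * val i) + (\<Sum>i\<in>Y. ?p * (top_phi / 48))
      = ?p * (sum val Y / 16 + real (card Y) * top_phi / 48)"
    by (simp add: distrib_left sum_divide_distrib mult.commute)
  finally show ?thesis by (simp add: distrib_left)
qed

lemma slack_drift:
  assumes Y: "Y \<subseteq> {1..n}" and slack: "1 \<le> surplus Y"
  shows "pot Y / (6 * real n) \<le> mutation_mean n (pot_drop Y)"
proof -
  let ?p = "1 / real n"
  let ?YH = "{i \<in> Y. \<not> i \<le> B}" and ?YL = "{i \<in> Y. i \<le> B}"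
  let ?S = "{l \<in> {1..n} - Y. l \<le> B}"
  let ?h = "\<lambda>F. pot_drop Y F + slack_loss Y F"
  have fin: "finite Y" using Y finite_bits by simp
  define k1 where "k1 = real (card ?YH)"
  define k0 where "k0 = real (card ?YL)"
  have surp: "surplus Y = k1 - k0" using surplus_eq[OF fin] by (simp add: k1_def k0_def)
  have YY: "Y = ?YH \<union> ?YL" by auto
  have cardY: "real (card Y) = k1 + k0"
  proof -
    have "card (?YH \<union> ?YL) = card ?YH + card ?YL" using fin by (intro card_Un_disjoint) auto
    then show ?thesis using YY by (simp add: k1_def k0_def)
  qed
  have sumY: "sum val Y = sum val ?YH + sum val ?YL"
  proof -
    have "sum val (?YH \<union> ?YL) = sum val ?YH + sum val ?YL" using fin by (intro sum.union_disjoint) auto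
    then show ?thesis using YY by simp
  qed
  have low_val: "val l \<le> top_phi" if "l \<in> {1..n}" "l \<le> B" for l
    using that val_mono[of l "w B"] wB_level gap_less_wB[of l] by simp
  have sum0: "sum val ?YL \<le> k0 * top_phi"
    unfolding k0_def using low_val Y by (intro sum_bounded_above) auto
  define sw where "sw = (\<Sum>l\<in>?S. top_phi - val l)"
  have sw0: "0 \<le> sw" unfolding sw_def using low_val by (intro sum_nonneg) auto
  define X where "X = sum val ?YH + k1 * top_phi"
  have potX: "pot Y \<le> X"
    using sum0 by (simp add: pot_def sumY X_def surp left_diff_distrib)
  have s1: "0 \<le> sum val ?YH" using val_nonneg Y by (intro sum_nonneg) auto
  have h1: "val i + top_phi \<le> ?h {i}" if i: "i \<in> ?YH" for i
  proof -
    have eq: "{i} \<inter> Y = {i}" "{i} - Y = {}" using i by auto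
    have s: "surplus {i} = 1" "surplus {} = 0" using i by (auto simp: surplus_def side_def)
    have "accepted Y {i}"
      using surplus_flip[OF fin, of "{i}"] cost_flip_le_iff[OF fin, of "{i}"] slack wB_pos gap_nonneg[of i]
      unfolding accepted_def eq s by simp
    then have "pot_drop Y {i} = val i + top_phi"
      using pot_flip[OF fin, of "{i}"] unfolding pot_drop_def eq s by simp
    then show ?thesis using slack_loss_nonneg[of Y "{i}"] by simp
  qed
  have h2: "top_phi - val l \<le> ?h {l}" if l: "l \<in> ?S" for l
  proof -
    have eq: "{l} \<inter> Y = {}" "{l} - Y = {l}" using l by auto
    have s: "surplus {l} = - 1" "surplus {} = 0" using l by (auto simp: surplus_def side_def)
    have "accepted Y {l}"
      using surplus_flip[OF fin, of "{l}"] cost_flip_le_iff[OF fin, of "{l}"] slack gap_less_wB[of l] l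
      unfolding accepted_def eq s by simp
    then have "pot_drop Y {l} = top_phi - val l"
      using pot_flip[OF fin, of "{l}"] unfolding pot_drop_def eq s by simp
    then show ?thesis using slack_loss_nonneg[of Y "{l}"] by simp
  qed
  have "?p * (X + sw) = (\<Sum>i\<in>?YH. ?p * (val i + top_phi)) + (\<Sum>l\<in>?S. ?p * (top_phi - val l))"
    unfolding X_def sw_def by (simp add: sum.distrib k1_def distrib_left sum_divide_distrib)
  also have "\<dots> \<le> (\<Sum>i\<in>?YH. ?p ^ card {i} * ?h {i}) + (\<Sum>l\<in>?S. ?p ^ card {l} * ?h {l})"
  proof (intro add_mono sum_mono)
    fix i assume "i \<in> ?YH"
    then have "?p * (val i + top_phi) \<le> ?p * ?h {i}" using h1 by (intro mult_left_mono) auto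
    then show "?p * (val i + top_phi) \<le> ?p ^ card {i} * ?h {i}" by simp
  next
    fix l assume "l \<in> ?S"
    then have "?p * (top_phi - val l) \<le> ?p * ?h {l}" using h2 by (intro mult_left_mono) auto
    then show "?p * (top_phi - val l) \<le> ?p ^ card {l} * ?h {l}" by simp
  qed
  also have "\<dots> = (\<Sum>i\<in>?YH \<union> ?S. ?p ^ card {i} * ?h {i})"
    using fin by (intro sum.union_disjoint[symmetric]) auto
  also have "\<dots> = (\<Sum>F\<in>(\<lambda>i. {i}) ` (?YH \<union> ?S). ?p ^ card F * ?h F)"
    by (subst sum.reindex) (auto simp: inj_on_def)
  finally have "?p * (X + sw) / 3 \<le> (\<Sum>F\<in>(\<lambda>i. {i}) ` (?YH \<union> ?S). ?p ^ card F * ?h F) / 3"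
    by (intro divide_right_mono) auto
  also have "\<dots> \<le> mutation_mean n ?h"
    using Y pot_drop_plus_slack_loss_nonneg[OF Y] by (intro mutation_mean_ge_sum[OF n_ge1]) auto
  also have "\<dots> = mutation_mean n (pot_drop Y) + mutation_mean n (slack_loss Y)"
    by (rule mutation_mean_add)
  also have "mutation_mean n (slack_loss Y) \<le> ?p * (sum val Y / 16 + real (card Y) * top_phi / 48 + 5 / 48 * sw)"
    using mean_slack_loss[OF Y] by (simp add: sw_def)
  also have "\<dots> \<le> ?p * (X / 6 + sw / 3)"
  proof (rule mult_left_mono)
    have "k0 * top_phi \<le> k1 * top_phi" using surp slack top_phi_ge1 by (intro mult_right_mono) auto
    moreover have arith: "(a + b) / 16 + (K1 + K0) / 48 + 5 / 48 * s \<le> (a + K1) / 6 + s / 3"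
      if "K0 \<le> K1" "0 \<le> K1" "b \<le> K0" "0 \<le> a" "0 \<le> s" for a b K0 K1 s :: real
      using that by (simp add: field_simps)
    moreover have "0 \<le> k1 * top_phi" using top_phi_ge1 by (simp add: k1_def)
    ultimately show "sum val Y / 16 + real (card Y) * top_phi / 48 + 5 / 48 * sw \<le> X / 6 + sw / 3"
      using sum0 s1 sw0 arith unfolding X_def sumY cardY distrib_right by blast
  qed auto
  finally have "?p * (X / 6) \<le> mutation_mean n (pot_drop Y)"
    by (simp add: algebra_simps add_divide_distrib)
  moreover have "?p * (pot Y / 6) \<le> ?p * (X / 6)" using potX by (intro mult_left_mono) auto
  ultimately show ?thesis by simp
qed

end

section \<open>Drift theorems for the (1+1) EA\<close>

lemma pmf_flip_mask:
  assumes F: "F \<subseteq> {1..n}"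
  shows "pmf (flip_mask n) (\<lambda>i. i \<in> F) = (1 / real n) ^ card F * (1 - 1 / real n) ^ (n - card F)"
proof -
  let ?p = "1 / real n"
  have p: "0 \<le> ?p" "?p \<le> 1" by (cases n; simp)+
  have "pmf (flip_mask n) (\<lambda>i. i \<in> F) = (\<Prod>i\<in>{1..n}. pmf (bernoulli_pmf ?p) (i \<in> F))"
    unfolding flip_mask_def using F by (subst pmf_Pi') auto
  also have "\<dots> = (\<Prod>i\<in>{1..n}. if i \<in> F then ?p else 1 - ?p)"
    using p by (intro prod.cong) auto
  also have "\<dots> = (\<Prod>i\<in>{1..n} \<inter> F. ?p) * (\<Prod>i\<in>{1..n} - F. 1 - ?p)"
    by (subst prod.If_cases) (auto simp: Diff_eq)
  also have "{1..n} \<inter> F = F" using F by auto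
  finally show ?thesis using F by (simp add: card_Diff_subset finite_subset)
qed

lemma nn_integral_flip_mask:
  assumes nonneg: "\<And>F. F \<subseteq> {1..n} \<Longrightarrow> 0 \<le> h (\<lambda>i. i \<in> F)"
  shows "(\<integral>\<^sup>+m. ennreal (h m) \<partial>flip_mask n) = ennreal (mutation_mean n (\<lambda>F. h (\<lambda>i. i \<in> F)))"
proof -
  let ?A = "(\<lambda>F i. i \<in> F) ` Pow {1..n}"
  have inj: "inj_on (\<lambda>F i. i \<in> F) (Pow {1..n})" by (auto simp: inj_on_def fun_eq_iff)
  have supp: "set_pmf (flip_mask n) \<subseteq> ?A"
  proof
    fix m assume "m \<in> set_pmf (flip_mask n)"
    then have "\<not> m i" if "i \<notin> {1..n}" for i
      using set_Pi_pmf_subset[of "{1..n}" False "\<lambda>_. bernoulli_pmf (1 / real n)"] that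
      unfolding flip_mask_def by auto
    then have "{i. m i} \<subseteq> {1..n}" by blast
    moreover have "m = (\<lambda>i. i \<in> {i. m i})" by simp
    ultimately show "m \<in> ?A" by blast
  qed
  have "(\<integral>\<^sup>+m. ennreal (h m) \<partial>flip_mask n) = (\<Sum>m\<in>?A. ennreal (h m) * pmf (flip_mask n) m)"
    using supp by (intro nn_integral_measure_pmf_support) auto
  also have "\<dots> = (\<Sum>F\<in>Pow {1..n}. ennreal (h (\<lambda>i. i \<in> F)) * pmf (flip_mask n) (\<lambda>i. i \<in> F))"
    by (subst sum.reindex[OF inj]) simp
  also have "\<dots> = (\<Sum>F\<in>Pow {1..n}.
      ennreal ((1 / real n) ^ card F * (1 - 1 / real n) ^ (n - card F) * h (\<lambda>i. i \<in> F)))"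
  proof (rule sum.cong[OF refl])
    fix F assume "F \<in> Pow {1..n}"
    then have F: "F \<subseteq> {1..n}" by simp
    show "ennreal (h (\<lambda>i. i \<in> F)) * pmf (flip_mask n) (\<lambda>i. i \<in> F) =
      ennreal ((1 / real n) ^ card F * (1 - 1 / real n) ^ (n - card F) * h (\<lambda>i. i \<in> F))"
      unfolding pmf_flip_mask[OF F] using nonneg[OF F] mutation_weight_nonneg
      by (simp only: ennreal_mult[symmetric] mult.commute)
  qed
  also have "\<dots> = ennreal (mutation_mean n (\<lambda>F. h (\<lambda>i. i \<in> F)))"
    unfolding mutation_mean_def
    by (intro sum_ennreal mult_nonneg_nonneg[OF mutation_weight_nonneg] nonneg) auto
  finally show ?thesis .
qed

definition mutate :: "(nat \<Rightarrow> bool) \<Rightarrow> nat set \<Rightarrow> nat \<Rightarrow> bool" where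
  "mutate x F = (\<lambda>i. x i \<noteq> (i \<in> F))"

definition ea_next :: "nat \<Rightarrow> (nat \<Rightarrow> real) \<Rightarrow> nat \<Rightarrow> (nat \<Rightarrow> bool) \<Rightarrow> nat set \<Rightarrow> nat \<Rightarrow> bool" where
  "ea_next n w B x F =
     (if f_pen n w B (mutate x F) \<le> f_pen n w B x then mutate x F else x)"

lemma ea_next_search_space:
  "x \<in> search_space n \<Longrightarrow> F \<subseteq> {1..n} \<Longrightarrow> ea_next n w B x F \<in> search_space n"
  by (auto simp: ea_next_def mutate_def search_space_def)

lemma ea_state_0: "ea_state n w B 0 = ea_start n w B"
  by (simp add: ea_state_def)

lemma ea_state_Suc: "ea_state n w B (Suc t) = bind_pmf (ea_state n w B t) (ea_step n w B)"
  by (simp add: ea_state_def)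

lemma ea_state_support:
  assumes "s \<in> set_pmf (ea_state n w B t)"
  shows "fst s \<in> search_space n \<and> (\<not> snd s \<longrightarrow> \<not> optimal n w B (fst s))"
  using assms
proof (induction t arbitrary: s)
  case 0
  have "set_pmf (init_pmf n) \<subseteq> search_space n"
    using set_Pi_pmf_subset[of "{1..n}" False "\<lambda>_. bernoulli_pmf (1 / 2)"]
    unfolding init_pmf_def search_space_def by auto
  then show ?case using 0 by (auto simp: ea_state_0 ea_start_def)
next
  case (Suc t)
  then obtain r where r: "r \<in> set_pmf (ea_state n w B t)" "s \<in> set_pmf (ea_step n w B r)"
    by (auto simp: ea_state_Suc)
  note IH = Suc.IH[OF r(1)]
  obtain m where m: "m \<in> set_pmf (flip_mask n)" and
    s: "s = (if f_pen n w B (\<lambda>i. fst r i \<noteq> m i) \<le> f_pen n w B (fst r) then (\<lambda>i. fst r i \<noteq> m i) else fst r,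
             snd r \<or> optimal n w B (\<lambda>i. fst r i \<noteq> m i))"
    using r(2) by (auto simp: ea_step_def Let_def)
  have "m \<in> search_space n"
    using m set_Pi_pmf_subset[of "{1..n}" False "\<lambda>_. bernoulli_pmf (1 / real n)"]
    unfolding flip_mask_def search_space_def by auto
  then show ?case using IH by (auto simp: s search_space_def)
qed

definition unsolved_value :: "((nat \<Rightarrow> bool) \<Rightarrow> real) \<Rightarrow> (nat \<Rightarrow> bool) \<times> bool \<Rightarrow> ennreal" where
  "unsolved_value V s = (if snd s then 0 else ennreal (V (fst s)))"

lemma unsolved_value_step:
  assumes x: "fst s \<in> search_space n" and nonneg: "\<And>x. x \<in> search_space n \<Longrightarrow> 0 \<le> V x"
  shows "(\<integral>\<^sup>+r. unsolved_value V r \<partial>ea_step n w B s)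
    \<le> (if snd s then 0 else ennreal (mutation_mean n (\<lambda>F. V (ea_next n w B (fst s) F))))"
proof (cases "snd s")
  case True
  then show ?thesis by (simp add: ea_step_def unsolved_value_def Let_def)
next
  case False
  let ?h = "\<lambda>m. V (ea_next n w B (fst s) {i. m i})"
  have "(\<integral>\<^sup>+r. unsolved_value V r \<partial>ea_step n w B s) \<le> (\<integral>\<^sup>+m. ennreal (?h m) \<partial>flip_mask n)"
    unfolding ea_step_def nn_integral_map_pmf
    by (intro nn_integral_mono) (simp add: unsolved_value_def ea_next_def mutate_def Let_def)
  also have "\<dots> = ennreal (mutation_mean n (\<lambda>F. V (ea_next n w B (fst s) F)))"
    using nonneg ea_next_search_space[OF x] by (subst nn_integral_flip_mask) auto
  finally show ?thesis using False by simp
qed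

lemma tail_prob_eq_nn_integral:
  "ennreal (tail_prob n w B t) = (\<integral>\<^sup>+s. (if snd s then 0 else 1) \<partial>ea_state n w B t)"
proof -
  have "(\<integral>\<^sup>+s. (if snd s then 0 else 1) \<partial>ea_state n w B t)
      = (\<integral>\<^sup>+s. indicator {s. \<not> snd s} s \<partial>ea_state n w B t)"
    by (intro nn_integral_cong) auto
  also have "\<dots> = emeasure (ea_state n w B t) {s. \<not> snd s}" by simp
  finally show ?thesis by (simp add: tail_prob_def measure_pmf.emeasure_eq_measure)
qed

lemma unsolved_value_start_le:
  assumes "\<And>x. x \<in> search_space n \<Longrightarrow> V x \<le> M"
  shows "(\<integral>\<^sup>+s. unsolved_value V s \<partial>ea_state n w B 0) \<le> ennreal M"
proof -
  have "(\<integral>\<^sup>+s. unsolved_value V s \<partial>ea_state n w B 0) \<le> (\<integral>\<^sup>+s. ennreal M \<partial>ea_state n w B 0)"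
    using assms ea_state_support[of _ n w B 0]
    by (intro nn_integral_mono_AE) (auto simp: AE_measure_pmf_iff unsolved_value_def intro!: ennreal_leI)
  then show ?thesis by simp
qed

lemma expected_time_le_additive_drift:
  assumes nonneg: "\<And>x. x \<in> search_space n \<Longrightarrow> 0 \<le> V x"
    and bound: "\<And>x. x \<in> search_space n \<Longrightarrow> V x \<le> M"
    and drift: "\<And>x. x \<in> search_space n \<Longrightarrow> \<not> optimal n w B x \<Longrightarrow>
       mutation_mean n (\<lambda>F. V (ea_next n w B x F)) \<le> V x - 1"
  shows "expected_time n w B \<le> ennreal M"
proof -
  let ?I = "\<lambda>t. \<integral>\<^sup>+s. unsolved_value V s \<partial>ea_state n w B t"
  have step: "ennreal (tail_prob n w B t) + ?I (Suc t) \<le> ?I t" for t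
  proof -
    have "ennreal (tail_prob n w B t) + ?I (Suc t) =
      (\<integral>\<^sup>+s. (if snd s then 0 else 1) + (\<integral>\<^sup>+r. unsolved_value V r \<partial>ea_step n w B s) \<partial>ea_state n w B t)"
      unfolding tail_prob_eq_nn_integral ea_state_Suc nn_integral_bind_pmf
      by (intro nn_integral_add[symmetric]) auto
    also have "\<dots> \<le> ?I t"
    proof (rule nn_integral_mono_AE, unfold AE_measure_pmf_iff, rule ballI)
      fix s assume s: "s \<in> set_pmf (ea_state n w B t)"
      note supp = ea_state_support[OF s]
      have le: "(\<integral>\<^sup>+r. unsolved_value V r \<partial>ea_step n w B s)
        \<le> (if snd s then 0 else ennreal (mutation_mean n (\<lambda>F. V (ea_next n w B (fst s) F))))"
        using supp nonneg by (intro unsolved_value_step) auto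
      show "(if snd s then 0 else 1) + (\<integral>\<^sup>+r. unsolved_value V r \<partial>ea_step n w B s) \<le> unsolved_value V s"
      proof (cases "snd s")
        case True
        then show ?thesis using le by simp
      next
        case False
        have mean: "mutation_mean n (\<lambda>F. V (ea_next n w B (fst s) F)) \<le> V (fst s) - 1"
          using drift supp False by simp
        have mean0: "0 \<le> mutation_mean n (\<lambda>F. V (ea_next n w B (fst s) F))"
          using mutation_mean_mono[of n "\<lambda>_. 0" "\<lambda>F. V (ea_next n w B (fst s) F)"]
            nonneg ea_next_search_space supp by (simp add: mutation_mean_const)
        have "1 + (\<integral>\<^sup>+r. unsolved_value V r \<partial>ea_step n w B s)
           \<le> ennreal 1 + ennreal (mutation_mean n (\<lambda>F. V (ea_next n w B (fst s) F)))"
          using le False by (intro add_mono) auto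
        also have "\<dots> = ennreal (1 + mutation_mean n (\<lambda>F. V (ea_next n w B (fst s) F)))"
          using mean0 by (intro ennreal_plus[symmetric]) auto
        also have "\<dots> \<le> ennreal (V (fst s))" using mean by (intro ennreal_leI) simp
        finally show ?thesis using False by (simp add: unsolved_value_def)
      qed
    qed
    finally show ?thesis .
  qed
  have partial: "(\<Sum>t<m. ennreal (tail_prob n w B t)) + ?I m \<le> ?I 0" for m
  proof (induction m)
    case (Suc m)
    have "(\<Sum>t<Suc m. ennreal (tail_prob n w B t)) + ?I (Suc m)
       = (\<Sum>t<m. ennreal (tail_prob n w B t)) + (ennreal (tail_prob n w B m) + ?I (Suc m))"
      by (simp add: add.assoc)
    also have "\<dots> \<le> (\<Sum>t<m. ennreal (tail_prob n w B t)) + ?I m"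
      using step by (intro add_left_mono)
    finally show ?case using Suc.IH by (rule order_trans)
  qed simp
  have "(\<Sum>t<m. ennreal (tail_prob n w B t)) \<le> ennreal M" for m
    using partial[of m] unsolved_value_start_le[OF bound, where w = w and B = B]
    by (meson add_increasing2 order_trans zero_le le_add1 order_refl add_mono)
  then show ?thesis
    unfolding expected_time_def suminf_eq_SUP by (intro SUP_least)
qed

lemma tail_prob_le_multiplicative_drift:
  assumes r: "0 \<le> r" "r \<le> 1"
    and nonneg: "\<And>x. x \<in> search_space n \<Longrightarrow> 0 \<le> V x"
    and ge1: "\<And>x. x \<in> search_space n \<Longrightarrow> \<not> optimal n w B x \<Longrightarrow> 1 \<le> V x"
    and bound: "\<And>x. x \<in> search_space n \<Longrightarrow> V x \<le> M" and M: "0 \<le> M"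
    and drift: "\<And>x. x \<in> search_space n \<Longrightarrow> \<not> optimal n w B x \<Longrightarrow>
       mutation_mean n (\<lambda>F. V (ea_next n w B x F)) \<le> (1 - r) * V x"
  shows "tail_prob n w B t \<le> (1 - r) ^ t * M"
proof -
  let ?I = "\<lambda>t. \<integral>\<^sup>+s. unsolved_value V s \<partial>ea_state n w B t"
  have "?I t \<le> ennreal ((1 - r) ^ t * M)"
  proof (induction t)
    case 0
    then show ?case using unsolved_value_start_le[OF bound] by simp
  next
    case (Suc t)
    have "?I (Suc t) = (\<integral>\<^sup>+s. (\<integral>\<^sup>+r. unsolved_value V r \<partial>ea_step n w B s) \<partial>ea_state n w B t)"
      unfolding ea_state_Suc nn_integral_bind_pmf ..
    also have "\<dots> \<le> (\<integral>\<^sup>+s. ennreal (1 - r) * unsolved_value V s \<partial>ea_state n w B t)"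
    proof (rule nn_integral_mono_AE, unfold AE_measure_pmf_iff, rule ballI)
      fix s assume s: "s \<in> set_pmf (ea_state n w B t)"
      note supp = ea_state_support[OF s]
      have "(\<integral>\<^sup>+r. unsolved_value V r \<partial>ea_step n w B s)
        \<le> (if snd s then 0 else ennreal (mutation_mean n (\<lambda>F. V (ea_next n w B (fst s) F))))"
        using supp nonneg by (intro unsolved_value_step) auto
      also have "\<dots> \<le> (if snd s then 0 else ennreal ((1 - r) * V (fst s)))"
        using drift supp by (auto intro!: ennreal_leI)
      also have "\<dots> = ennreal (1 - r) * unsolved_value V s"
        using r nonneg supp by (auto simp: unsolved_value_def ennreal_mult)
      finally show "(\<integral>\<^sup>+r. unsolved_value V r \<partial>ea_step n w B s) \<le> ennreal (1 - r) * unsolved_value V s" .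
    qed
    also have "\<dots> = ennreal (1 - r) * ?I t" by (rule nn_integral_cmult) auto
    also have "\<dots> \<le> ennreal (1 - r) * ennreal ((1 - r) ^ t * M)"
      using Suc.IH by (intro mult_left_mono) auto
    also have "\<dots> = ennreal ((1 - r) ^ Suc t * M)"
      using r M by (subst ennreal_mult[symmetric]) (auto simp: mult.assoc)
    finally show ?case .
  qed
  moreover have "ennreal (tail_prob n w B t) \<le> ?I t"
    unfolding tail_prob_eq_nn_integral
  proof (rule nn_integral_mono_AE, unfold AE_measure_pmf_iff, rule ballI)
    fix s assume s: "s \<in> set_pmf (ea_state n w B t)"
    have "ennreal 1 \<le> ennreal (V (fst s))" if "\<not> snd s"
      using ea_state_support[OF s] that ge1 by (intro ennreal_leI) auto
    then show "(if snd s then 0 else 1) \<le> unsolved_value V s"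
      by (auto simp: unsolved_value_def)
  qed
  ultimately have "ennreal (tail_prob n w B t) \<le> ennreal ((1 - r) ^ t * M)" by (rule order_trans[rotated])
  then show ?thesis using r M by (subst (asm) ennreal_le_iff) auto
qed

section \<open>Runtime bounds\<close>

text \<open>A concave function of the potential: below the threshold \<open>s\<close>, which is never exceeded without
  surplus, the drift is of order \<open>g / N\<^sup>2\<close>, and above it of order \<open>g / N\<close>.\<close>

definition time_bound :: "real \<Rightarrow> real \<Rightarrow> real \<Rightarrow> real" where
  "time_bound N s g =
     (if g < 1 then 0 else 6 * N\<^sup>2 * (1 + ln (min g s)) + 6 * N * (max 0 (g - s) / s))"

lemma time_bound_nonneg: "1 \<le> N \<Longrightarrow> 1 \<le> s \<Longrightarrow> 0 \<le> time_bound N s g"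
  by (auto simp: time_bound_def intro!: add_nonneg_nonneg mult_nonneg_nonneg)

lemma ln_le_tangent: "0 < x \<Longrightarrow> 0 < y \<Longrightarrow> ln y \<le> ln x + (y - x) / (x::real)"
  using ln_le_minus_one[of "y / x"] by (simp add: ln_div diff_divide_distrib)

lemma time_bound_tangent_small:
  assumes N: "1 \<le> N" and g: "1 \<le> g" "g \<le> s" and g': "0 \<le> g'"
  shows "time_bound N s g' \<le> time_bound N s g + 6 * N\<^sup>2 / g * (g' - g)"
proof -
  have tb: "time_bound N s g = 6 * N\<^sup>2 * (1 + ln g)" using g by (simp add: time_bound_def)
  have eq: "time_bound N s g + 6 * N\<^sup>2 / g * (g' - g) = 6 * N\<^sup>2 * (1 + ln g + (g' - g) / g)"
    unfolding tb by (simp add: distrib_left)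
  consider "g' < 1" | "1 \<le> g'" "g' \<le> s" | "s < g'" by linarith
  then have "time_bound N s g' \<le> 6 * N\<^sup>2 * (1 + ln g + (g' - g) / g)"
  proof cases
    case 1
    have "0 \<le> 1 + ln g + (g' - g) / g" using g g' by (simp add: diff_divide_distrib)
    then show ?thesis using 1 by (simp add: time_bound_def)
  next
    case 2
    have "1 + ln g' \<le> 1 + ln g + (g' - g) / g" using ln_le_tangent[of g g'] g 2 by simp
    then have "6 * N\<^sup>2 * (1 + ln g') \<le> 6 * N\<^sup>2 * (1 + ln g + (g' - g) / g)"
      by (intro mult_left_mono) auto
    then show ?thesis using 2 by (simp add: time_bound_def)
  next
    case 3
    have "(g' - s) / s \<le> (g' - s) / g" using g 3 by (intro divide_left_mono) auto
    then have "N * ((g' - s) / s) \<le> N\<^sup>2 * ((g' - s) / g)"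
      using N 3 g by (intro mult_mono) (auto simp: power2_eq_square)
    moreover have "N\<^sup>2 * (1 + ln s) \<le> N\<^sup>2 * (1 + (ln g + (s - g) / g))"
      using ln_le_tangent[of g s] g by (intro mult_left_mono) auto
    ultimately have "N\<^sup>2 * (1 + ln s) + N * ((g' - s) / s) \<le> N\<^sup>2 * (1 + (ln g + (s - g) / g)) + N\<^sup>2 * ((g' - s) / g)"
      by (rule add_mono[rotated])
    also have "\<dots> = N\<^sup>2 * (1 + ln g + (g' - g) / g)"
      by (simp add: distrib_left diff_divide_distrib right_diff_distrib)
    finally show ?thesis using 3 g by (simp add: time_bound_def)
  qed
  then show ?thesis unfolding eq .
qed

lemma time_bound_tangent_large:
  assumes N: "1 \<le> N" and s: "1 \<le> s" and g: "s \<le> g" and g': "0 \<le> g'"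
  shows "time_bound N s g' \<le> time_bound N s g + 6 * N / s * (g' - g)"
proof -
  have tb: "time_bound N s g = 6 * N\<^sup>2 * (1 + ln s) + 6 * N * ((g - s) / s)"
    using g s by (simp add: time_bound_def)
  have eq: "time_bound N s g + 6 * N / s * (g' - g) = 6 * N\<^sup>2 * (1 + ln s) + 6 * N * ((g' - s) / s)"
    unfolding tb by (simp add: diff_divide_distrib algebra_simps)
  have N2: "N \<le> N\<^sup>2" using N by (simp add: power2_eq_square)
  consider "g' < 1" | "1 \<le> g'" "g' \<le> s" | "s < g'" by linarith
  then have "time_bound N s g' \<le> 6 * N\<^sup>2 * (1 + ln s) + 6 * N * ((g' - s) / s)"
  proof cases
    case 1
    have "N * 1 \<le> N\<^sup>2 * (1 + ln s)" using N N2 s by (intro mult_mono) auto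
    moreover have "0 \<le> N * (g' / s)" using N g' s by auto
    ultimately have "0 \<le> 6 * N\<^sup>2 * (1 + ln s) + 6 * N * ((g' - s) / s)"
      using s by (simp add: diff_divide_distrib right_diff_distrib)
    then show ?thesis using 1 by (simp add: time_bound_def)
  next
    case 2
    have "ln g' \<le> ln s + (g' - s) / s" using ln_le_tangent[of s g'] s 2 by simp
    then have "N\<^sup>2 * ln g' \<le> N\<^sup>2 * (ln s + (g' - s) / s)" by (intro mult_left_mono) auto
    moreover have "N\<^sup>2 * ((g' - s) / s) \<le> N * ((g' - s) / s)"
      using N2 2 s by (intro mult_right_mono_neg) (auto simp: divide_nonpos_pos)
    ultimately have "N\<^sup>2 * ln g' \<le> N\<^sup>2 * ln s + N * ((g' - s) / s)" by (simp add: distrib_left)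
    then show ?thesis using 2 by (simp add: time_bound_def distrib_left)
  next
    case 3
    then show ?thesis using s by (simp add: time_bound_def)
  qed
  then show ?thesis unfolding eq .
qed

lemma time_bound_le:
  assumes N: "1 \<le> N" and s: "1 \<le> s" and g: "g \<le> N * s"
  shows "time_bound N s g \<le> 6 * N\<^sup>2 * (2 + ln s)"
proof (cases "g < 1")
  case True
  then show ?thesis using s by (simp add: time_bound_def)
next
  case False
  have "N\<^sup>2 * ln (min g s) \<le> N\<^sup>2 * ln s" using s False by (intro mult_left_mono) auto
  moreover have "max 0 (g - s) / s \<le> N" using g s N by (auto simp: pos_divide_le_eq)
  then have "N * (max 0 (g - s) / s) \<le> N * N" using N by (intro mult_left_mono) auto
  ultimately show ?thesis using False by (simp add: time_bound_def power2_eq_square distrib_left)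
qed

context ea_potential
begin

definition misplaced :: "(nat \<Rightarrow> bool) \<Rightarrow> nat set" where
  "misplaced x = {i \<in> {1..n}. x i \<noteq> (i \<le> B)}"

lemma misplaced_subset: "misplaced x \<subseteq> {1..n}"
  by (auto simp: misplaced_def)

lemma misplaced_flip: "F \<subseteq> {1..n} \<Longrightarrow> misplaced (mutate x F) = flip (misplaced x) F"
  by (auto simp: misplaced_def flip_def mutate_def)

lemma sum_misplaced:
  "(\<Sum>i\<in>{1..n}. if x i then h i else 0) = (\<Sum>i\<in>{1..B}. h i) + (\<Sum>i\<in>misplaced x. side i * h i)"
proof -
  have "(\<Sum>i\<in>{1..n}. if x i then h i else 0)
     = (\<Sum>i\<in>{1..n}. (if i \<in> {1..B} then h i else 0) + (if i \<in> misplaced x then side i * h i else 0))"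
    by (intro sum.cong) (auto simp: misplaced_def side_def)
  also have "\<dots> = (\<Sum>i\<in>{1..n} \<inter> {1..B}. h i) + (\<Sum>i\<in>{1..n} \<inter> misplaced x. side i * h i)"
    by (simp only: sum.distrib sum.inter_restrict finite_atLeastAtMost)
  also have "{1..n} \<inter> {1..B} = {1..B}" using B_le_n by auto
  also have "{1..n} \<inter> misplaced x = misplaced x" using misplaced_subset by blast
  finally show ?thesis .
qed

lemma ones_eq: "real (ones n x) = real B + surplus (misplaced x)"
proof -
  have "real (ones n x) = (\<Sum>i\<in>{1..n}. if x i then 1 else 0)"
    unfolding ones_def by (simp add: sum.If_cases Int_def)
  then show ?thesis using sum_misplaced[of x "\<lambda>_. 1"] by (simp add: surplus_def)
qed

lemma f_obj_eq: "f_obj n w x = (\<Sum>i\<in>{1..B}. w i) + cost (misplaced x)"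
proof -
  have "(\<Sum>i\<in>misplaced x. side i * w i) = (\<Sum>i\<in>misplaced x. gap i + side i * w B)"
  proof (rule sum.cong[OF refl])
    fix i assume "i \<in> misplaced x"
    then have "w i = w B + side i * gap i" using side_gap[of i] misplaced_subset[of x] by auto
    then show "side i * w i = gap i + side i * w B" using side_pm[of i] by auto
  qed
  then show ?thesis
    unfolding f_obj_def sum_misplaced by (simp add: cost_def surplus_def sum.distrib sum_distrib_right)
qed

lemma feasible_iff: "B \<le> ones n x \<longleftrightarrow> 0 \<le> surplus (misplaced x)"
  using ones_eq[of x] by linarith

lemma f_obj_nonneg: "0 \<le> f_obj n w x"
  unfolding f_obj_def using w_pos by (intro sum_nonneg) (auto intro: less_imp_le)

lemma f_obj_le: "f_obj n w x \<le> real n * w n"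
proof -
  have "f_obj n w x \<le> (\<Sum>i\<in>{1..n}. w n)"
    unfolding f_obj_def
  proof (rule sum_mono)
    fix i assume "i \<in> {1..n}"
    then show "(if x i then w i else 0) \<le> w n" using w_mono[of i n] w_pos[of n] by auto
  qed
  then show ?thesis by simp
qed

lemma f_pen_feasible: "B \<le> ones n x \<Longrightarrow> f_pen n w B x = f_obj n w x"
  by (simp add: f_pen_def)

lemma penalty_pos: "0 < real n * w n + 1"
  using w_pos[of n] n_ge1 by (intro add_nonneg_pos mult_nonneg_nonneg) auto

lemma f_pen_infeasible:
  "ones n x < B \<Longrightarrow> f_pen n w B x = f_obj n w x + (real B - real (ones n x)) * (real n * w n + 1)"
  by (simp add: f_pen_def)

lemma infeasible_f_pen_gt:
  assumes "ones n y < B" "ones n y < ones n x"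
  shows "f_pen n w B x < f_pen n w B y"
proof -
  let ?K = "real n * w n + 1"
  have "max 0 (real B - real (ones n x)) + 1 \<le> real B - real (ones n y)" using assms by linarith
  then have "(max 0 (real B - real (ones n x)) + 1) * ?K \<le> (real B - real (ones n y)) * ?K"
    using penalty_pos by (intro mult_right_mono) auto
  moreover have "f_obj n w x < ?K" using f_obj_le[of x] by simp
  moreover have "a + p < b + q" if "(m + 1) * k \<le> q" "a < k" "0 \<le> b" "p = m * k" for a b p q m k :: real
    using that by (simp add: distrib_right)
  ultimately show ?thesis
    using f_obj_nonneg[of y] unfolding f_pen_infeasible[OF assms(1)] f_pen_def[of n w B x] by blast
qed

lemma accepted_iff:
  assumes x: "B \<le> ones n x" and F: "F \<subseteq> {1..n}"
  shows "f_pen n w B (mutate x F) \<le> f_pen n w B x \<longleftrightarrow> accepted (misplaced x) F"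
proof (cases "B \<le> ones n (mutate x F)")
  case True
  then show ?thesis
    using x F feasible_iff[of "mutate x F"]
    by (simp add: f_pen_feasible f_obj_eq accepted_def misplaced_flip)
next
  case False
  then show ?thesis
    using infeasible_f_pen_gt[of "mutate x F" x] x F feasible_iff[of "mutate x F"]
    by (simp add: accepted_def misplaced_flip)
qed

lemma next_feasible:
  assumes x: "B \<le> ones n x" and F: "F \<subseteq> {1..n}"
  shows "B \<le> ones n (ea_next n w B x F)"
    and "pot (misplaced (ea_next n w B x F)) = pot (misplaced x) - pot_drop (misplaced x) F"
proof -
  show "B \<le> ones n (ea_next n w B x F)"
    using accepted_iff[OF x F] x feasible_iff[of "mutate x F"] F
    by (auto simp: ea_next_def accepted_def misplaced_flip)
  show "pot (misplaced (ea_next n w B x F)) = pot (misplaced x) - pot_drop (misplaced x) F"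
    using accepted_iff[OF x F] F by (auto simp: ea_next_def pot_drop_def misplaced_flip)
qed

lemma pot_nonneg: "Y \<subseteq> {1..n} \<Longrightarrow> 0 \<le> surplus Y \<Longrightarrow> 0 \<le> pot Y"
  unfolding pot_def using val_nonneg top_phi_ge1
  by (intro add_nonneg_nonneg sum_nonneg mult_nonneg_nonneg) auto

lemma pot_le:
  assumes Y: "Y \<subseteq> {1..n}"
  shows "pot Y \<le> 2 * real n * exp 288"
proof -
  have "card Y \<le> card {1..n}" using Y by (intro card_mono) auto
  then have c: "real (card Y) \<le> real n" by simp
  have "sum val Y \<le> real (card Y) * exp 288" using val_le_exp Y by (intro sum_bounded_above) auto
  also have "\<dots> \<le> real n * exp 288" using c by (intro mult_right_mono) auto
  finally have 1: "sum val Y \<le> real n * exp 288" .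
  have "surplus Y \<le> real n" using abs_surplus_le[of Y] c by linarith
  then have "surplus Y * top_phi \<le> real n * top_phi" using top_phi_ge1 by (intro mult_right_mono) auto
  also have "\<dots> \<le> real n * exp 288" using phi_le[OF wB_level] by (intro mult_left_mono) auto
  finally show ?thesis using 1 by (simp add: pot_def)
qed

lemma pot_le_tight:
  assumes Y: "Y \<subseteq> {1..n}" and s: "surplus Y = 0"
  shows "pot Y \<le> 2 * real B * exp 288"
proof -
  have fin: "finite Y" using Y finite_bits by simp
  let ?YH = "{i \<in> Y. \<not> i \<le> B}" and ?YL = "{i \<in> Y. i \<le> B}"
  have "Y = ?YH \<union> ?YL" by auto
  moreover have "card (?YH \<union> ?YL) = card ?YH + card ?YL" using fin by (intro card_Un_disjoint) auto
  moreover have "card ?YH = card ?YL" using surplus_eq[OF fin] s by simp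
  moreover have "card ?YL \<le> card {1..B}" using Y by (intro card_mono) auto
  ultimately have "card Y \<le> 2 * B" by simp
  then have "real (card Y) \<le> 2 * real B" by linarith
  moreover have "sum val Y \<le> real (card Y) * exp 288" using val_le_exp Y by (intro sum_bounded_above) auto
  moreover have "real (card Y) * exp 288 \<le> 2 * real B * exp 288" using calculation(1) by (intro mult_right_mono) auto
  ultimately have "sum val Y \<le> 2 * real B * exp 288" by linarith
  then show ?thesis using s by (simp add: pot_def)
qed

lemma cost_nonneg: "0 \<le> surplus Y \<Longrightarrow> 0 \<le> cost Y"
  unfolding cost_def using wB_pos by (intro add_nonneg_nonneg sum_nonneg mult_nonneg_nonneg) auto

lemma pot_ge1:
  assumes x: "x \<in> search_space n" "B \<le> ones n x" and no: "\<not> optimal n w B x"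
  shows "1 \<le> pot (misplaced x)"
proof (rule ccontr)
  let ?Y = "misplaced x"
  have Y: "?Y \<subseteq> {1..n}" by (rule misplaced_subset)
  assume "\<not> 1 \<le> pot ?Y"
  then have less: "pot ?Y < 1" by simp
  have nn: "0 \<le> val i" if "i \<in> ?Y" for i using val_nonneg Y that by blast
  have s0: "surplus ?Y = 0"
  proof (rule ccontr)
    assume "surplus ?Y \<noteq> 0"
    then have "1 \<le> surplus ?Y" using ones_eq[of x] x(2) by (cases "ones n x = B") auto
    then have "1 * 1 \<le> surplus ?Y * top_phi" using top_phi_ge1 by (intro mult_mono) auto
    then show False using less sum_nonneg[of ?Y val] nn by (simp add: pot_def)
  qed
  have "gap i = 0" if i: "i \<in> ?Y" for i
  proof (rule ccontr)
    assume "gap i \<noteq> 0"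
    then have "1 \<le> val i" using val_ge1[of i] i Y gap_nonneg[of i] by (auto simp: less_le)
    also have "val i \<le> sum val ?Y" using i nn Y finite_bits by (intro member_le_sum) auto
    finally show False using less s0 by (simp add: pot_def)
  qed
  then have "cost ?Y = 0" using s0 by (simp add: cost_def)
  then have "f_obj n w x \<le> f_obj n w y" if "B \<le> ones n y" for y
    using that feasible_iff[of y] cost_nonneg[of "misplaced y"] by (simp add: f_obj_eq)
  then show False using no x by (simp add: optimal_def)
qed

lemma feasible_drift:
  assumes x: "B \<le> ones n x"
  shows "mutation_mean n (\<lambda>F. pot (misplaced (ea_next n w B x F)))
      \<le> pot (misplaced x) - pot (misplaced x) / (6 * (real n)\<^sup>2)"
    and "2 * real B * exp 288 < pot (misplaced x) \<Longrightarrow>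
      mutation_mean n (\<lambda>F. pot (misplaced (ea_next n w B x F)))
      \<le> pot (misplaced x) - pot (misplaced x) / (6 * real n)"
proof -
  let ?Y = "misplaced x"
  have Y: "?Y \<subseteq> {1..n}" by (rule misplaced_subset)
  have "mutation_mean n (\<lambda>F. pot (misplaced (ea_next n w B x F)))
      \<le> mutation_mean n (\<lambda>F. pot ?Y - pot_drop ?Y F)"
    using next_feasible(2)[OF x] by (intro mutation_mean_mono) auto
  then have le: "mutation_mean n (\<lambda>F. pot (misplaced (ea_next n w B x F)))
      \<le> pot ?Y - mutation_mean n (pot_drop ?Y)"
    by (simp add: mutation_mean_diff mutation_mean_const)
  have slack: "pot ?Y / (6 * real n) \<le> mutation_mean n (pot_drop ?Y)" if "surplus ?Y \<noteq> 0"
  proof (rule slack_drift[OF Y])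
    show "1 \<le> surplus ?Y" using that ones_eq[of x] x by (cases "ones n x = B") auto
  qed
  show "mutation_mean n (\<lambda>F. pot (misplaced (ea_next n w B x F)))
      \<le> pot ?Y - pot ?Y / (6 * (real n)\<^sup>2)"
  proof (cases "surplus ?Y = 0")
    case True
    then show ?thesis using tight_drift[OF Y] le by simp
  next
    case False
    have "6 * real n \<le> 6 * (real n)\<^sup>2" using n_ge1 by (simp add: power2_eq_square)
    then have "pot ?Y / (6 * (real n)\<^sup>2) \<le> pot ?Y / (6 * real n)"
      using pot_nonneg[OF Y] feasible_iff[of x] x n_ge1 by (intro divide_left_mono) auto
    then show ?thesis using slack[OF False] le by linarith
  qed
  assume "2 * real B * exp 288 < pot ?Y"
  then have "surplus ?Y \<noteq> 0" using pot_le_tight[OF Y] by fastforce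
  then show "mutation_mean n (\<lambda>F. pot (misplaced (ea_next n w B x F))) \<le> pot ?Y - pot ?Y / (6 * real n)"
    using slack le by linarith
qed

definition deficit :: "(nat \<Rightarrow> bool) \<Rightarrow> real" where
  "deficit x = max 0 (real B - real (ones n x))"

lemma infeasible_drift:
  assumes x: "ones n x < B"
  shows "mutation_mean n (\<lambda>F. deficit (ea_next n w B x F)) \<le> deficit x - deficit x / (3 * real n)"
proof -
  have mono: "deficit (ea_next n w B x F) \<le> deficit x" for F
  proof (cases "ones n (mutate x F) < ones n x")
    case True
    then have "ea_next n w B x F = x"
      using infeasible_f_pen_gt[OF _ True] x by (simp add: ea_next_def)
    then show ?thesis by simp
  next
    case False
    then show ?thesis by (auto simp: deficit_def ea_next_def)
  qed
  let ?Z = "{l \<in> {1..n}. \<not> x l}" and ?h = "\<lambda>F. deficit x - deficit (ea_next n w B x F)"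
  have dx: "deficit x = real B - real (ones n x)" using x by (simp add: deficit_def)
  have cardZ: "deficit x \<le> real (card ?Z)"
  proof -
    have eq: "{1..n} = ?Z \<union> {i \<in> {1..n}. x i}" by auto
    have "n = card {1..n}" by simp
    also have "\<dots> = card (?Z \<union> {i \<in> {1..n}. x i})" using eq by (rule arg_cong)
    also have "\<dots> = card ?Z + ones n x" unfolding ones_def by (intro card_Un_disjoint) auto
    finally show ?thesis using dx B_le_n by linarith
  qed
  have gain: "1 \<le> ?h {l}" if l: "l \<in> ?Z" for l
  proof -
    let ?y = "mutate x {l}"
    have "{i \<in> {1..n}. ?y i} = insert l {i \<in> {1..n}. x i}" using l by (auto simp: mutate_def)
    then have ones: "ones n ?y = Suc (ones n x)" using l by (simp add: ones_def)
    then have "f_pen n w B ?y < f_pen n w B x" using infeasible_f_pen_gt[of x ?y] x by simp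
    then have "ea_next n w B x {l} = ?y" by (simp add: ea_next_def)
    then have "deficit (ea_next n w B x {l}) = deficit ?y" by simp
    also have "\<dots> = deficit x - 1" using ones x dx by (simp add: deficit_def)
    finally show ?thesis by simp
  qed
  have "1 / real n * deficit x \<le> 1 / real n * real (card ?Z)" using cardZ by (intro mult_left_mono) auto
  also have "\<dots> = (\<Sum>l\<in>?Z. 1 / real n * 1)" by simp
  also have "\<dots> \<le> (\<Sum>l\<in>?Z. (1 / real n) ^ card {l} * ?h {l})"
  proof (rule sum_mono)
    fix l assume "l \<in> ?Z"
    then have "1 / real n * 1 \<le> 1 / real n * ?h {l}" using gain by (intro mult_left_mono) auto
    then show "1 / real n * 1 \<le> (1 / real n) ^ card {l} * ?h {l}" by simp
  qed
  also have "\<dots> = (\<Sum>F\<in>(\<lambda>l. {l}) ` ?Z. (1 / real n) ^ card F * ?h F)"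
    by (subst sum.reindex) (auto simp: inj_on_def)
  finally have "1 / real n * deficit x / 3 \<le> (\<Sum>F\<in>(\<lambda>l. {l}) ` ?Z. (1 / real n) ^ card F * ?h F) / 3"
    by (intro divide_right_mono) auto
  also have "\<dots> \<le> mutation_mean n ?h"
    using mono by (intro mutation_mean_ge_sum[OF n_ge1]) auto
  also have "\<dots> = deficit x - mutation_mean n (\<lambda>F. deficit (ea_next n w B x F))"
    by (simp add: mutation_mean_diff mutation_mean_const)
  finally show "mutation_mean n (\<lambda>F. deficit (ea_next n w B x F)) \<le> deficit x - deficit x / (3 * real n)"
    by (simp add: mult.commute)
qed

lemma deficit_le: "deficit x \<le> real n" and deficit_nonneg: "0 \<le> deficit x"
  using B_le_n by (auto simp: deficit_def)

lemma expected_time_le: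
  "expected_time n w B \<le> ennreal (6 * (real n)\<^sup>2 * (3 + ln (2 * real B * exp 288)))"
proof -
  define N where "N = real n"
  define gs where "gs = 2 * real B * exp 288"
  define Vm where "Vm = 6 * N\<^sup>2 * (2 + ln gs)"
  define V where "V x = (if B \<le> ones n x then time_bound N gs (pot (misplaced x)) else Vm + 3 * N * deficit x)" for x
  have N1: "1 \<le> N" using n_ge1 by (simp add: N_def)
  have "1 * 1 \<le> 2 * real B * exp 288" using B_ge1 by (intro mult_mono) auto
  then have gs1: "1 \<le> gs" by (simp add: gs_def)
  have tb: "time_bound N gs (pot (misplaced x)) \<le> Vm" for x
  proof -
    have "pot (misplaced x) \<le> 2 * real n * exp 288" by (rule pot_le[OF misplaced_subset])
    also have "\<dots> = 2 * (real n * 1) * exp 288" by simp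
    also have "\<dots> \<le> 2 * (real n * real B) * exp 288"
      using B_ge1 by (intro mult_right_mono mult_left_mono) auto
    also have "\<dots> = N * gs" by (simp add: N_def gs_def)
    finally show ?thesis unfolding Vm_def by (rule time_bound_le[OF N1 gs1])
  qed
  have Vm0: "0 \<le> Vm" unfolding Vm_def using gs1 by (intro mult_nonneg_nonneg add_nonneg_nonneg) auto
  have V_le: "V x \<le> Vm + 3 * N * deficit x" for x
  proof -
    have "0 \<le> 3 * N * deficit x" using N1 deficit_nonneg[of x] by simp
    then show ?thesis using tb[of x] by (simp add: V_def)
  qed
  have "expected_time n w B \<le> ennreal (Vm + 3 * N * N)"
  proof (rule expected_time_le_additive_drift[where V = V])
    fix x assume x: "x \<in> search_space n"
    show "0 \<le> V x"
      using time_bound_nonneg[OF N1 gs1] Vm0 N1 deficit_nonneg[of x] by (auto simp: V_def)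
    have "3 * N * deficit x \<le> 3 * N * N" using deficit_le[of x] N1 by (intro mult_left_mono) (auto simp: N_def)
    then show "V x \<le> Vm + 3 * N * N" using V_le[of x] by linarith
    assume no: "\<not> optimal n w B x"
    show "mutation_mean n (\<lambda>F. V (ea_next n w B x F)) \<le> V x - 1"
    proof (cases "B \<le> ones n x")
      case False
      have "mutation_mean n (\<lambda>F. V (ea_next n w B x F))
          \<le> mutation_mean n (\<lambda>F. Vm + 3 * N * deficit (ea_next n w B x F))"
        using V_le by (intro mutation_mean_mono)
      also have "\<dots> = Vm + 3 * N * mutation_mean n (\<lambda>F. deficit (ea_next n w B x F))"
        by (simp add: mutation_mean_add mutation_mean_const mutation_mean_cmult)
      also have "\<dots> \<le> Vm + 3 * N * (deficit x - deficit x / (3 * N))"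
        using infeasible_drift[of x] False N1 by (intro add_left_mono mult_left_mono) (auto simp: N_def)
      also have "\<dots> = Vm + 3 * N * deficit x - deficit x"
        using N1 by (simp add: right_diff_distrib)
      also have "\<dots> \<le> V x - 1" using False by (simp add: V_def deficit_def)
      finally show ?thesis .
    next
      case True
      define g where "g = pot (misplaced x)"
      have g1: "1 \<le> g" unfolding g_def by (rule pot_ge1[OF x True no])
      have Vx: "V x = time_bound N gs g" using True by (simp add: V_def g_def)
      let ?m = "mutation_mean n (\<lambda>F. pot (misplaced (ea_next n w B x F)))"
      have key: ?thesis
        if tangent: "\<And>g'. 0 \<le> g' \<Longrightarrow> time_bound N gs g' \<le> time_bound N gs g + c * (g' - g)"
          and c: "c * (?m - g) \<le> - 1" for c
      proof -
        have "mutation_mean n (\<lambda>F. V (ea_next n w B x F))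
            \<le> mutation_mean n (\<lambda>F. V x + c * (pot (misplaced (ea_next n w B x F)) - g))"
        proof (rule mutation_mean_mono)
          fix F assume F: "F \<subseteq> {1..n}"
          have feas: "B \<le> ones n (ea_next n w B x F)" by (rule next_feasible(1)[OF True F])
          then have "0 \<le> pot (misplaced (ea_next n w B x F))"
            using pot_nonneg[OF misplaced_subset] feasible_iff by simp
          then show "V (ea_next n w B x F) \<le> V x + c * (pot (misplaced (ea_next n w B x F)) - g)"
            using tangent feas Vx by (simp add: V_def)
        qed
        also have "\<dots> = V x + c * (?m - g)"
          by (simp only: mutation_mean_add mutation_mean_const mutation_mean_cmult mutation_mean_diff)
        finally show ?thesis using c by linarith
      qed
      show ?thesis
      proof (cases "g \<le> gs")
        case small: True
        show ?thesis
        proof (rule key[OF time_bound_tangent_small[OF N1 g1 small]])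
          have "?m - g \<le> - (g / (6 * N\<^sup>2))" using feasible_drift(1)[OF True] by (simp add: g_def N_def)
          then have "6 * N\<^sup>2 / g * (?m - g) \<le> 6 * N\<^sup>2 / g * - (g / (6 * N\<^sup>2))"
            using g1 by (intro mult_left_mono) auto
          also have "\<dots> = - 1" using g1 N1 by simp
          finally show "6 * N\<^sup>2 / g * (?m - g) \<le> - 1" .
        qed
      next
        case large: False
        show ?thesis
        proof (rule key[OF time_bound_tangent_large[OF N1 gs1]])
          show "gs \<le> g" using large by simp
          have "?m - g \<le> - (g / (6 * N))"
            using feasible_drift(2)[OF True] large by (simp add: g_def gs_def N_def)
          also have "\<dots> \<le> - (gs / (6 * N))" using large N1 by (simp add: divide_right_mono)
          finally have "6 * N / gs * (?m - g) \<le> 6 * N / gs * - (gs / (6 * N))"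
            using gs1 N1 by (intro mult_left_mono) auto
          also have "\<dots> = - 1" using gs1 N1 by simp
          finally show "6 * N / gs * (?m - g) \<le> - 1" .
        qed
      qed
    qed
  qed
  also have "Vm + 3 * N * N \<le> 6 * N\<^sup>2 * (3 + ln gs)"
    using N1 by (simp add: Vm_def power2_eq_square algebra_simps)
  then have "ennreal (Vm + 3 * N * N) \<le> ennreal (6 * N\<^sup>2 * (3 + ln gs))" by (rule ennreal_leI)
  finally show ?thesis by (simp add: N_def gs_def)
qed

lemma tail_prob_le:
  "tail_prob n w B t \<le> (1 - 1 / (6 * (real n)\<^sup>2)) ^ t * (4 * (real n)\<^sup>2 * exp 288)"
proof (rule tail_prob_le_multiplicative_drift)
  define N where "N = real n"
  define K where "K = 2 * N * exp 288"
  define V where "V x = (if B \<le> ones n x then pot (misplaced x) else K * (1 + deficit x))" for x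
  have N1: "1 \<le> N" using n_ge1 by (simp add: N_def)
  have N2: "1 \<le> N\<^sup>2" "N \<le> N\<^sup>2" using N1 one_le_power[of N 2] by (auto simp: power2_eq_square)
  show "0 \<le> 1 / (6 * (real n)\<^sup>2)" by simp
  show "1 / (6 * (real n)\<^sup>2) \<le> 1" using N2 by (simp add: N_def divide_le_eq)
  have "1 * 1 \<le> 2 * N * exp 288" using N1 by (intro mult_mono) auto
  then have K1: "1 \<le> K" by (simp add: K_def)
  have V_le: "V x \<le> K * (1 + deficit x)" for x
  proof -
    have "pot (misplaced x) \<le> K * 1" using pot_le[OF misplaced_subset] by (simp add: K_def N_def)
    also have "\<dots> \<le> K * (1 + deficit x)" using K1 deficit_nonneg[of x] by (intro mult_left_mono) auto
    finally show ?thesis by (simp add: V_def)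
  qed
  fix x assume x: "x \<in> search_space n"
  show "0 \<le> V x"
    using pot_nonneg[OF misplaced_subset] feasible_iff[of x] K1 deficit_nonneg[of x] by (auto simp: V_def)
  have "K * (1 + deficit x) \<le> K * (1 + N)"
    using K1 deficit_le[of x] by (intro mult_left_mono) (auto simp: N_def)
  also have "\<dots> \<le> K * (N + N)" using K1 N1 by (intro mult_left_mono) auto
  also have "\<dots> = 4 * (real n)\<^sup>2 * exp 288" by (simp add: K_def N_def power2_eq_square)
  finally show "V x \<le> 4 * (real n)\<^sup>2 * exp 288" using V_le[of x] by linarith
  assume no: "\<not> optimal n w B x"
  show "1 \<le> V x"
  proof (cases "B \<le> ones n x")
    case True
    then show ?thesis using pot_ge1[OF x True no] by (simp add: V_def)
  next
    case False
    have "1 * 1 \<le> K * (1 + deficit x)" using K1 deficit_nonneg[of x] by (intro mult_mono) auto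
    then show ?thesis using False by (simp add: V_def)
  qed
  show "mutation_mean n (\<lambda>F. V (ea_next n w B x F)) \<le> (1 - 1 / (6 * (real n)\<^sup>2)) * V x"
  proof (cases "B \<le> ones n x")
    case True
    have "mutation_mean n (\<lambda>F. V (ea_next n w B x F)) \<le> mutation_mean n (\<lambda>F. pot (misplaced (ea_next n w B x F)))"
      using next_feasible(1)[OF True] by (intro mutation_mean_mono) (auto simp: V_def)
    also have "\<dots> \<le> pot (misplaced x) - pot (misplaced x) / (6 * (real n)\<^sup>2)" by (rule feasible_drift(1)[OF True])
    also have "\<dots> = (1 - 1 / (6 * (real n)\<^sup>2)) * V x" using True by (simp add: V_def left_diff_distrib)
    finally show ?thesis .
  next
    case False
    then have d1: "1 \<le> deficit x" by (simp add: deficit_def)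
    have "mutation_mean n (\<lambda>F. V (ea_next n w B x F))
        \<le> mutation_mean n (\<lambda>F. K * (1 + deficit (ea_next n w B x F)))"
      using V_le by (intro mutation_mean_mono)
    also have "\<dots> = K * (1 + mutation_mean n (\<lambda>F. deficit (ea_next n w B x F)))"
      by (simp add: mutation_mean_add mutation_mean_const mutation_mean_cmult)
    also have "\<dots> \<le> K * (1 + (deficit x - deficit x / (3 * N)))"
      using infeasible_drift[of x] False K1 by (intro add_left_mono mult_left_mono) (auto simp: N_def)
    also have "\<dots> \<le> K * ((1 - 1 / (6 * N\<^sup>2)) * (1 + deficit x))"
    proof (rule mult_left_mono)
      have "(1 + deficit x) / (6 * N\<^sup>2) \<le> (2 * deficit x) / (6 * N\<^sup>2)" using d1 by (intro divide_right_mono) auto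
      also have "\<dots> = deficit x / (3 * N\<^sup>2)" by simp
      also have "\<dots> \<le> deficit x / (3 * N)" using d1 N1 N2 by (intro divide_left_mono) auto
      finally show "1 + (deficit x - deficit x / (3 * N)) \<le> (1 - 1 / (6 * N\<^sup>2)) * (1 + deficit x)"
        by (simp add: left_diff_distrib)
    qed (use K1 in simp)
    also have "\<dots> = (1 - 1 / (6 * (real n)\<^sup>2)) * V x" using False by (simp add: V_def N_def)
    finally show ?thesis .
  qed
qed simp

end

theorem theorem5:
  shows "(\<exists>C>0. \<forall>n w B. valid_instance n w B \<longrightarrow>
            expected_time n w B \<le> ennreal (C * real n ^ 2 * max 1 (ln (real B))))
       \<and> (\<forall>c>0::real. \<exists>C>0. \<exists>C'>0. \<forall>n w B. valid_instance n w B \<longrightarrow>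
            tail_prob n w B (nat \<lfloor>C * real n ^ 2 * ln (real n)\<rfloor>) \<le> C' * real n powr (- c))"
proof (intro conjI allI impI)
  have "expected_time n w B \<le> ennreal (6 * (293 + ln 2) * real n ^ 2 * max 1 (ln (real B)))"
    if valid: "valid_instance n w B" for n w B
  proof -
    interpret ea_instance n w B by standard (rule valid)
    obtain \<phi> \<kappa> where "ea_potential n w B \<phi> \<kappa>" using potential_exists by blast
    then interpret ea_potential n w B \<phi> \<kappa> .
    let ?L = "max 1 (ln (real B))"
    have ln0: "0 \<le> ln (2 :: real)" by simp
    have "3 + ln (2 * real B * exp 288) = 291 + ln 2 + ln (real B)"
      using B_ge1 by (simp add: ln_mult)
    also have "\<dots> \<le> (291 + ln 2) * ?L + ?L"
      using ln0 mult_left_mono[of 1 ?L "291 + ln 2"] by simp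
    also have "\<dots> \<le> (293 + ln 2) * ?L" by (simp add: distrib_right)
    finally have "6 * (real n)\<^sup>2 * (3 + ln (2 * real B * exp 288)) \<le> 6 * (real n)\<^sup>2 * ((293 + ln 2) * ?L)"
      by (intro mult_left_mono) auto
    then have "ennreal (6 * (real n)\<^sup>2 * (3 + ln (2 * real B * exp 288)))
        \<le> ennreal (6 * (293 + ln 2) * real n ^ 2 * ?L)"
      by (intro ennreal_leI) (simp only: mult_ac)
    then show ?thesis using expected_time_le by (rule order_trans[rotated])
  qed
  moreover have "0 < 6 * (293 + ln (2 :: real))" by (simp add: add_pos_pos)
  ultimately show "\<exists>C>0. \<forall>n w B. valid_instance n w B \<longrightarrow>
            expected_time n w B \<le> ennreal (C * real n ^ 2 * max 1 (ln (real B)))"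
    by blast
next
  fix c :: real assume c: "0 < c"
  define C where "C = 6 * (2 + c)"
  have "tail_prob n w B (nat \<lfloor>C * real n ^ 2 * ln (real n)\<rfloor>) \<le> (4 * exp 289) * real n powr (- c)"
    if valid: "valid_instance n w B" for n w B
  proof -
    interpret ea_instance n w B by standard (rule valid)
    obtain \<phi> \<kappa> where "ea_potential n w B \<phi> \<kappa>" using potential_exists by blast
    then interpret ea_potential n w B \<phi> \<kappa> .
    define t where "t = nat \<lfloor>C * real n ^ 2 * ln (real n)\<rfloor>"
    define r where "r = 1 / (6 * (real n)\<^sup>2)"
    have n1: "1 \<le> real n" using n_ge1 by simp
    have nsq: "1 \<le> (real n)\<^sup>2" using n1 by simp
    have "0 < r" using n1 by (simp add: r_def)
    moreover have "r \<le> 1"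
      unfolding r_def by (rule divide_le_eq_1_pos[THEN iffD2]) (use nsq in linarith)+
    ultimately have r: "0 < r" "r \<le> 1" by simp_all
    have "C * real n ^ 2 * ln (real n) - 1 \<le> real t" unfolding t_def by linarith
    then have "r * (C * real n ^ 2 * ln (real n) - 1) \<le> r * real t" using r by (intro mult_left_mono) auto
    moreover have "r * (C * real n ^ 2 * ln (real n) - 1) = (2 + c) * ln (real n) - r"
      using n1 by (simp add: r_def C_def field_simps)
    ultimately have rt: "(2 + c) * ln (real n) - 1 \<le> r * real t" using r by linarith
    have "(1 - r) ^ t \<le> exp (- r) ^ t"
      using exp_ge_add_one_self[of "- r"] r by (intro power_mono) auto
    also have "\<dots> = exp (- (r * real t))" by (simp add: mult.commute flip: exp_of_nat_mult)
    also have "\<dots> \<le> exp (1 + - (2 + c) * ln (real n))"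
      unfolding exp_le_cancel_iff mult_minus_left using rt by linarith
    also have "\<dots> = exp 1 * real n powr (- (2 + c))"
      using n1 by (simp add: exp_add powr_def)
    finally have "(1 - r) ^ t * (4 * (real n)\<^sup>2 * exp 288)
        \<le> exp 1 * real n powr (- (2 + c)) * (4 * (real n)\<^sup>2 * exp 288)"
      by (intro mult_right_mono) auto
    also have "\<dots> = 4 * (exp 1 * exp 288) * (real n powr (- (2 + c)) * real n powr 2)"
      using n1 by (simp add: powr_numeral)
    also have "\<dots> = 4 * exp 289 * real n powr (- c)"
      by (simp only: exp_add[symmetric] powr_add[symmetric]) simp
    finally show ?thesis using tail_prob_le[of t] unfolding t_def r_def by linarith
  qed
  moreover have "0 < C" "0 < 4 * exp (289 :: real)" using c by (auto simp: C_def)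
  ultimately show "\<exists>C>0. \<exists>C'>0. \<forall>n w B. valid_instance n w B \<longrightarrow>
            tail_prob n w B (nat \<lfloor>C * real n ^ 2 * ln (real n)\<rfloor>) \<le> C' * real n powr (- c)"
    by blast
qed

end
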